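(* Let $\Omega\subset\mathbb{R}^n$ be a bounded domain with smooth boundary and $\varphi$ a smooth function on $\partial\Omega$. Let $A\in C^2(\bar\Omega\times\mathbb{R}^n)$ be a symmetric $n\times n$ matrix valued function which is regular, and let $B\in C^2(\bar\Omega\times\mathbb{R}^n)$ be a scalar function with $\inf B>0$. Let $u\in C^4(\Omega)\cap C^2(\bar\Omega)$ be an elliptic solution of the Dirichlet problem $$\det\{D^2u-A(x,Du)\}=B(x,Du)\ \text{ in }\Omega,\qquad u=\varphi\ \text{ on }\partial\Omega .$$ Suppose also that there exists a subsolution $\underline u\in C^2(\bar\Omega)$ of the equation $\det\{D^2u-A(x,Du)\}=B(x,Du)$ in $\Omega$. Then $$\sup_\Omega|D^2u|\leqslant C\Big(1+\sup_{\partial\Omega}|D^2u|\Big),$$ where the constant $C$ depends only on $n, A, B, \Omega, \underline u$ and $\sup_\Omega(|u|+|Du|)$.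
   Context: $Du$ and $D^2u$ denote the gradient and Hessian of $u$; points of $\bar\Omega\times\mathbb{R}^n$ are written $(x,p)$. Repeated indices are summed from $1$ to $n$. The matrix function $A$ is called regular if $A_{ij,kl}(x,p)\xi_i\xi_j\eta_k\eta_l\geqslant 0$ for all $(x,p)\in\Omega\times\mathbb{R}^n$ and all $\xi,\eta\in\mathbb{R}^n$ with $\xi\perp\eta$, where $A_{ij,kl}=D^2_{p_kp_l}A_{ij}$. A solution $u\in C^2(\Omega)$ is called elliptic if the matrix $D^2u-A(x,Du)$ is positive definite in $\Omega$. A subsolution is a function $\underline u$ which is elliptic, i.e. $D^2\underline u-A(x,D\underline u)>0$ in $\Omega$, and satisfies $\det\{D^2\underline u-A(x,D\underline u)\}\geqslant B(x,D\underline u)$ in $\Omega$ (it need not be a strict subsolution). *)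

theory Defs
  imports "HOL-Analysis.Analysis"
begin

definition dir_deriv :: "'a::euclidean_space \<Rightarrow> ('a \<Rightarrow> 'b::real_normed_vector) \<Rightarrow> 'a \<Rightarrow> 'b" where
  "dir_deriv e f x = frechet_derivative f (at x) e"

text \<open>
  \<open>Ck_on k S f\<close> is the class \<open>C\<^sup>k(S)\<close>; it is meant for open \<open>S\<close> only.
\<close>

primrec Ck_on :: "nat \<Rightarrow> 'a::euclidean_space set \<Rightarrow> ('a \<Rightarrow> 'b::real_normed_vector) \<Rightarrow> bool" where
  "Ck_on 0 S f \<longleftrightarrow> continuous_on S f"
| "Ck_on (Suc k) S f \<longleftrightarrow>
     (\<forall>x\<in>S. f differentiable (at x)) \<and> (\<forall>e\<in>Basis. Ck_on k S (dir_deriv e f))"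

definition smooth_on :: "'a::euclidean_space set \<Rightarrow> ('a \<Rightarrow> 'b::real_normed_vector) \<Rightarrow> bool" where
  "smooth_on S f \<longleftrightarrow> (\<forall>k. Ck_on k S f)"

text \<open>
  For open \<open>S\<close>, \<open>Ck_closure k S f\<close> says that \<open>f\<close>, a function on the closure of \<open>S\<close>, is of class
  \<open>C\<^sup>k\<close> up to the boundary: it is continuous on the closure, it is of class \<open>C\<^sup>k\<close> in \<open>S\<close>, and all
  its partial derivatives of order at most \<open>k\<close> extend continuously from \<open>S\<close> to the closure. The
  function \<open>g\<close> below is such an extension; as it agrees with the derivative on the open set \<open>S\<close>, its
  own derivatives in \<open>S\<close> are the higher derivatives of \<open>f\<close>.
\<close>

primrec Ck_closure :: "nat \<Rightarrow> 'a::euclidean_space set \<Rightarrow> ('a \<Rightarrow> 'b::real_normed_vector) \<Rightarrow> bool" where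
  "Ck_closure 0 S f \<longleftrightarrow> continuous_on (closure S) f"
| "Ck_closure (Suc k) S f \<longleftrightarrow>
     continuous_on (closure S) f \<and> (\<forall>x\<in>S. f differentiable (at x)) \<and>
     (\<forall>e\<in>Basis. \<exists>g. (\<forall>x\<in>S. g x = dir_deriv e f x) \<and> Ck_closure k S g)"

text \<open>The continuous extension of \<open>f\<close> from an open set \<open>S\<close> to its closure, whenever there is one.\<close>

definition closure_ext :: "'a::metric_space set \<Rightarrow> ('a \<Rightarrow> 'b::metric_space) \<Rightarrow> 'a \<Rightarrow> 'b" where
  "closure_ext S f x = (if x \<in> S then f x else Lim (at x within S) f)"

text \<open>
  Smooth boundary: near each boundary point there is a smooth diffeomorphism \<open>\<psi>\<close> onto an open set
  carrying \<open>\<Omega>\<close> into an open half-space and the boundary of \<open>\<Omega>\<close> into its bounding hyperplane.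
\<close>

definition smooth_boundary :: "(real ^ 'n) set \<Rightarrow> bool" where
  "smooth_boundary \<Omega> \<longleftrightarrow>
     (\<forall>x\<in>frontier \<Omega>. \<exists>U (\<psi> :: real ^ 'n \<Rightarrow> real ^ 'n) i.
        open U \<and> x \<in> U \<and> inj_on \<psi> U \<and> open (\<psi> ` U) \<and>
        smooth_on U \<psi> \<and> smooth_on (\<psi> ` U) (inv_into U \<psi>) \<and>
        \<Omega> \<inter> U = {y\<in>U. \<psi> y $ i > 0} \<and> frontier \<Omega> \<inter> U = {y\<in>U. \<psi> y $ i = 0})"

definition smooth_bounded_domain :: "(real ^ 'n) set \<Rightarrow> bool" where
  "smooth_bounded_domain \<Omega> \<longleftrightarrow>
     open \<Omega> \<and> connected \<Omega> \<and> \<Omega> \<noteq> {} \<and> bounded \<Omega> \<and> smooth_boundary \<Omega>"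

text \<open>Smoothness on an arbitrary set: locally the restriction of a smooth function on an open set.\<close>

definition smooth_on_subset :: "(real ^ 'n) set \<Rightarrow> (real ^ 'n \<Rightarrow> real) \<Rightarrow> bool" where
  "smooth_on_subset T \<phi> \<longleftrightarrow>
     (\<forall>x\<in>T. \<exists>U g. open U \<and> x \<in> U \<and> smooth_on U g \<and> (\<forall>y\<in>T \<inter> U. g y = \<phi> y))"

definition grad :: "(real ^ 'n \<Rightarrow> real) \<Rightarrow> real ^ 'n \<Rightarrow> real ^ 'n" where
  "grad u x = (\<chi> i. dir_deriv (axis i 1) u x)"

definition hess :: "(real ^ 'n \<Rightarrow> real) \<Rightarrow> real ^ 'n \<Rightarrow> real ^ 'n ^ 'n" where
  "hess u x = (\<chi> i j. dir_deriv (axis i 1) (dir_deriv (axis j 1) u) x)"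

definition pos_definite :: "real ^ 'n ^ 'n \<Rightarrow> bool" where
  "pos_definite M \<longleftrightarrow> (\<forall>\<xi>. \<xi> \<noteq> 0 \<longrightarrow> \<xi> \<bullet> (M *v \<xi>) > 0)"

text \<open>
  Functions of \<open>(x, p)\<close> are functions on the product space; \<open>dp k\<close> is the partial derivative
  with respect to the component \<open>p\<^sub>k\<close>.
\<close>

definition dp :: "'n \<Rightarrow> ((real ^ 'n) \<times> (real ^ 'n) \<Rightarrow> real) \<Rightarrow> (real ^ 'n) \<times> (real ^ 'n) \<Rightarrow> real" where
  "dp k f z = dir_deriv (0, axis k 1) f z"

definition regular_on ::
  "(real ^ 'n) set \<Rightarrow> ((real ^ 'n) \<times> (real ^ 'n) \<Rightarrow> real ^ 'n ^ 'n) \<Rightarrow> bool" where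
  "regular_on \<Omega> A \<longleftrightarrow>
     (\<forall>x\<in>\<Omega>. \<forall>p \<xi> \<eta>. orthogonal \<xi> \<eta> \<longrightarrow>
        (\<Sum>i\<in>UNIV. \<Sum>j\<in>UNIV. \<Sum>k\<in>UNIV. \<Sum>l\<in>UNIV.
           dp k (dp l (\<lambda>z. A z $ i $ j)) (x, p) * \<xi> $ i * \<xi> $ j * \<eta> $ k * \<eta> $ l) \<ge> 0)"

definition MA_matrix ::
  "((real ^ 'n) \<times> (real ^ 'n) \<Rightarrow> real ^ 'n ^ 'n) \<Rightarrow> (real ^ 'n \<Rightarrow> real) \<Rightarrow> real ^ 'n \<Rightarrow> real ^ 'n ^ 'n" where
  "MA_matrix A u x = hess u x - A (x, grad u x)"

definition elliptic ::
  "(real ^ 'n) set \<Rightarrow> ((real ^ 'n) \<times> (real ^ 'n) \<Rightarrow> real ^ 'n ^ 'n) \<Rightarrow> (real ^ 'n \<Rightarrow> real) \<Rightarrow> bool" where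
  "elliptic \<Omega> A u \<longleftrightarrow> (\<forall>x\<in>\<Omega>. pos_definite (MA_matrix A u x))"

definition subsolution ::
  "(real ^ 'n) set \<Rightarrow> ((real ^ 'n) \<times> (real ^ 'n) \<Rightarrow> real ^ 'n ^ 'n) \<Rightarrow>
   ((real ^ 'n) \<times> (real ^ 'n) \<Rightarrow> real) \<Rightarrow> (real ^ 'n \<Rightarrow> real) \<Rightarrow> bool" where
  "subsolution \<Omega> A B v \<longleftrightarrow>
     elliptic \<Omega> A v \<and> (\<forall>x\<in>\<Omega>. det (MA_matrix A v x) \<ge> B (x, grad v x))"

definition dirichlet_solution ::
  "(real ^ 'n) set \<Rightarrow> ((real ^ 'n) \<times> (real ^ 'n) \<Rightarrow> real ^ 'n ^ 'n) \<Rightarrow>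
   ((real ^ 'n) \<times> (real ^ 'n) \<Rightarrow> real) \<Rightarrow> (real ^ 'n \<Rightarrow> real) \<Rightarrow> (real ^ 'n \<Rightarrow> real) \<Rightarrow> bool" where
  "dirichlet_solution \<Omega> A B \<phi> u \<longleftrightarrow>
     (\<forall>x\<in>\<Omega>. det (MA_matrix A u x) = B (x, grad u x)) \<and> (\<forall>x\<in>frontier \<Omega>. u x = \<phi> x)"

end

theory Submission
  imports Defs
begin

text \<open>
  Write \<open>W(x) = D\<^sup>2u - A(x,Du)\<close>, a positive definite symmetric matrix, and \<open>\<beta> = ln B\<close>, so that
  \<open>ln det W = \<beta>(x,Du)\<close>. The proof is a maximum principle argument for the function
    \<open>H(x,\<xi>) = ln (\<xi> \<bullet> W(x) \<xi>) + \<tau> |Du|\<^sup>2/2 + \<kappa> exp (K (v - u))\<close>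
  over points \<open>x\<close> and unit vectors \<open>\<xi>\<close>, where \<open>v\<close> is the subsolution. If the maximum is on the boundary,
  the estimate is immediate. At an interior maximum \<open>x0\<close>, let \<open>b\<close> be an orthonormal frame of
  eigenvectors of \<open>W(x0)\<close> with eigenvalues \<open>lam\<close>, the largest being \<open>lam m\<close>, and let \<open>L\<close> be
  the operator obtained by linearizing \<open>ln det W - \<beta>\<close> at \<open>u\<close>; its second-order part is
  \<open>\<Sum>i. (1 / lam i) D\<^sub>i\<^sub>i\<close>. With \<open>T = \<Sum>i. 1 / lam i\<close>, the three terms of \<open>H\<close> satisfy at \<open>x0\<close>,
  for constants \<open>C\<close> and \<open>\<epsilon> > 0\<close>, provided that \<open>lam m \<ge> 1\<close>:

  \<^item> \<open>L ln W\<^sub>m\<^sub>m \<ge> - C (1 + T + lam m)\<close> (\<open>elliptic_point.L_ln_W_ge\<close>). The equation is differentiated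
    twice in the direction \<open>b m\<close>. In the term \<open>(lam m)\<^sup>2 \<Sum>i. D\<^sub>p\<^sub>p A\<^sub>i\<^sub>i(b m, b m) / lam i\<close>, which would be
    too large, the summands with \<open>i \<noteq> m\<close> are nonnegative because \<open>A\<close> is regular, and the third derivatives of \<open>u\<close>
    have a sign, up to terms of lower order that arise from commuting \<open>D\<^sub>i W\<^sub>m\<^sub>m\<close> and \<open>D\<^sub>m W\<^sub>i\<^sub>m\<close>.
  \<^item> \<open>L (|Du|\<^sup>2/2) \<ge> lam m - C (1 + T)\<close> (\<open>elliptic_point.L_psq_ge\<close>).
  \<^item> \<open>L exp (K (v - u)) \<ge> \<epsilon> T - C\<close> (\<open>elliptic_point.L_barrier\<close>). Since \<open>det (D\<^sup>2v - A(x,Dv)) \<ge> inf B > 0\<close>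
    and \<open>v\<close> has bounded second derivatives, \<open>D\<^sup>2v - A(x,Dv)\<close> is uniformly positive. Taylor's formula for
    \<open>A\<close> in \<open>p\<close> and the regularity of \<open>A\<close> leave only terms controlled by the square
    \<open>K \<Sum>i. (D\<^sub>i (v - u))\<^sup>2 / lam i\<close> that the exponential produces.

  As \<open>L H \<le> 0\<close> at the maximum, \<open>\<tau>\<close> is chosen so large that the second term dominates \<open>lam m\<close>, and then
  \<open>\<kappa>\<close> so large that the third dominates \<open>T\<close>; there remains a bound for \<open>lam m\<close>
  (\<open>elliptic_point.largest_eigenvalue_bound\<close>).

  The determinant is never differentiated. For a positive definite \<open>N\<close> one has \<open>ln det N \<le> trace N - n\<close>
  (\<open>ln_det_le_trace\<close>), and hence, after a change of frame, an upper bound for \<open>\<beta>(x,Du) = ln det W\<close> that is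
  an equality at \<open>x0\<close> (\<open>ln_det_le_sheared_frame\<close>). The first- and second-order conditions at this contact
  point are the once and twice differentiated equation, including the third-order terms that are needed
  (\<open>elliptic_point.second_order_comparison\<close>, \<open>elliptic_point.L_umm_ge\<close>).
\<close>

section \<open>Symmetric matrices: eigenframes and the determinant\<close>

lemma symmetric_matrix_inner:
  fixes M :: "real ^ 'n ^ 'n"
  assumes "transpose M = M"
  shows "x \<bullet> (M *v y) = y \<bullet> (M *v x)"
proof -
  have "x \<bullet> (M *v y) = (transpose M *v x) \<bullet> y"
    by (simp add: dot_lmul_matrix)
  then show ?thesis using assms by (simp add: inner_commute)
qed

text \<open>
  The first-order condition for a maximum of a quadratic form on a subspace, in algebraic form.
\<close>
lemma quadratic_small_imp_zero:
  fixes a c :: real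
  assumes "\<And>t. 2 * t * a \<le> t\<^sup>2 * c"
  shows "a = 0"
proof (rule ccontr)
  assume "a \<noteq> 0"
  define t where "t = a / (\<bar>c\<bar> + 1)"
  have pos: "\<bar>c\<bar> + 1 > 0" by simp
  have "2 * t * a \<le> t\<^sup>2 * c" by (rule assms)
  also have "\<dots> \<le> t\<^sup>2 * (\<bar>c\<bar> + 1)" by (intro mult_left_mono) auto
  also have "\<dots> = t * a" using pos by (simp add: t_def power2_eq_square)
  finally have "t * a \<le> 0" by (simp add: mult.commute)
  moreover have "t * a > 0"
    using \<open>a \<noteq> 0\<close> pos unfolding t_def by (simp add: zero_less_mult_iff zero_less_divide_iff) (auto simp: linorder_neq_iff)
  ultimately show False by simp
qed

text \<open>
  The quadratic form attains its maximum on the unit sphere of the subspace at an eigenvector.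
\<close>
lemma eigenvector_in_invariant_subspace:
  fixes M :: "real ^ 'n ^ 'n"
  assumes sym: "transpose M = M" and S: "subspace S" and inv: "\<And>x. x \<in> S \<Longrightarrow> M *v x \<in> S"
    and ne: "S \<noteq> {0}"
  obtains e l where "e \<in> S" "norm e = 1" "M *v e = l *\<^sub>R e"
proof -
  let ?K = "S \<inter> sphere 0 1"
  have "compact ?K"
    by (intro closed_Int_compact closed_subspace S compact_sphere)
  moreover have "?K \<noteq> {}"
  proof -
    from ne S obtain x where "x \<in> S" "x \<noteq> 0" using subspace_0 by blast
    then have "(1 / norm x) *\<^sub>R x \<in> ?K" using S by (simp add: subspace_scale)
    then show ?thesis by blast
  qed
  moreover have "continuous_on ?K (\<lambda>x. x \<bullet> (M *v x))"
    by (intro continuous_intros matrix_vector_mult_linear_continuous_on)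
  ultimately obtain e where e: "e \<in> ?K" and max: "\<And>x. x \<in> ?K \<Longrightarrow> x \<bullet> (M *v x) \<le> e \<bullet> (M *v e)"
    using continuous_attains_sup[of ?K "\<lambda>x. x \<bullet> (M *v x)"] by blast
  define l where "l = e \<bullet> (M *v e)"
  have eS: "e \<in> S" and e1: "norm e = 1" using e by auto
  have le: "x \<bullet> (M *v x) \<le> l * (x \<bullet> x)" if "x \<in> S" for x
  proof (cases "x = 0")
    case False
    have "(1 / norm x) *\<^sub>R x \<in> ?K" using False that S by (simp add: subspace_scale)
    from max[OF this] have "(x \<bullet> (M *v x)) / (norm x)\<^sup>2 \<le> l"
      by (simp add: l_def matrix_vector_mult_scaleR power2_eq_square field_simps)
    then show ?thesis using False by (simp add: field_simps power2_norm_eq_inner)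
  qed simp
  have orth: "y \<bullet> (M *v e) = 0" if y: "y \<in> S" "y \<bullet> e = 0" for y
  proof (rule quadratic_small_imp_zero)
    fix t :: real
    have "e + t *\<^sub>R y \<in> S" using S eS y by (simp add: subspace_add subspace_scale)
    from le[OF this] have "l + 2 * t * (y \<bullet> (M *v e)) + t\<^sup>2 * (y \<bullet> (M *v y)) \<le> l * (1 + t\<^sup>2 * (y \<bullet> y))"
      using y(2) e1 symmetric_matrix_inner[OF sym, of e y]
      by (simp add: matrix_vector_right_distrib matrix_vector_mult_scaleR inner_add inner_commute
          l_def[symmetric] power2_eq_square algebra_simps norm_eq_1)
    then show "2 * t * (y \<bullet> (M *v e)) \<le> t\<^sup>2 * (l * (y \<bullet> y) - y \<bullet> (M *v y))"
      by (simp add: algebra_simps)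
  qed
  define y where "y = M *v e - l *\<^sub>R e"
  have yS: "y \<in> S" unfolding y_def using S eS inv by (simp add: subspace_diff subspace_scale)
  have ye: "y \<bullet> e = 0" using e1 by (simp add: y_def l_def inner_diff inner_commute norm_eq_1)
  have "y \<bullet> y = y \<bullet> (M *v e)" using ye by (simp add: y_def inner_diff inner_commute)
  then have "y = 0" using orth[OF yS ye] by simp
  then show ?thesis using that[OF eS e1, of l] by (simp add: y_def)
qed

theorem symmetric_matrix_eigenbasis:
  fixes M :: "real ^ 'n ^ 'n"
  assumes sym: "transpose M = M"
  obtains b :: "'n \<Rightarrow> real ^ 'n" and l where
    "\<And>i j. b i \<bullet> b j = (if i = j then 1 else 0)" "\<And>i. M *v b i = l i *\<^sub>R b i"
proof -
  \<comment> \<open>An orthogonal set of unit eigenvectors of largest cardinality spans the whole space,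
    since its orthogonal complement is invariant.\<close>
  define \<E> where "\<E> = {E :: (real ^ 'n) set. pairwise orthogonal E \<and>
    (\<forall>e\<in>E. norm e = 1 \<and> (\<exists>l. M *v e = l *\<^sub>R e))}"
  have indep: "independent E" if "E \<in> \<E>" for E
    using that by (intro pairwise_orthogonal_independent) (auto simp: \<E>_def)
  have card_le: "card E \<le> CARD('n)" and fin: "finite E" if "E \<in> \<E>" for E
    using independent_card_le[OF indep[OF that]] independent_imp_finite[OF indep[OF that]] by auto
  have "{} \<in> \<E>" by (simp add: \<E>_def)
  then obtain E where E: "E \<in> \<E>" and max: "\<And>E'. E' \<in> \<E> \<Longrightarrow> card E' \<le> card E"
    using ex_has_greatest_nat[of "\<lambda>E. E \<in> \<E>" "{}" card "CARD('n) + 1"] card_le by (auto simp: less_Suc_eq_le)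
  have "span E = UNIV"
  proof (rule ccontr)
    assume ns: "span E \<noteq> UNIV"
    define S where "S = {x. \<forall>e\<in>E. orthogonal e x}"
    have S: "subspace S" unfolding S_def by (rule subspace_orthogonal_to_vectors)
    have "S \<noteq> {0}"
    proof -
      from ns have "span E \<subset> UNIV" by blast
      then obtain a where "a \<noteq> 0" "\<And>x. x \<in> span E \<Longrightarrow> orthogonal a x"
        by (metis orthogonal_to_subspace_exists_gen span_UNIV)
      then have "a \<in> S" by (auto simp: S_def orthogonal_commute span_base)
      then show ?thesis using \<open>a \<noteq> 0\<close> by blast
    qed
    moreover have "M *v x \<in> S" if "x \<in> S" for x
      unfolding S_def
    proof (clarify)
      fix e assume e: "e \<in> E"
      then obtain l where "M *v e = l *\<^sub>R e" using E by (auto simp: \<E>_def)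
      then show "orthogonal e (M *v x)" using that e symmetric_matrix_inner[OF sym, of e x]
        by (auto simp: S_def orthogonal_def inner_commute)
    qed
    ultimately obtain e l where e: "e \<in> S" "norm e = 1" "M *v e = l *\<^sub>R e"
      using eigenvector_in_invariant_subspace[OF sym S] by blast
    have "e \<notin> E" using e(1,2) by (auto simp: S_def orthogonal_def)
    moreover have "insert e E \<in> \<E>"
      using E e by (auto simp: \<E>_def S_def pairwise_insert orthogonal_commute)
    ultimately show False using max[of "insert e E"] fin[OF E] by simp
  qed
  then have "card E = CARD('n)"
    using indep[OF E] by (metis DIM_cart DIM_real dim_UNIV dim_eq_card_independent dim_span mult.right_neutral)
  then obtain b where b: "bij_betw b (UNIV :: 'n set) E"
    using fin[OF E] by (metis finite_class.finite_UNIV finite_same_card_bij)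
  have "\<forall>i. \<exists>l. M *v b i = l *\<^sub>R b i"
    using b E by (auto simp: \<E>_def bij_betw_def)
  then obtain l where l: "\<And>i. M *v b i = l i *\<^sub>R b i" by metis
  have "b i \<bullet> b j = (if i = j then 1 else 0)" for i j
  proof -
    have "b i \<in> E" "b j \<in> E" using b by (auto simp: bij_betw_def)
    moreover have "i \<noteq> j \<Longrightarrow> b i \<noteq> b j" using b by (auto simp: bij_betw_def inj_on_def)
    ultimately show ?thesis using E by (auto simp: \<E>_def pairwise_def orthogonal_def norm_eq_1)
  qed
  then show ?thesis using that l by blast
qed

text \<open>
  An orthonormal basis indexed by the coordinates, so that it is also an orthogonal matrix.
\<close>
definition orthonormal_frame :: "('n \<Rightarrow> real ^ 'n) \<Rightarrow> bool" where
  "orthonormal_frame b \<longleftrightarrow> (\<forall>i j. b i \<bullet> b j = (if i = j then 1 else 0))"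

lemma orthonormal_frame_inner:
  "orthonormal_frame b \<Longrightarrow> b i \<bullet> b j = (if i = j then 1 else 0)"
  by (simp add: orthonormal_frame_def)

lemma orthonormal_frame_matrix:
  fixes b :: "'n \<Rightarrow> real ^ 'n"
  assumes "orthonormal_frame b"
  shows "orthogonal_matrix (\<chi> r i. b i $ r)"
proof -
  have "transpose (\<chi> r i. b i $ r) ** (\<chi> r i. b i $ r) = (mat 1 :: real ^ 'n ^ 'n)"
    using assms by (auto simp: vec_eq_iff matrix_matrix_mult_def transpose_def mat_def
        orthonormal_frame_def inner_vec_def)
  then show ?thesis by (simp add: orthogonal_matrix)
qed

lemma orthonormal_frame_expand:
  fixes b :: "'n \<Rightarrow> real ^ 'n"
  assumes "orthonormal_frame b"
  shows "x = (\<Sum>i\<in>UNIV. (b i \<bullet> x) *\<^sub>R b i)"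
proof -
  let ?P = "(\<chi> r i. b i $ r) :: real ^ 'n ^ 'n"
  have "?P ** transpose ?P = mat 1"
    using orthonormal_frame_matrix[OF assms] by (simp add: orthogonal_matrix_def)
  then have "x = ?P *v (transpose ?P *v x)"
    by (metis matrix_vector_mul_assoc matrix_vector_mul_lid)
  also have "\<dots> = (\<Sum>i\<in>UNIV. (b i \<bullet> x) *\<^sub>R b i)"
    by (simp add: vec_eq_iff matrix_vector_mult_def transpose_def inner_vec_def mult.commute)
  finally show ?thesis .
qed

lemma orthonormal_frame_Parseval:
  fixes b :: "'n \<Rightarrow> real ^ 'n"
  assumes "orthonormal_frame b"
  shows "x \<bullet> y = (\<Sum>i\<in>UNIV. (b i \<bullet> x) * (b i \<bullet> y))"
  by (subst orthonormal_frame_expand[OF assms, of x]) (simp add: inner_sum_left)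

lemma orthonormal_frame_norm: "orthonormal_frame b \<Longrightarrow> norm (b i) = 1"
  by (simp add: orthonormal_frame_def norm_eq_1)

lemma conjugate_entry:
  fixes M Q :: "real ^ 'n ^ 'n"
  shows "(transpose Q ** M ** Q) $ i $ j = column i Q \<bullet> (M *v column j Q)"
proof -
  have "(transpose Q ** M ** Q) $ i $ j = (\<Sum>k\<in>UNIV. (\<Sum>r\<in>UNIV. Q$r$i * M$r$k) * Q$k$j)"
    by (simp add: matrix_matrix_mult_def transpose_def)
  also have "\<dots> = (\<Sum>k\<in>UNIV. \<Sum>r\<in>UNIV. Q$r$i * (M$r$k * Q$k$j))"
    by (simp add: sum_distrib_right mult.assoc)
  also have "\<dots> = (\<Sum>r\<in>UNIV. \<Sum>k\<in>UNIV. Q$r$i * (M$r$k * Q$k$j))"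
    by (rule sum.swap)
  also have "\<dots> = column i Q \<bullet> (M *v column j Q)"
    by (simp add: inner_vec_def matrix_vector_mult_def column_def sum_distrib_left)
  finally show ?thesis .
qed

lemma det_eq_prod_eigenvalues:
  fixes M :: "real ^ 'n ^ 'n"
  assumes b: "orthonormal_frame b" and M: "\<And>i. M *v b i = l i *\<^sub>R b i"
  shows "det M = (\<Prod>i\<in>UNIV. l i)"
proof -
  let ?P = "(\<chi> r i. b i $ r) :: real ^ 'n ^ 'n"
  have P: "orthogonal_matrix ?P" by (rule orthonormal_frame_matrix[OF b])
  have col: "column i ?P = b i" for i by (simp add: column_def vec_eq_iff)
  have "det (transpose ?P ** M ** ?P) = det (transpose ?P ** ?P) * det M"
    by (simp add: det_mul)
  also have "transpose ?P ** ?P = mat 1" using P by (simp add: orthogonal_matrix)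
  finally have "det M = det (transpose ?P ** M ** ?P)" by simp
  also have "\<dots> = (\<Prod>i\<in>UNIV. l i)"
    using b by (subst det_diagonal)
      (auto simp: conjugate_entry col M orthonormal_frame_def)
  finally show ?thesis .
qed

lemma pos_definite_eigenframe:
  fixes M :: "real ^ 'n ^ 'n"
  assumes "transpose M = M" "pos_definite M"
  obtains b l where "orthonormal_frame b" "\<And>i. M *v b i = l i *\<^sub>R b i" "\<And>i. l i > 0"
proof -
  obtain b :: "'n \<Rightarrow> real ^ 'n" and l where
    b: "\<And>i j. b i \<bullet> b j = (if i = j then 1 else 0)" and l: "\<And>i. M *v b i = l i *\<^sub>R b i"
    using symmetric_matrix_eigenbasis[OF assms(1)] by metis
  have "l i > 0" for i
  proof -
    have "b i \<noteq> 0" using b[of i i] by auto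
    then have "b i \<bullet> (M *v b i) > 0" using assms(2) by (simp add: pos_definite_def)
    then show ?thesis by (simp add: l b)
  qed
  then show ?thesis using that[of b l] b l by (auto simp: orthonormal_frame_def)
qed

lemma trace_eq_sum_eigenvalues:
  fixes M :: "real ^ 'n ^ 'n"
  assumes b: "orthonormal_frame b" and M: "\<And>i. M *v b i = l i *\<^sub>R b i"
  shows "trace M = (\<Sum>i\<in>UNIV. l i)"
proof -
  let ?P = "(\<chi> r i. b i $ r) :: real ^ 'n ^ 'n"
  have P: "?P ** transpose ?P = mat 1"
    using orthonormal_frame_matrix[OF b] by (simp add: orthogonal_matrix_def)
  have col: "column i ?P = b i" for i by (simp add: column_def vec_eq_iff)
  have "trace (transpose ?P ** M ** ?P) = trace M"
    using P by (metis matrix_mul_assoc matrix_mul_rid trace_mul_sym)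
  moreover have "trace (transpose ?P ** M ** ?P) = (\<Sum>i\<in>UNIV. l i)"
    using b by (simp add: trace_def conjugate_entry col M orthonormal_frame_def)
  ultimately show ?thesis by simp
qed

lemma ln_det_le_trace:
  fixes M :: "real ^ 'n ^ 'n"
  assumes "transpose M = M" "pos_definite M"
  shows "det M > 0" "ln (det M) \<le> trace M - CARD('n)"
proof -
  obtain b l where b: "orthonormal_frame b" and l: "\<And>i. M *v b i = l i *\<^sub>R b i" "\<And>i. l i > 0"
    using pos_definite_eigenframe[OF assms] by blast
  have det: "det M = (\<Prod>i\<in>UNIV. l i)" by (rule det_eq_prod_eigenvalues[OF b l(1)])
  show "det M > 0" unfolding det using l(2) by (simp add: prod_pos)
  have "ln (det M) = (\<Sum>i\<in>UNIV. ln (l i))" unfolding det using l(2) by (intro ln_prod) (auto simp: less_imp_neq[THEN not_sym])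
  also have "\<dots> \<le> (\<Sum>i\<in>UNIV. l i - 1)" using l(2) by (intro sum_mono ln_le_minus_one) auto
  also have "\<dots> = trace M - CARD('n)"
    by (simp add: trace_eq_sum_eigenvalues[OF b l(1)] sum_subtractf)
  finally show "ln (det M) \<le> trace M - CARD('n)" .
qed

text \<open>
  The matrix is the identity with \<open>c\<close> added to its row \<open>m\<close>.
\<close>
lemma det_row_perturbed_identity:
  fixes c :: "'n::finite \<Rightarrow> real"
  shows "det (\<chi> r i. (if r = i then 1 else 0) + (if r = m then c i else 0) :: real ^ 'n ^ 'n) = 1 + c m"
    (is "det ?U = _")
proof -
  let ?D = "(\<chi> r i. if r = i then (if r = m then 1 + c m else 1) else 0) :: real ^ 'n ^ 'n"
  let ?x = "(\<Sum>j\<in>UNIV - {m}. c j *s axis j 1) :: real ^ 'n"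
  have rowj: "row j ?D = axis j 1" if "j \<noteq> m" for j
    using that by (auto simp: row_def axis_def vec_eq_iff)
  have "?x \<in> vec.span {row j ?D |j. j \<noteq> m}"
  proof (intro vec.span_sum vec.span_scale vec.span_base)
    fix j assume "j \<in> UNIV - {m}"
    then show "axis j 1 \<in> {row j ?D |j. j \<noteq> m}" using rowj[of j] by force
  qed
  from det_row_span[OF this] have "det (\<chi> k. if k = m then row m ?D + ?x else row k ?D) = det ?D" .
  moreover have "?x $ i = (if i = m then 0 else c i)" for i
    by (simp add: axis_def if_distrib sum.delta cong: if_cong)
  then have "(\<chi> k. if k = m then row m ?D + ?x else row k ?D) = ?U"
    by (auto simp: vec_eq_iff row_def)
  moreover have "det ?D = (\<Prod>i\<in>UNIV. if i = m then 1 + c m else 1)"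
    by (subst det_diagonal) auto
  ultimately show ?thesis by simp
qed

text \<open>
  The trace bound applied to \<open>Q\<^sup>T M Q\<close>, where \<open>Q\<close> has the columns \<open>(b i + c i b m) / sqrt (l i)\<close>. If \<open>b\<close> is an
  eigenframe of \<open>M\<close> with eigenvalues \<open>l\<close>, equality holds for \<open>c = 0\<close>. Adding multiples of the one vector
  \<open>b m\<close> is enough to recover the third-order terms that the estimate uses, and keeps \<open>det Q\<close> explicit.
\<close>

lemma ln_det_le_sheared_frame:
  fixes M :: "real ^ 'n ^ 'n" and c :: "'n \<Rightarrow> real"
  assumes M: "transpose M = M" "pos_definite M" and b: "orthonormal_frame b"
    and l: "\<And>i. l i > 0" and c: "1 + c m > 0"
  shows "ln (det M) \<le> (\<Sum>i\<in>UNIV. (b i + c i *\<^sub>R b m) \<bullet> (M *v (b i + c i *\<^sub>R b m)) / l i)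
           - CARD('n) + (\<Sum>i\<in>UNIV. ln (l i)) - 2 * ln (1 + c m)"
proof -
  define q where "q i = (b i + c i *\<^sub>R b m)" for i
  let ?P = "(\<chi> r i. b i $ r) :: real ^ 'n ^ 'n"
  let ?U = "(\<chi> r i. (if r = i then 1 else 0) + (if r = m then c i else 0)) :: real ^ 'n ^ 'n"
  let ?D = "(\<chi> r i. if r = i then 1 / sqrt (l i) else 0) :: real ^ 'n ^ 'n"
  define Q where "Q = ?P ** ?U ** ?D"
  have PU: "(?P ** ?U) $ r $ i = q i $ r" for r i
  proof -
    have "(?P ** ?U) $ r $ i = (\<Sum>k\<in>UNIV. (if k = i then b k $ r else 0) + (if k = m then b k $ r * c i else 0))"
      unfolding matrix_matrix_mult_def by (auto intro!: sum.cong simp: algebra_simps)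
    then show ?thesis by (simp add: sum.distrib q_def)
  qed
  have Q: "Q $ r $ i = q i $ r / sqrt (l i)" for r i
  proof -
    have "Q $ r $ i = (\<Sum>k\<in>UNIV. (?P ** ?U) $ r $ k * ?D $ k $ i)"
      unfolding Q_def matrix_matrix_mult_def[of "?P ** ?U" ?D] by simp
    also have "\<dots> = (\<Sum>k\<in>UNIV. if k = i then q k $ r / sqrt (l i) else 0)"
      unfolding PU by (intro sum.cong) auto
    finally show ?thesis by simp
  qed
  have col: "column i Q = (1 / sqrt (l i)) *\<^sub>R q i" for i
    by (simp add: column_def vec_eq_iff Q)
  have P2: "det ?P * det ?P = 1"
    using det_orthogonal_matrix[OF orthonormal_frame_matrix[OF b]] by auto
  have "det Q = det ?P * (1 + c m) * (\<Prod>i\<in>UNIV. 1 / sqrt (l i))"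
  proof -
    have "det ?D = (\<Prod>i\<in>UNIV. 1 / sqrt (l i))" by (subst det_diagonal) auto
    then show ?thesis unfolding Q_def det_mul by (simp add: det_row_perturbed_identity)
  qed
  then have "det Q * det Q = (det ?P * det ?P) * (1 + c m)\<^sup>2 *
      ((\<Prod>i\<in>UNIV. 1 / sqrt (l i)) * (\<Prod>i\<in>UNIV. 1 / sqrt (l i)))"
    by (simp add: power2_eq_square mult_ac)
  also have "(\<Prod>i\<in>UNIV. 1 / sqrt (l i)) * (\<Prod>i\<in>UNIV. 1 / sqrt (l i)) = (\<Prod>i\<in>UNIV. 1 / l i)"
    using l by (simp add: prod.distrib[symmetric] less_imp_le)
  finally have "det Q * det Q = (det ?P * det ?P) * (1 + c m)\<^sup>2 * (\<Prod>i\<in>UNIV. 1 / l i)" .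
  then have detQ: "det Q * det Q = (1 + c m)\<^sup>2 / (\<Prod>i\<in>UNIV. l i)"
    by (simp add: P2 prod_dividef)
  have prodl: "(\<Prod>i\<in>UNIV. l i) > 0" using l by (simp add: prod_pos)
  have detQ0: "det Q \<noteq> 0"
    using detQ prodl c by (metis divide_eq_0_iff less_irrefl mult_zero_left power_not_zero)
  define R where "R = transpose Q ** M ** Q"
  have symR: "transpose R = R"
    unfolding R_def by (simp add: matrix_transpose_mul M(1) matrix_mul_assoc)
  have posR: "pos_definite R"
    unfolding pos_definite_def
  proof (intro allI impI)
    fix \<xi> :: "real ^ 'n" assume "\<xi> \<noteq> 0"
    then have "Q *v \<xi> \<noteq> 0" using detQ0
      by (metis invertible_det_nz invertible_left_inverse matrix_left_invertible_ker)
    then have "(Q *v \<xi>) \<bullet> (M *v (Q *v \<xi>)) > 0" using M(2) by (simp add: pos_definite_def)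
    moreover have "\<xi> \<bullet> (R *v \<xi>) = (Q *v \<xi>) \<bullet> (M *v (Q *v \<xi>))"
      unfolding R_def matrix_vector_mul_assoc[symmetric]
      by (subst dot_lmul_matrix[symmetric]) (simp add: vector_transpose_matrix)
    ultimately show "\<xi> \<bullet> (R *v \<xi>) > 0" by simp
  qed
  have "det R = (1 + c m)\<^sup>2 / (\<Prod>i\<in>UNIV. l i) * det M"
  proof -
    have "det R = (det Q * det Q) * det M" by (simp add: R_def det_mul)
    then show ?thesis by (simp add: detQ)
  qed
  moreover have "det M > 0" by (rule ln_det_le_trace[OF M])
  ultimately have "ln (det R) = 2 * ln (1 + c m) - (\<Sum>i\<in>UNIV. ln (l i)) + ln (det M)"
    using prodl c l by (simp add: ln_mult ln_div ln_realpow ln_prod zero_less_mult_iff less_imp_neq[THEN not_sym])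
  moreover have "trace R = (\<Sum>i\<in>UNIV. q i \<bullet> (M *v q i) / l i)"
    unfolding trace_def R_def conjugate_entry col
    using l by (intro sum.cong) (auto simp: matrix_vector_mult_scaleR less_imp_le)
  ultimately show ?thesis
    using ln_det_le_trace(2)[OF symR posR] by (simp add: q_def)
qed

text \<open>
  If all eigenvalues are at most \<open>K\<close> and their product is at least \<open>c\<close>, none of them is small.
\<close>
lemma pos_definite_lower_bound:
  fixes M :: "real ^ 'n ^ 'n"
  assumes M: "transpose M = M" "pos_definite M" and c: "0 < c" "c \<le> det M"
    and K: "1 \<le> K" "\<And>x. norm x = 1 \<Longrightarrow> x \<bullet> (M *v x) \<le> K"
  shows "x \<bullet> (M *v x) \<ge> c / K ^ CARD('n) * (x \<bullet> x)"
proof -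
  obtain b l where b: "orthonormal_frame b" and l: "\<And>i. M *v b i = l i *\<^sub>R b i" "\<And>i. l i > 0"
    using pos_definite_eigenframe[OF M] by blast
  have lK: "l i \<le> K" for i
    using K(2)[of "b i"] b by (simp add: l(1) orthonormal_frame_norm orthonormal_frame_inner)
  have lc: "l i \<ge> c / K ^ CARD('n)" for i
  proof -
    have "c \<le> (\<Prod>j\<in>UNIV. l j)" using c det_eq_prod_eigenvalues[OF b l(1)] by simp
    also have "\<dots> = l i * (\<Prod>j\<in>UNIV - {i}. l j)" by (simp add: prod.remove)
    also have "\<dots> \<le> l i * (\<Prod>j\<in>UNIV - {i}. K)"
      using l(2) lK by (intro mult_left_mono prod_mono) (auto simp: less_imp_le)
    also have "\<dots> \<le> l i * K ^ CARD('n)"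
      using K(1) l(2)[of i] by (intro mult_left_mono) (auto intro!: power_increasing simp: card_Diff_singleton)
    finally show ?thesis using K(1) by (simp add: field_simps)
  qed
  have "x \<bullet> (M *v x) = (\<Sum>i\<in>UNIV. l i * (b i \<bullet> x)\<^sup>2)"
  proof -
    have "b i \<bullet> (M *v x) = l i * (b i \<bullet> x)" for i
      using symmetric_matrix_inner[OF M(1), of "b i" x] by (simp add: l(1) inner_commute)
    then show ?thesis
      by (subst orthonormal_frame_Parseval[OF b]) (simp add: power2_eq_square algebra_simps)
  qed
  also have "\<dots> \<ge> (\<Sum>i\<in>UNIV. c / K ^ CARD('n) * (b i \<bullet> x)\<^sup>2)"
    using lc by (intro sum_mono mult_right_mono) auto
  also have "(\<Sum>i\<in>UNIV. c / K ^ CARD('n) * (b i \<bullet> x)\<^sup>2) = c / K ^ CARD('n) * (x \<bullet> x)"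
    by (subst orthonormal_frame_Parseval[OF b]) (simp add: power2_eq_square sum_distrib_left)
  finally show ?thesis .
qed

section \<open>Directional derivatives\<close>

abbreviation "D \<equiv> dir_deriv"
lemma dir_deriv_eq: "(f has_derivative f') (at x) \<Longrightarrow> D e f x = f' e"
  unfolding dir_deriv_def using frechet_derivative_at[of f f' x] by simp

lemma has_derivative_dir_deriv:
  "f differentiable (at x) \<Longrightarrow> (f has_derivative (\<lambda>e. D e f x)) (at x)"
  unfolding dir_deriv_def by (simp add: frechet_derivative_works)

lemma linear_dir_deriv: "f differentiable (at x) \<Longrightarrow> linear (\<lambda>e. D e f x)"
  using has_derivative_dir_deriv has_derivative_linear by blast

lemma dir_deriv_expand:
  fixes f :: "'a::euclidean_space \<Rightarrow> 'b::real_normed_vector"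
  assumes "f differentiable (at x)"
  shows "D e f x = (\<Sum>c\<in>Basis. (e \<bullet> c) *\<^sub>R D c f x)"
proof -
  have "D e f x = D (\<Sum>c\<in>Basis. (e \<bullet> c) *\<^sub>R c) f x"
    by (simp add: euclidean_representation)
  also have "\<dots> = (\<Sum>c\<in>Basis. (e \<bullet> c) *\<^sub>R D c f x)"
    using linear_sum[OF linear_dir_deriv[OF assms], of "\<lambda>c. (e \<bullet> c) *\<^sub>R c" Basis]
      linear_scale[OF linear_dir_deriv[OF assms]] by simp
  finally show ?thesis .
qed

lemma has_derivative_cong_open:
  assumes "open S" "x \<in> S" "\<And>y. y \<in> S \<Longrightarrow> f y = g y"
  shows "(f has_derivative f') (at x) \<longleftrightarrow> (g has_derivative f') (at x)"
  using has_derivative_transform_within_open[OF _ assms(1,2)] assms(3) by metis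

lemma dir_deriv_cong:
  assumes "open S" "x \<in> S" "\<And>y. y \<in> S \<Longrightarrow> f y = g y"
  shows "D e f x = D e g x"
  unfolding dir_deriv_def frechet_derivative_def
  using has_derivative_cong_open[OF assms] by presburger

lemma differentiable_cong:
  assumes "open S" "x \<in> S" "\<And>y. y \<in> S \<Longrightarrow> f y = g y"
  shows "f differentiable (at x) \<longleftrightarrow> g differentiable (at x)"
  unfolding differentiable_def using has_derivative_cong_open[OF assms] by presburger

lemma Ck_on_cong:
  assumes "open S" "\<And>y. y \<in> S \<Longrightarrow> f y = g y"
  shows "Ck_on k S f \<longleftrightarrow> Ck_on k S g"
  using assms(2)
proof (induction k arbitrary: f g)
  case 0
  then show ?case by (simp cong: continuous_on_cong)
next
  case (Suc k)
  have "D e f y = D e g y" if "y \<in> S" for e y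
    using dir_deriv_cong[OF assms(1) that, of f g] Suc.prems by blast
  then have "Ck_on k S (D e f) \<longleftrightarrow> Ck_on k S (D e g)" for e
    by (rule Suc.IH)
  moreover have "f differentiable (at y) \<longleftrightarrow> g differentiable (at y)" if "y \<in> S" for y
    using differentiable_cong[OF assms(1) that, of f g] Suc.prems by blast
  ultimately show ?case by simp
qed

lemma Ck_on_imp_continuous_on: "Ck_on k S f \<Longrightarrow> continuous_on S f"
  by (cases k) (auto intro!: continuous_at_imp_continuous_on differentiable_imp_continuous_within)

lemma Ck_on_SucD: "Ck_on (Suc k) S f \<Longrightarrow> Ck_on k S f"
proof (induction k arbitrary: f)
  case 0
  then show ?case using Ck_on_imp_continuous_on by (metis Ck_on.simps(1))
next
  case (Suc k)
  then show ?case by (metis Ck_on.simps(2))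
qed

lemma Ck_on_mono: "Ck_on k S f \<Longrightarrow> j \<le> k \<Longrightarrow> Ck_on j S f"
proof (induction k)
  case (Suc k)
  then show ?case using Ck_on_SucD[of k S f] by (cases "j = Suc k") auto
qed simp

lemma dir_deriv_add:
  "f differentiable (at x) \<Longrightarrow> g differentiable (at x) \<Longrightarrow>
    D e (\<lambda>y. f y + g y) x = D e f x + D e g x"
  by (rule dir_deriv_eq) (intro has_derivative_add has_derivative_dir_deriv)

lemma dir_deriv_diff:
  "f differentiable (at x) \<Longrightarrow> g differentiable (at x) \<Longrightarrow>
    D e (\<lambda>y. f y - g y) x = D e f x - D e g x"
  by (rule dir_deriv_eq) (intro has_derivative_diff has_derivative_dir_deriv)

lemma dir_deriv_sum:
  "(\<And>i. i \<in> I \<Longrightarrow> f i differentiable (at x)) \<Longrightarrow>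
    D e (\<lambda>y. \<Sum>i\<in>I. f i y) x = (\<Sum>i\<in>I. D e (f i) x)"
  by (rule dir_deriv_eq) (intro has_derivative_sum has_derivative_dir_deriv)

lemma dir_deriv_bounded_linear:
  assumes "bounded_linear h" "f differentiable (at x)"
  shows "(\<lambda>y. h (f y)) differentiable (at x)" "D e (\<lambda>y. h (f y)) x = h (D e f x)"
proof -
  have *: "((\<lambda>y. h (f y)) has_derivative (\<lambda>e. h (D e f x))) (at x)"
    by (intro bounded_linear.has_derivative[OF assms(1)] has_derivative_dir_deriv assms(2))
  show "(\<lambda>y. h (f y)) differentiable (at x)" using * by (rule differentiableI)
  show "D e (\<lambda>y. h (f y)) x = h (D e f x)" using * by (rule dir_deriv_eq)
qed

lemma dir_deriv_cmult:
  fixes f :: "'a::euclidean_space \<Rightarrow> real"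
  assumes "f differentiable (at x)"
  shows "D e (\<lambda>y. c * f y) x = c * D e f x"
  by (rule dir_deriv_bounded_linear[OF bounded_linear_mult_right assms])

lemma Ck_on_bounded_linear:
  assumes "open S" "bounded_linear h" "Ck_on k S f"
  shows "Ck_on k S (\<lambda>y. h (f y))"
  using assms(3)
proof (induction k arbitrary: f)
  case 0
  then show ?case using assms(2) by (auto intro: bounded_linear.continuous_on)
next
  case (Suc k)
  then have diff: "f differentiable (at y)" if "y \<in> S" for y using that by auto
  have "Ck_on k S (D e (\<lambda>y. h (f y)))" if "e \<in> Basis" for e
  proof -
    have "Ck_on k S (\<lambda>y. h (D e f y))" using Suc that by auto
    then show ?thesis
      using dir_deriv_bounded_linear(2)[OF assms(2) diff] by (subst Ck_on_cong[OF assms(1)]) auto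
  qed
  then show ?case using dir_deriv_bounded_linear(1)[OF assms(2) diff] by simp
qed

lemma Ck_on_add:
  assumes "open S" "Ck_on k S f" "Ck_on k S g"
  shows "Ck_on k S (\<lambda>y. f y + g y)"
  using assms(2,3)
proof (induction k arbitrary: f g)
  case 0
  then show ?case by (auto intro: continuous_intros)
next
  case (Suc k)
  have "Ck_on k S (D e (\<lambda>y. f y + g y))" if "e \<in> Basis" for e
  proof -
    have "Ck_on k S (\<lambda>y. D e f y + D e g y)" using Suc that by auto
    then show ?thesis
      using Suc.prems by (subst Ck_on_cong[OF assms(1)]) (auto simp: dir_deriv_add)
  qed
  then show ?case using Suc.prems by auto
qed

lemma dir_deriv_const [simp]: "D e (\<lambda>y. c) = (\<lambda>y. 0)"
  by (simp add: dir_deriv_def fun_eq_iff)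

lemma Ck_on_const: "Ck_on k S (\<lambda>y. c)"
proof (induction k arbitrary: c)
  case (Suc k)
  show ?case using Suc by simp
qed simp

lemma Ck_on_sum:
  assumes "open S" "\<And>i. i \<in> I \<Longrightarrow> Ck_on k S (f i)"
  shows "Ck_on k S (\<lambda>y. \<Sum>i\<in>I. f i y)"
  using assms(2) by (induction I rule: infinite_finite_induct) (auto intro: Ck_on_const Ck_on_add[OF assms(1)])

text \<open>
  \<open>Ck_on\<close> is defined with the coordinate directions; it controls the derivatives in all directions.
\<close>
lemma Ck_on_dir_deriv:
  assumes "open S" "Ck_on (Suc k) S f"
  shows "Ck_on k S (D e f)"
proof -
  have "Ck_on k S (\<lambda>y. \<Sum>c\<in>Basis. (e \<bullet> c) *\<^sub>R D c f y)"
    using assms by (intro Ck_on_sum Ck_on_bounded_linear[OF _ bounded_linear_scaleR_right]) auto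
  then show ?thesis
    using assms by (subst Ck_on_cong[OF assms(1)]) (auto intro: dir_deriv_expand)
qed

lemma Ck_closure_imp_Ck_on:
  assumes "open S" "Ck_closure k S f"
  shows "Ck_on k S f"
  using assms(2)
proof (induction k arbitrary: f)
  case 0
  then show ?case using continuous_on_subset[OF _ closure_subset] by auto
next
  case (Suc k)
  have "Ck_on k S (D e f)" if e: "e \<in> Basis" for e
  proof -
    obtain g where g: "\<forall>x\<in>S. g x = D e f x" "Ck_closure k S g"
      using Suc.prems e by auto
    then show ?thesis using Suc.IH[of g] Ck_on_cong[OF assms(1), of g "D e f"] by auto
  qed
  then show ?case using Suc.prems by auto
qed

lemma line_has_real_derivative:
  fixes f :: "'a::euclidean_space \<Rightarrow> real"
  assumes "f differentiable (at (x + t *\<^sub>R e))"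
  shows "((\<lambda>t. f (x + t *\<^sub>R e)) has_real_derivative D e f (x + t *\<^sub>R e)) (at t)"
proof -
  have "((\<lambda>t. x + t *\<^sub>R e) has_derivative (\<lambda>s. s *\<^sub>R e)) (at t)"
    by (auto intro!: derivative_eq_intros)
  from has_derivative_compose[OF this has_derivative_dir_deriv[OF assms]]
  have "((\<lambda>t. f (x + t *\<^sub>R e)) has_derivative (\<lambda>s. D (s *\<^sub>R e) f (x + t *\<^sub>R e))) (at t)" .
  moreover have "D (s *\<^sub>R e) f (x + t *\<^sub>R e) = s * D e f (x + t *\<^sub>R e)" for s
    using linear_scale[OF linear_dir_deriv[OF assms], of s e] by simp
  moreover have "(\<lambda>s. s * D e f (x + t *\<^sub>R e)) = (*) (D e f (x + t *\<^sub>R e))"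
    by (simp add: fun_eq_iff mult.commute)
  ultimately show ?thesis by (simp add: has_field_derivative_def)
qed

text \<open>
  The mixed second difference is symmetric in \<open>a\<close> and \<open>b\<close>; its mean value form gives the symmetry of
  second derivatives.
\<close>

lemma mixed_difference_mean_value:
  fixes f :: "'a::euclidean_space \<Rightarrow> real"
  assumes f: "\<And>y. y \<in> S \<Longrightarrow> f differentiable (at y)" "\<And>y. y \<in> S \<Longrightarrow> D a f differentiable (at y)"
    and s: "s > 0" and seg: "\<And>t r. 0 \<le> t \<Longrightarrow> t \<le> s \<Longrightarrow> 0 \<le> r \<Longrightarrow> r \<le> s \<Longrightarrow> x + t *\<^sub>R a + r *\<^sub>R b \<in> S"
  obtains t r where "0 \<le> t" "t \<le> s" "0 \<le> r" "r \<le> s"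
    "f (x + s *\<^sub>R a + s *\<^sub>R b) - f (x + s *\<^sub>R a) - f (x + s *\<^sub>R b) + f x =
      s\<^sup>2 * D b (D a f) (x + t *\<^sub>R a + r *\<^sub>R b)"
proof -
  have d1: "((\<lambda>t. f (x + t *\<^sub>R a + s *\<^sub>R b) - f (x + t *\<^sub>R a)) has_real_derivative
      D a f (x + t *\<^sub>R a + s *\<^sub>R b) - D a f (x + t *\<^sub>R a)) (at t)"
    if "0 \<le> t" "t \<le> s" for t
    using line_has_real_derivative[of f "x + s *\<^sub>R b" t a] line_has_real_derivative[of f x t a]
      f(1) seg[of t s] seg[of t 0] that s
    by (intro DERIV_diff) (simp_all add: add.assoc add.commute[of "s *\<^sub>R b"])
  obtain t where t: "0 < t" "t < s" and eq1:
    "(f (x + s *\<^sub>R a + s *\<^sub>R b) - f (x + s *\<^sub>R a)) - (f (x + s *\<^sub>R b) - f x) =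
      s * (D a f (x + t *\<^sub>R a + s *\<^sub>R b) - D a f (x + t *\<^sub>R a))"
    using MVT2[OF s d1] by auto
  have d2: "((\<lambda>r. D a f (x + t *\<^sub>R a + r *\<^sub>R b)) has_real_derivative
      D b (D a f) (x + t *\<^sub>R a + r *\<^sub>R b)) (at r)" if "0 \<le> r" "r \<le> s" for r
    using f(2) seg[of t r] that t by (intro line_has_real_derivative) auto
  obtain r where r: "0 < r" "r < s" and eq2:
    "D a f (x + t *\<^sub>R a + s *\<^sub>R b) - D a f (x + t *\<^sub>R a) =
      s * D b (D a f) (x + t *\<^sub>R a + r *\<^sub>R b)"
    using MVT2[OF s d2] by auto
  show ?thesis
    using that[of t r] t r eq1 eq2 by (simp add: power2_eq_square)
qed

lemma isCont_dist_less:
  "isCont f x \<Longrightarrow> e > 0 \<Longrightarrow> \<exists>d>0. \<forall>y. dist y x < d \<longrightarrow> dist (f y) (f x) < e"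
  for f :: "'a::metric_space \<Rightarrow> 'b::metric_space"
  unfolding continuous_at_eps_delta by blast

theorem dir_deriv_commute:
  fixes f :: "'a::euclidean_space \<Rightarrow> real"
  assumes S: "open S" "x \<in> S" and f: "Ck_on 2 S f"
  shows "D a (D b f) x = D b (D a f) x"
proof -
  have f2: "Ck_on (Suc (Suc 0)) S f" using f by (simp add: numeral_2_eq_2)
  have f1: "Ck_on (Suc 0) S (D e f)" for e by (rule Ck_on_dir_deriv[OF S(1) f2])
  have diff: "f differentiable (at y)" "D e f differentiable (at y)" if "y \<in> S" for y e
    using f2 f1[of e] that by auto
  have cont: "continuous_on S (D d (D e f))" for d e
    using Ck_on_dir_deriv[OF S(1) f1] by simp
  let ?F = "D a (D b f)" and ?G = "D b (D a f)"
  have "\<bar>?F x - ?G x\<bar> \<le> 0 + e" if e: "e > 0" for e :: real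
  proof -
    have cF: "isCont ?F x" and cG: "isCont ?G x"
      using cont[of a b] cont[of b a] S by (simp_all add: continuous_on_eq_continuous_at)
    obtain d1 d2 where d1: "d1 > 0" "\<And>y. dist y x < d1 \<Longrightarrow> dist (?F y) (?F x) < e / 2"
      and d2: "d2 > 0" "\<And>y. dist y x < d2 \<Longrightarrow> dist (?G y) (?G x) < e / 2"
      using isCont_dist_less[OF cF half_gt_zero[OF e]] isCont_dist_less[OF cG half_gt_zero[OF e]]
      by blast
    obtain d3 where d3: "d3 > 0" "ball x d3 \<subseteq> S" using S openE by blast
    define d where "d = min d1 (min d2 d3)"
    define s where "s = d / 2 / (norm a + norm b + 1)"
    have d0: "d > 0" using d1 d2 d3 by (simp add: d_def)
    have n0: "norm a + norm b + 1 > 0" by (simp add: add_nonneg_pos)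
    have s0: "s > 0" using d0 n0 by (simp add: s_def)
    have near: "dist (x + t *\<^sub>R a + r *\<^sub>R b) x < d"
      if "0 \<le> t" "t \<le> s" "0 \<le> r" "r \<le> s" for t r
    proof -
      have "norm (t *\<^sub>R a + r *\<^sub>R b) \<le> t * norm a + r * norm b"
        using norm_triangle_ineq[of "t *\<^sub>R a" "r *\<^sub>R b"] that by simp
      also have "\<dots> \<le> s * norm a + s * norm b"
        using that by (intro add_mono mult_right_mono) auto
      also have "\<dots> \<le> s * (norm a + norm b + 1)" using s0 by (simp add: algebra_simps)
      also have "\<dots> = d / 2" using n0 by (intro nonzero_eq_divide_eq[THEN iffD1]) (auto simp: s_def)
      also have "\<dots> < d" using d0 by simp
      finally show ?thesis by (simp add: dist_norm add.assoc)
    qed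
    have sub: "x + t *\<^sub>R a + r *\<^sub>R b \<in> S" if "0 \<le> t" "t \<le> s" "0 \<le> r" "r \<le> s" for t r
      using near[OF that] d3(2) by (auto simp: d_def dist_commute)
    obtain t r where tr: "0 \<le> t" "t \<le> s" "0 \<le> r" "r \<le> s" and eqG:
      "f (x + s *\<^sub>R a + s *\<^sub>R b) - f (x + s *\<^sub>R a) - f (x + s *\<^sub>R b) + f x =
        s\<^sup>2 * ?G (x + t *\<^sub>R a + r *\<^sub>R b)"
      by (rule mixed_difference_mean_value[OF diff(1) diff(2) s0 sub])
    have sub': "x + t *\<^sub>R b + r *\<^sub>R a \<in> S" if "0 \<le> t" "t \<le> s" "0 \<le> r" "r \<le> s" for t r
      using sub[of r t] that by (simp add: algebra_simps)
    obtain t' r' where tr': "0 \<le> t'" "t' \<le> s" "0 \<le> r'" "r' \<le> s" and eqF: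
      "f (x + s *\<^sub>R b + s *\<^sub>R a) - f (x + s *\<^sub>R b) - f (x + s *\<^sub>R a) + f x =
        s\<^sup>2 * ?F (x + t' *\<^sub>R b + r' *\<^sub>R a)"
      by (rule mixed_difference_mean_value[OF diff(1) diff(2) s0 sub'])
    have "s\<^sup>2 * ?G (x + t *\<^sub>R a + r *\<^sub>R b) = s\<^sup>2 * ?F (x + t' *\<^sub>R b + r' *\<^sub>R a)"
    proof -
      have xx: "x + s *\<^sub>R b + s *\<^sub>R a = x + s *\<^sub>R a + s *\<^sub>R b" by simp
      show ?thesis
        unfolding eqF[unfolded xx, symmetric] eqG[symmetric] by (simp only: diff_right_commute)
    qed
   then have "?G (x + t *\<^sub>R a + r *\<^sub>R b) = ?F (x + t' *\<^sub>R b + r' *\<^sub>R a)" using s0 by simp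
    moreover have "dist (?G (x + t *\<^sub>R a + r *\<^sub>R b)) (?G x) < e / 2"
      using near[OF tr] by (intro d2(2)) (simp add: d_def)
    moreover have "dist (?F (x + t' *\<^sub>R b + r' *\<^sub>R a)) (?F x) < e / 2"
    proof (rule d1(2))
      have "x + t' *\<^sub>R b + r' *\<^sub>R a = x + r' *\<^sub>R a + t' *\<^sub>R b" by simp
      then show "dist (x + t' *\<^sub>R b + r' *\<^sub>R a) x < d1"
        using near[of r' t'] tr' by (simp only: d_def min_less_iff_conj)
    qed
    ultimately show ?thesis unfolding dist_real_def by linarith
  qed
  then have "\<bar>?F x - ?G x\<bar> \<le> 0" by (rule field_le_epsilon)
  then show ?thesis by simp
qed

lemma second_derivative_at_minimum:
  fixes f g :: "real \<Rightarrow> real"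
  assumes d: "d > 0" and f: "\<And>t. \<bar>t\<bar> < d \<Longrightarrow> (f has_real_derivative g t) (at t)"
    and g: "(g has_real_derivative c) (at 0)" and min: "\<And>t. \<bar>t\<bar> < d \<Longrightarrow> f 0 \<le> f t"
  shows "g 0 = 0" "c \<ge> 0"
proof -
  show g0: "g 0 = 0"
    by (rule DERIV_local_min[OF f d]) (use d min in auto)
  show "c \<ge> 0"
  proof (rule ccontr)
    assume "\<not> c \<ge> 0"
    then obtain e where e: "e > 0" "\<And>h. 0 < h \<Longrightarrow> h < e \<Longrightarrow> g h < 0"
      using DERIV_neg_dec_right[OF g] g0 by auto
    define h where "h = min d e / 2"
    have h: "0 < h" "h < d" "h < e" using d e(1) by (auto simp: h_def)
    obtain z where z: "0 < z" "z < h" "f h - f 0 = (h - 0) * g z"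
      using MVT2[OF h(1), of f g] f h by auto
    have "h * g z < 0" using h z e(2)[of z] by (simp add: mult_pos_neg)
    then show False using z min[of h] h by simp
  qed
qed

text \<open>
  Differentiability in \<open>S\<close> together with differentiability of all directional derivatives at the one
  point \<open>x\<close>. This is all that the second-order conditions at an extremum require, and it is preserved by
  the compositions below without any discussion of the continuity of second derivatives.
\<close>

definition twice_diff :: "'a::euclidean_space set \<Rightarrow> ('a \<Rightarrow> 'b::real_normed_vector) \<Rightarrow> 'a \<Rightarrow> bool" where
  "twice_diff S f x \<longleftrightarrow>
     (\<forall>y\<in>S. f differentiable (at y)) \<and> (\<forall>e. D e f differentiable (at x))"

lemma twice_diffD:
  assumes "twice_diff S f x"
  shows "y \<in> S \<Longrightarrow> f differentiable (at y)" "D e f differentiable (at x)"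
  using assms by (auto simp: twice_diff_def)

lemma Ck_on_imp_twice_diff:
  assumes "open S" "x \<in> S" "Ck_on 2 S f"
  shows "twice_diff S f x"
proof -
  have "Ck_on (Suc (Suc 0)) S f" using assms(3) by (simp add: numeral_2_eq_2)
  then show ?thesis
    using Ck_on_dir_deriv[OF assms(1), of "Suc 0" f] assms(2) by (auto simp: twice_diff_def)
qed

lemma second_derivative_at_maximum:
  fixes f :: "'a::euclidean_space \<Rightarrow> real"
  assumes S: "open S" "x \<in> S" and f: "twice_diff S f x" and max: "\<And>y. y \<in> S \<Longrightarrow> f y \<le> f x"
  shows "D e f x = 0" "D e (D e f) x \<le> 0"
proof -
  obtain r where r: "r > 0" "ball x r \<subseteq> S" using S openE by blast
  define d where "d = r / (norm e + 1)"
  have n1: "norm e + 1 > 0" using norm_ge_zero[of e] by linarith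
  have d0: "d > 0" using r(1) n1 by (simp add: d_def)
  have inS: "x + t *\<^sub>R e \<in> S" if "\<bar>t\<bar> < d" for t
  proof -
    have "\<bar>t\<bar> * norm e \<le> \<bar>t\<bar> * (norm e + 1)" by (intro mult_left_mono) auto
    also have "\<dots> < d * (norm e + 1)" using that n1 by (intro mult_strict_right_mono)
    also have "\<dots> = r" using n1 by (simp add: d_def)
    finally show ?thesis using r(2) by (auto simp: dist_norm)
  qed
  have 1: "((\<lambda>t. - f (x + t *\<^sub>R e)) has_real_derivative - D e f (x + t *\<^sub>R e)) (at t)"
    if "\<bar>t\<bar> < d" for t
    using twice_diffD(1)[OF f inS[OF that]] by (intro DERIV_minus line_has_real_derivative)
  have 2: "((\<lambda>t. - D e f (x + t *\<^sub>R e)) has_real_derivative - D e (D e f) x) (at 0)"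
    using line_has_real_derivative[of "D e f" x 0 e] twice_diffD(2)[OF f]
    by (intro DERIV_minus) simp
  have 3: "- f (x + 0 *\<^sub>R e) \<le> - f (x + t *\<^sub>R e)" if "\<bar>t\<bar> < d" for t
    using max[OF inS[OF that]] by simp
  show "D e f x = 0"
    using second_derivative_at_minimum(1)[where f = "\<lambda>t. - f (x + t *\<^sub>R e)" and g = "\<lambda>t. - D e f (x + t *\<^sub>R e)",
        OF d0 1 2 3] by simp
  show "D e (D e f) x \<le> 0"
    using second_derivative_at_minimum(2)[where f = "\<lambda>t. - f (x + t *\<^sub>R e)" and g = "\<lambda>t. - D e f (x + t *\<^sub>R e)",
        OF d0 1 2 3] by simp
qed

lemma twice_diff_add:
  assumes S: "open S" "x \<in> S" and f: "twice_diff S f x" and g: "twice_diff S g x"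
  shows "twice_diff S (\<lambda>y. f y + g y) x"
    "D d (D e (\<lambda>y. f y + g y)) x = D d (D e f) x + D d (D e g) x"
proof -
  note fg = twice_diffD[OF f] twice_diffD[OF g]
  have eq: "D e (\<lambda>y. f y + g y) y = D e f y + D e g y" if "y \<in> S" for e y
    using fg that by (intro dir_deriv_add)
  have "D e (\<lambda>y. f y + g y) differentiable (at x)" for e
    by (subst differentiable_cong[OF S eq]) (auto intro!: fg differentiable_add)
  then show "twice_diff S (\<lambda>y. f y + g y) x" using fg by (auto simp: twice_diff_def)
  show "D d (D e (\<lambda>y. f y + g y)) x = D d (D e f) x + D d (D e g) x"
    by (subst dir_deriv_cong[OF S eq]) (auto intro: fg dir_deriv_add)
qed

lemma twice_diff_bounded_linear:
  assumes S: "open S" "x \<in> S" and h: "bounded_linear h" and f: "twice_diff S f x"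
  shows "twice_diff S (\<lambda>y. h (f y)) x"
    "D d (D e (\<lambda>y. h (f y))) x = h (D d (D e f) x)"
proof -
  note fD = twice_diffD[OF f]
  have eq: "D e (\<lambda>y. h (f y)) y = h (D e f y)" if "y \<in> S" for e y
    by (rule dir_deriv_bounded_linear(2)[OF h fD(1)[OF that]])
  have "D e (\<lambda>y. h (f y)) differentiable (at x)" for e
    by (subst differentiable_cong[OF S eq]) (auto simp: dir_deriv_bounded_linear(1)[OF h fD(2)])
  then show "twice_diff S (\<lambda>y. h (f y)) x"
    using dir_deriv_bounded_linear(1)[OF h fD(1)] by (simp add: twice_diff_def)
  show "D d (D e (\<lambda>y. h (f y))) x = h (D d (D e f) x)"
    by (subst dir_deriv_cong[OF S eq]) (auto simp: dir_deriv_bounded_linear(2)[OF h fD(2)])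
qed

lemma twice_diff_diff:
  assumes S: "open S" "x \<in> S" and f: "twice_diff S f x" and g: "twice_diff S g x"
  shows "twice_diff S (\<lambda>y. f y - g y) x"
    "D d (D e (\<lambda>y. f y - g y)) x = D d (D e f) x - D d (D e g) x"
proof -
  note neg = bounded_linear_minus[OF bounded_linear_ident]
  note ng = twice_diff_bounded_linear[OF S neg g]
  show "twice_diff S (\<lambda>y. f y - g y) x"
    using twice_diff_add(1)[OF S f ng(1)] by simp
  show "D d (D e (\<lambda>y. f y - g y)) x = D d (D e f) x - D d (D e g) x"
    using twice_diff_add(2)[OF S f ng(1), of d e] ng(2)[of d e] by simp
qed

lemma twice_diff_const: "twice_diff S (\<lambda>y. c) x"
  by (simp add: twice_diff_def)

lemma twice_diff_sum:
  assumes S: "open S" "x \<in> S" and I: "finite I" and f: "\<And>i. i \<in> I \<Longrightarrow> twice_diff S (f i) x"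
  shows "twice_diff S (\<lambda>y. \<Sum>i\<in>I. f i y) x \<and>
    D d (D e (\<lambda>y. \<Sum>i\<in>I. f i y)) x = (\<Sum>i\<in>I. D d (D e (f i)) x)"
  using I f
proof (induction I rule: finite_induct)
  case empty
  show ?case by (simp add: twice_diff_const)
next
  case (insert i I)
  have fi: "twice_diff S (f i) x" using insert.prems by simp
  have IH: "twice_diff S (\<lambda>y. \<Sum>i\<in>I. f i y) x"
    "D d (D e (\<lambda>y. \<Sum>i\<in>I. f i y)) x = (\<Sum>i\<in>I. D d (D e (f i)) x)"
    using insert by auto
  show ?case
    unfolding sum.insert[OF insert.hyps(1,2)]
    using twice_diff_add(1)[OF S fi IH(1)] twice_diff_add(2)[OF S fi IH(1), of d e] IH(2) by argo
qed

lemma dir_deriv_chain_real: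
  fixes f :: "'a::euclidean_space \<Rightarrow> real"
  assumes "f differentiable (at x)" "(\<phi> has_real_derivative c) (at (f x))"
  shows "(\<lambda>y. \<phi> (f y)) differentiable (at x)" "D e (\<lambda>y. \<phi> (f y)) x = c * D e f x"
proof -
  have *: "((\<lambda>y. \<phi> (f y)) has_derivative (\<lambda>e. c * D e f x)) (at x)"
    using has_derivative_compose[OF has_derivative_dir_deriv[OF assms(1)]
        assms(2)[unfolded has_field_derivative_def]] .
  show "(\<lambda>y. \<phi> (f y)) differentiable (at x)" using * by (rule differentiableI)
  show "D e (\<lambda>y. \<phi> (f y)) x = c * D e f x" using * by (rule dir_deriv_eq)
qed

lemma dir_deriv_mult:
  fixes f g :: "'a::euclidean_space \<Rightarrow> real"
  assumes "f differentiable (at x)" "g differentiable (at x)"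
  shows "D e (\<lambda>y. f y * g y) x = f x * D e g x + D e f x * g x"
  by (rule dir_deriv_eq) (intro has_derivative_mult has_derivative_dir_deriv assms)

lemma twice_diff_chain_real:
  fixes f :: "'a::euclidean_space \<Rightarrow> real"
  assumes S: "open S" "x \<in> S" and f: "twice_diff S f x"
    and \<phi>: "\<And>y. y \<in> S \<Longrightarrow> (\<phi> has_real_derivative \<phi>' (f y)) (at (f y))"
    and \<phi>': "(\<phi>' has_real_derivative c) (at (f x))"
  shows "twice_diff S (\<lambda>y. \<phi> (f y)) x"
    "D d (D e (\<lambda>y. \<phi> (f y))) x =
      \<phi>' (f x) * D d (D e f) x + c * D d f x * D e f x"
proof -
  note fD = twice_diffD[OF f]
  have eq: "D e (\<lambda>y. \<phi> (f y)) y = \<phi>' (f y) * D e f y" if "y \<in> S" for e y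
    using fD(1)[OF that] \<phi>[OF that] by (rule dir_deriv_chain_real)
  have \<phi>'d: "(\<lambda>y. \<phi>' (f y)) differentiable (at x)"
    using fD(1)[OF S(2)] \<phi>' by (rule dir_deriv_chain_real)
  have "D e (\<lambda>y. \<phi> (f y)) differentiable (at x)" for e
    by (subst differentiable_cong[OF S eq]) (auto intro!: differentiable_mult \<phi>'d fD)
  then show "twice_diff S (\<lambda>y. \<phi> (f y)) x"
    using dir_deriv_chain_real(1)[OF fD(1) \<phi>] by (auto simp: twice_diff_def)
  show "D d (D e (\<lambda>y. \<phi> (f y))) x =
      \<phi>' (f x) * D d (D e f) x + c * D d f x * D e f x"
    using dir_deriv_chain_real(2)[OF fD(1)[OF S(2)] \<phi>']
    by (subst dir_deriv_cong[OF S eq]) (auto simp: dir_deriv_mult \<phi>'d fD)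
qed

section \<open>Gradients, Hessians and composition with the gradient map\<close>

lemma grad_eq_sum: "grad u = (\<lambda>x. \<Sum>i\<in>UNIV. D (axis i 1) u x *\<^sub>R axis i 1)"
  by (simp add: fun_eq_iff vec_eq_iff grad_def axis_def if_distrib cong: if_cong)

lemma inner_axis_sum:
  fixes e :: "real ^ 'n"
  shows "(\<Sum>i\<in>UNIV. (e $ i) *\<^sub>R axis i 1) = e"
  by (simp add: vec_eq_iff axis_def if_distrib cong: if_cong)

lemma dir_deriv_expand_axis:
  fixes f :: "real ^ 'n \<Rightarrow> 'b::real_normed_vector"
  assumes "f differentiable (at x)"
  shows "D e f x = (\<Sum>i\<in>UNIV. (e $ i) *\<^sub>R D (axis i 1) f x)"
  using linear_sum[OF linear_dir_deriv[OF assms], of "\<lambda>i. (e $ i) *\<^sub>R axis i 1" UNIV]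
    linear_scale[OF linear_dir_deriv[OF assms]]
  by (simp add: inner_axis_sum)

lemma grad_inner:
  assumes "u differentiable (at x)"
  shows "grad u x \<bullet> e = D e u x"
  by (subst dir_deriv_expand_axis[OF assms]) (simp add: inner_vec_def grad_def mult.commute)

lemma Ck_on_grad:
  assumes "open S" "Ck_on (Suc k) S u"
  shows "Ck_on k S (grad u)"
  unfolding grad_eq_sum
  by (intro Ck_on_sum Ck_on_bounded_linear[OF _ bounded_linear_scaleR_left] Ck_on_dir_deriv assms)

lemma dir_deriv_grad_inner:
  assumes S: "open S" "x \<in> S" and u: "\<And>y. y \<in> S \<Longrightarrow> u differentiable (at y)"
    and gu: "grad u differentiable (at x)"
  shows "D e (grad u) x \<bullet> f = D e (D f u) x"
proof -
  have "D e (\<lambda>y. grad u y \<bullet> f) x = D e (grad u) x \<bullet> f"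
    by (rule dir_deriv_bounded_linear(2)[OF bounded_linear_inner_left gu])
  then show ?thesis
    using dir_deriv_cong[OF S, of "\<lambda>y. grad u y \<bullet> f" "D f u" e] grad_inner[OF u] by simp
qed

text \<open>
  The matrix \<open>hess u\<close> represents the derivative of the gradient; this uses the symmetry of second derivatives.
\<close>
lemma hess_mult:
  assumes S: "open S" "x \<in> S" and u: "Ck_on 2 S u"
  shows "hess u x *v e = D e (grad u) x"
proof -
  have u2: "Ck_on (Suc (Suc 0)) S u" using u by (simp add: numeral_2_eq_2)
  have gu: "grad u differentiable (at x)" using Ck_on_grad[OF S(1) u2] S(2) by simp
  have du: "u differentiable (at y)" if "y \<in> S" for y using u2 that by simp
  have diff: "D f u differentiable (at x)" for f
    using Ck_on_dir_deriv[OF S(1) u2] S(2) by auto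
  have "(hess u x *v e) $ i = D e (grad u) x $ i" for i
  proof -
    have "D e (grad u) x $ i = D e (grad u) x \<bullet> axis i 1" by (simp add: inner_axis)
    also have "\<dots> = D e (D (axis i 1) u) x" by (rule dir_deriv_grad_inner[OF S du gu])
    also have "\<dots> = (\<Sum>j\<in>UNIV. (e $ j) *\<^sub>R D (axis j 1) (D (axis i 1) u) x)"
      by (rule dir_deriv_expand_axis[OF diff])
    also have "\<dots> = (\<Sum>j\<in>UNIV. D (axis i 1) (D (axis j 1) u) x * e $ j)"
      by (intro sum.cong refl) (simp add: dir_deriv_commute[OF S u, of "axis i 1"] mult.commute)
    also have "\<dots> = (hess u x *v e) $ i" by (simp add: matrix_vector_mult_def hess_def)
    finally show ?thesis by simp
  qed
  then show ?thesis by (simp add: vec_eq_iff)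
qed

lemma hess_inner:
  assumes S: "open S" "x \<in> S" and u: "Ck_on 2 S u"
  shows "f \<bullet> (hess u x *v e) = D f (D e u) x"
proof -
  have u2: "Ck_on (Suc (Suc 0)) S u" using u by (simp add: numeral_2_eq_2)
  have gu: "grad u differentiable (at x)" using Ck_on_grad[OF S(1) u2] S(2) by simp
  have du: "u differentiable (at y)" if "y \<in> S" for y using u2 that by simp
  show ?thesis
    using dir_deriv_grad_inner[OF S du gu, of e f]
    by (simp add: hess_mult[OF S u] inner_commute dir_deriv_commute[OF S u, of e f])
qed

lemma transpose_hess:
  assumes S: "open S" "x \<in> S" and u: "Ck_on 2 S u"
  shows "transpose (hess u x) = hess u x"
  by (simp add: vec_eq_iff transpose_def hess_def dir_deriv_commute[OF S u])

lemma dir_deriv2_expand: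
  fixes f :: "'a::euclidean_space \<Rightarrow> 'b::real_normed_vector"
  assumes S: "open S" "z \<in> S" and f: "twice_diff S f z"
  shows "D \<zeta> (D \<omega> f) z = (\<Sum>c\<in>Basis. (\<omega> \<bullet> c) *\<^sub>R D \<zeta> (D c f) z)"
proof -
  note fD = twice_diffD[OF f]
  have "D \<zeta> (D \<omega> f) z = D \<zeta> (\<lambda>y. \<Sum>c\<in>Basis. (\<omega> \<bullet> c) *\<^sub>R D c f y) z"
    by (rule dir_deriv_cong[OF S]) (rule dir_deriv_expand[OF fD(1)])
  also have "\<dots> = (\<Sum>c\<in>Basis. (\<omega> \<bullet> c) *\<^sub>R D \<zeta> (D c f) z)"
    using dir_deriv_bounded_linear[OF bounded_linear_scaleR_right fD(2)]
    by (subst dir_deriv_sum) auto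
  finally show ?thesis .
qed

lemma linear_dir_deriv2:
  assumes S: "open S" "z \<in> S" and f: "twice_diff S f z"
  shows "linear (\<lambda>\<omega>. D \<zeta> (D \<omega> f) z)" "linear (\<lambda>\<zeta>. D \<zeta> (D \<omega> f) z)"
proof -
  show "linear (\<lambda>\<omega>. D \<zeta> (D \<omega> f) z)"
  proof -
    have "(\<lambda>\<omega>. D \<zeta> (D \<omega> f) z) =
        (\<lambda>\<omega>. \<Sum>c\<in>Basis. (\<omega> \<bullet> c) *\<^sub>R D \<zeta> (D c f) z)"
      by (rule ext) (rule dir_deriv2_expand[OF S f])
    moreover have "linear (\<lambda>\<omega>. \<Sum>c\<in>Basis. (\<omega> \<bullet> c) *\<^sub>R D \<zeta> (D c f) z)"
      by (rule linearI) (simp_all add: inner_add_left scaleR_add_left sum.distrib scaleR_right.sum)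
    ultimately show ?thesis by simp
  qed
  show "linear (\<lambda>\<zeta>. D \<zeta> (D \<omega> f) z)"
    by (rule linear_dir_deriv[OF twice_diffD(2)[OF f]])
qed

text \<open>
  First and second derivatives of \<open>y \<mapsto> a(y, p(y))\<close>. The second derivative is the Hessian of \<open>a\<close> along the
  tangent vectors \<open>(d, D d p)\<close> and \<open>(e, D e p)\<close> of the graph, plus the gradient of \<open>a\<close> along the second
  derivative of \<open>p\<close>.
\<close>

lemma twice_diff_compose_graph:
  fixes a :: "'a::euclidean_space \<times> 'c::euclidean_space \<Rightarrow> real" and p :: "'a \<Rightarrow> 'c"
  assumes S: "open S" "x \<in> S" and a: "\<And>y. y \<in> S \<Longrightarrow> twice_diff (S \<times> UNIV) a (y, p y)" and p: "twice_diff S p x"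
  shows dir_deriv_compose_graph:
    "\<And>y e. y \<in> S \<Longrightarrow> D e (\<lambda>y. a (y, p y)) y = D (e, D e p y) a (y, p y)"
    and "twice_diff S (\<lambda>y. a (y, p y)) x"
    and "D d (D e (\<lambda>y. a (y, p y))) x =
      D (d, D d p x) (D (e, D e p x) a) (x, p x) +
      D (0, D d (D e p) x) a (x, p x)"
proof -
  note pD = twice_diffD[OF p]
  have aD: "a differentiable (at (y, p y))" if "y \<in> S" for y
    using twice_diffD(1)[OF a[OF that]] that by simp
  have P: "((\<lambda>y. (y, p y)) has_derivative (\<lambda>e. (e, D e p y))) (at y)" if "y \<in> S" for y
    by (intro has_derivative_Pair has_derivative_ident has_derivative_dir_deriv pD(1) that)
  have 1: "((\<lambda>y. a (y, p y)) has_derivative (\<lambda>e. D (e, D e p y) a (y, p y))) (at y)"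
    if "y \<in> S" for y
    using has_derivative_compose[OF P[OF that] has_derivative_dir_deriv[OF aD[OF that]]] .
  show first: "D e (\<lambda>y. a (y, p y)) y = D (e, D e p y) a (y, p y)"
    if "y \<in> S" for y e
    by (rule dir_deriv_eq[OF 1[OF that]])
  have expand: "D e (\<lambda>y. a (y, p y)) y =
      (\<Sum>c\<in>Basis. ((e, D e p y) \<bullet> c) * D c a (y, p y))" if "y \<in> S" for y e
    using dir_deriv_expand[OF aD[OF that], of "(e, D e p y)"] first[OF that] by simp
  have z: "(x, p x) \<in> S \<times> UNIV" using S by simp
  have oS: "open (S \<times> (UNIV :: 'c set))" using S(1) by (intro open_Times) auto
  have d1: "((\<lambda>y. (e, D e p y) \<bullet> c) has_derivative (\<lambda>d. (0, D d (D e p) x) \<bullet> c)) (at x)"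
    for e :: 'a and c :: "'a \<times> 'c"
    by (intro has_derivative_inner_left has_derivative_Pair has_derivative_const has_derivative_dir_deriv pD(2))
  have d2: "((\<lambda>y. D c a (y, p y)) has_derivative
      (\<lambda>d. D (d, D d p x) (D c a) (x, p x))) (at x)" for c
    using has_derivative_compose[OF P[OF S(2)] has_derivative_dir_deriv[OF twice_diffD(2)[OF a[OF S(2)]]]] .
  have 2: "((\<lambda>y. \<Sum>c\<in>Basis. ((e, D e p y) \<bullet> c) * D c a (y, p y)) has_derivative
      (\<lambda>d. \<Sum>c\<in>Basis. ((e, D e p x) \<bullet> c) * D (d, D d p x) (D c a) (x, p x) +
           ((0, D d (D e p) x) \<bullet> c) * D c a (x, p x))) (at x)" for e
    by (rule has_derivative_sum) (rule has_derivative_mult[OF d1 d2])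
  have 3: "(D e (\<lambda>y. a (y, p y)) has_derivative
      (\<lambda>d. \<Sum>c\<in>Basis. ((e, D e p x) \<bullet> c) * D (d, D d p x) (D c a) (x, p x) +
           ((0, D d (D e p) x) \<bullet> c) * D c a (x, p x))) (at x)" for e
    by (rule has_derivative_cong_open[THEN iffD2, OF S expand 2])
  show "twice_diff S (\<lambda>y. a (y, p y)) x"
    unfolding twice_diff_def using differentiableI[OF 1] differentiableI[OF 3] by simp
  show "D d (D e (\<lambda>y. a (y, p y))) x =
      D (d, D d p x) (D (e, D e p x) a) (x, p x) +
      D (0, D d (D e p) x) a (x, p x)"
    unfolding dir_deriv_eq[OF 3] sum.distrib
    using dir_deriv2_expand[OF oS z a[OF S(2)], of "(d, D d p x)" "(e, D e p x)"]
      dir_deriv_expand[OF aD[OF S(2)], of "(0, D d (D e p) x)"]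
    by simp
qed

lemma dir_deriv_bound:
  assumes "f differentiable (at z)" and M: "\<And>c. c \<in> Basis \<Longrightarrow> norm (D c f z) \<le> M"
  shows "norm (D (\<zeta>::'a::euclidean_space) f z) \<le> real DIM('a) * M * norm \<zeta>"
proof -
  have "norm (D \<zeta> f z) \<le> (\<Sum>c\<in>Basis. norm ((\<zeta> \<bullet> c) *\<^sub>R D c f z))"
    unfolding dir_deriv_expand[OF assms(1), of \<zeta>] by (rule norm_sum)
  also have "\<dots> \<le> (\<Sum>c\<in>(Basis::'a set). norm \<zeta> * M)"
    using M by (intro sum_mono) (auto intro!: mult_mono Basis_le_norm)
  finally show ?thesis by (simp add: mult_ac)
qed

lemma dir_deriv2_bound:
  fixes f :: "'a::euclidean_space \<Rightarrow> 'b::real_normed_vector"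
  assumes S: "open S" "z \<in> S" and f: "twice_diff S f z"
    and M: "\<And>c d. c \<in> Basis \<Longrightarrow> d \<in> Basis \<Longrightarrow> norm (D d (D c f) z) \<le> M"
  shows "norm (D \<zeta> (D \<omega> f) z) \<le> real DIM('a) * (real DIM('a) * M) * norm \<zeta> * norm \<omega>"
proof -
  have c: "norm (D \<zeta> (D c f) z) \<le> real DIM('a) * M * norm \<zeta>" if "c \<in> Basis" for c
    using M[OF that] by (intro dir_deriv_bound twice_diffD(2)[OF f])
  have "norm (D \<zeta> (D \<omega> f) z) \<le>
      (\<Sum>c\<in>Basis. norm ((\<omega> \<bullet> c) *\<^sub>R D \<zeta> (D c f) z))"
    unfolding dir_deriv2_expand[OF S f, of \<zeta> \<omega>] by (rule norm_sum)
  also have "\<dots> \<le> (\<Sum>c\<in>(Basis::'a set). norm \<omega> * (real DIM('a) * M * norm \<zeta>))"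
    unfolding norm_scaleR using c by (intro sum_mono mult_mono) (auto intro!: Basis_le_norm)
  finally show ?thesis by (simp add: mult_ac)
qed

text \<open>
  A function of class \<open>C\<^sup>2\<close> up to the boundary has bounded derivatives on compact subsets of the closure.
\<close>
lemma Ck_closure_2_bounds:
  fixes f :: "'a::euclidean_space \<Rightarrow> 'b::real_normed_vector"
  assumes S: "open S" and f: "Ck_closure 2 S f" and K: "compact K" "K \<subseteq> closure S"
  obtains M where "M \<ge> 0" "\<And>z. z \<in> S \<Longrightarrow> z \<in> K \<Longrightarrow> norm (f z) \<le> M"
    "\<And>z \<zeta>. z \<in> S \<Longrightarrow> z \<in> K \<Longrightarrow> norm (D \<zeta> f z) \<le> M * norm \<zeta>"
    "\<And>z \<zeta> \<omega>. z \<in> S \<Longrightarrow> z \<in> K \<Longrightarrow> norm (D \<zeta> (D \<omega> f) z) \<le> M * norm \<zeta> * norm \<omega>"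
proof -
  have bd: "\<exists>M. \<forall>z\<in>K. norm (g z) \<le> M" if "continuous_on (closure S) g" for g :: "'a \<Rightarrow> 'b"
    using compact_imp_bounded[OF compact_continuous_image[OF continuous_on_subset[OF that K(2)] K(1)]]
    by (auto simp: bounded_iff)
  have f2: "Ck_closure (Suc (Suc 0)) S f" using f by (simp add: numeral_2_eq_2)
  have td: "twice_diff S f z" if "z \<in> S" for z
    by (rule Ck_on_imp_twice_diff[OF S that Ck_closure_imp_Ck_on[OF S f]])
  have "continuous_on (closure S) f" using f2 by simp
  from bd[OF this] obtain M0 where M0: "\<And>z. z \<in> K \<Longrightarrow> norm (f z) \<le> M0" by blast
  have ex1: "\<exists>g. (\<forall>x\<in>S. g x = D c f x) \<and> Ck_closure (Suc 0) S g" if "c \<in> Basis" for c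
    using f2 that unfolding Ck_closure.simps(2)[of "Suc 0"] by blast
  have "\<exists>M. \<forall>z\<in>S \<inter> K. norm (D c f z) \<le> M" if c: "c \<in> Basis" for c
  proof -
    obtain g where g: "\<forall>x\<in>S. g x = D c f x" "Ck_closure (Suc 0) S g" using ex1[OF c] by blast
    then have "continuous_on (closure S) g" by simp
    from bd[OF this] obtain M where "\<forall>z\<in>K. norm (g z) \<le> M" by blast
    then have "\<forall>z\<in>S \<inter> K. norm (D c f z) \<le> M" by (simp add: g(1)[rule_format, symmetric])
    then show ?thesis by blast
  qed
  then have "\<forall>c\<in>Basis. \<exists>M. \<forall>z\<in>S \<inter> K. norm (D c f z) \<le> M" by blast
  from bchoice[OF this] obtain M1 where
    M1: "\<And>c z. c \<in> Basis \<Longrightarrow> z \<in> S \<Longrightarrow> z \<in> K \<Longrightarrow> norm (D c f z) \<le> M1 c"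
    by blast
  have "\<exists>M. \<forall>z\<in>S \<inter> K. norm (D d (D c f) z) \<le> M" if c: "c \<in> Basis" and d: "d \<in> Basis" for c d
  proof -
    obtain g where g: "\<forall>x\<in>S. g x = D c f x" "Ck_closure (Suc 0) S g"
      using ex1[OF c] by blast
    obtain h where h: "\<forall>x\<in>S. h x = D d g x" "continuous_on (closure S) h"
      using g(2) d unfolding Ck_closure.simps by blast
    have "h z = D d (D c f) z" if "z \<in> S" for z
      using h(1) g(1) dir_deriv_cong[OF S that, of g "D c f" d] that by simp
    then have h': "D d (D c f) z = h z" if "z \<in> S" for z using that by simp
    from bd[OF h(2)] obtain M where "\<forall>z\<in>K. norm (h z) \<le> M" by blast
    then have "\<forall>z\<in>S \<inter> K. norm (D d (D c f) z) \<le> M" by (simp add: h')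
    then show ?thesis by blast
  qed
  then have "\<forall>c d. \<exists>M. c \<in> Basis \<longrightarrow> d \<in> Basis \<longrightarrow> (\<forall>z\<in>S \<inter> K. norm (D d (D c f) z) \<le> M)"
    by blast
  then obtain M2 where M2: "\<And>c d z. c \<in> Basis \<Longrightarrow> d \<in> Basis \<Longrightarrow> z \<in> S \<Longrightarrow> z \<in> K \<Longrightarrow>
      norm (D d (D c f) z) \<le> M2 c d"
    unfolding choice_iff by blast
  define N where "N = \<bar>M0\<bar> + (\<Sum>c\<in>Basis. \<bar>M1 c\<bar>) + (\<Sum>c\<in>Basis. \<Sum>d\<in>Basis. \<bar>M2 c d\<bar>)"
  have pos: "(\<Sum>c\<in>(Basis::'a set). \<bar>M1 c\<bar>) \<ge> 0" "(\<Sum>c\<in>(Basis::'a set). \<Sum>d\<in>(Basis::'a set). \<bar>M2 c d\<bar>) \<ge> 0"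
    by (auto intro!: sum_nonneg)
  have N0: "M0 \<le> N" "0 \<le> N" using pos unfolding N_def by linarith+
  have N1: "M1 c \<le> N" if "c \<in> Basis" for c
    using pos member_le_sum[OF that, of "\<lambda>c. \<bar>M1 c\<bar>"] unfolding N_def by simp
  have N2: "M2 c d \<le> N" if "c \<in> Basis" "d \<in> Basis" for c d
  proof -
    have "\<bar>M2 c d\<bar> \<le> (\<Sum>d\<in>Basis. \<bar>M2 c d\<bar>)"
      using member_le_sum[OF that(2), of "\<lambda>d. \<bar>M2 c d\<bar>"] by simp
    also have "\<dots> \<le> (\<Sum>c\<in>Basis. \<Sum>d\<in>Basis. \<bar>M2 c d\<bar>)"
      using member_le_sum[OF that(1), of "\<lambda>c. \<Sum>d\<in>Basis. \<bar>M2 c d\<bar>"] by (simp add: sum_nonneg)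
    finally show ?thesis using pos unfolding N_def by linarith
  qed
  let ?D = "real DIM('a)"
  have D1: "?D \<ge> 1" by (simp add: Suc_leI)
  have DN: "?D * N \<ge> N" "?D * (?D * N) \<ge> ?D * N"
    using D1 N0(2) mult_right_mono[of 1 ?D N] mult_right_mono[of 1 ?D "?D * N"] by auto
  show ?thesis
  proof (rule that[of "?D * (?D * N)"])
    show "0 \<le> ?D * (?D * N)" using N0(2) by simp
    fix z assume z: "z \<in> S" "z \<in> K"
    show "norm (f z) \<le> ?D * (?D * N)" using M0[OF z(2)] N0 DN by linarith
    fix \<zeta>
    have "norm (D \<zeta> f z) \<le> ?D * N * norm \<zeta>"
      by (rule dir_deriv_bound[OF twice_diffD(1)[OF td[OF z(1)] z(1)] order_trans[OF M1[OF _ z] N1]])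
    then show "norm (D \<zeta> f z) \<le> ?D * (?D * N) * norm \<zeta>"
      using mult_right_mono[OF DN(2) norm_ge_zero[of \<zeta>]] by linarith
    fix \<omega>
    show "norm (D \<zeta> (D \<omega> f) z) \<le> ?D * (?D * N) * norm \<zeta> * norm \<omega>"
      by (rule dir_deriv2_bound[OF S z(1) td[OF z(1)] order_trans[OF M2[OF _ _ z] N2]])
  qed
qed

section \<open>The linearized operator at an interior point\<close>

lemma norm_le_of_inner_le:
  fixes w :: "real ^ 'n"
  assumes "\<And>e. \<bar>w \<bullet> e\<bar> \<le> K * norm e"
  shows "norm w \<le> K"
proof (cases "w = 0")
  case True
  have "0 \<le> K" using order_trans[OF abs_ge_zero assms[of "axis undefined 1"]] by simp
  then show ?thesis using True by simp
next
  case False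
  have "norm w * norm w \<le> K * norm w"
    using assms[of w] by (simp add: power2_norm_eq_inner[symmetric] power2_eq_square)
  then show ?thesis using False by simp
qed

text \<open>
  The entry \<open>A\<^sub>\<xi>\<^sub>\<eta>\<close> of a matrix-valued function in the directions \<open>\<xi>\<close> and \<open>\<eta>\<close>, as a function of the point.
\<close>
definition mform :: "('z \<Rightarrow> real ^ 'n ^ 'n) \<Rightarrow> real ^ 'n \<Rightarrow> real ^ 'n \<Rightarrow> 'z \<Rightarrow> real" where
  "mform A \<xi> \<eta> z = \<xi> \<bullet> (A z *v \<eta>)"

lemma bounded_linear_matrix_form: "bounded_linear (\<lambda>M :: real ^ 'n ^ 'n. \<xi> \<bullet> (M *v \<eta>))"
  by (intro linear_conv_bounded_linear[THEN iffD1] linearI)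
    (simp_all add: matrix_vector_mult_add_rdistrib inner_add_right scaleR_matrix_vector_assoc[symmetric])

lemma twice_diff_mform:
  assumes S: "open S" "z \<in> S" and A: "twice_diff S A z"
  shows "twice_diff S (mform A \<xi> \<eta>) z"
    "D d (mform A \<xi> \<eta>) z = \<xi> \<bullet> (D d A z *v \<eta>)"
    "D d (D e (mform A \<xi> \<eta>)) z = \<xi> \<bullet> (D d (D e A) z *v \<eta>)"
  unfolding mform_def[abs_def]
  by (rule twice_diff_bounded_linear[OF S bounded_linear_matrix_form A]
      dir_deriv_bounded_linear(2)[OF bounded_linear_matrix_form twice_diffD(1)[OF A S(2)]])+

lemma MA_matrix_form: "\<xi> \<bullet> (MA_matrix A u x *v \<eta>) = \<xi> \<bullet> (hess u x *v \<eta>) - mform A \<xi> \<eta> (x, grad u x)"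
  by (simp add: MA_matrix_def mform_def matrix_vector_mult_diff_rdistrib inner_diff_right)

lemma transpose_MA_matrix:
  fixes u :: "real ^ 'n \<Rightarrow> real"
  assumes S: "open S" "x \<in> S" and u: "Ck_on 2 S u"
    and A: "transpose (A (x, grad u x)) = A (x, grad u x)"
  shows "transpose (MA_matrix A u x) = MA_matrix A u x"
proof -
  have "transpose (P - Q) = transpose P - transpose Q" for P Q :: "real ^ 'n ^ 'n"
    by (simp add: transpose_def vec_eq_iff)
  then show ?thesis using transpose_hess[OF S u] A by (simp add: MA_matrix_def)
qed

text \<open>
  A solution \<open>u\<close> of \<open>ln det (D\<^sup>2u - A(x,Du)) = \<beta>(x,Du)\<close> in \<open>\<Omega>\<close> and a point \<open>x0\<close>, with an eigenframe \<open>b\<close> of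
  \<open>D\<^sup>2u - A(x,Du)\<close> at \<open>x0\<close> whose largest eigenvalue \<open>lam m\<close> is at least \<open>1\<close>. The one constant \<open>M\<close> bounds
  \<open>|Du(x0)|\<close>, \<open>A\<close> and the first and second derivatives of \<open>A\<close> and \<open>\<beta>\<close> at \<open>(x0, Du(x0))\<close>; the
  regularity assumption \<open>reg\<close> is needed for all \<open>p\<close>, because the barrier compares two gradients.
\<close>
locale elliptic_point =
  fixes \<Omega> :: "(real ^ 'n) set" and A :: "(real ^ 'n) \<times> (real ^ 'n) \<Rightarrow> real ^ 'n ^ 'n"
    and \<beta> :: "(real ^ 'n) \<times> (real ^ 'n) \<Rightarrow> real" and u :: "real ^ 'n \<Rightarrow> real"
    and x0 :: "real ^ 'n" and b :: "'n \<Rightarrow> real ^ 'n" and lam :: "'n \<Rightarrow> real" and m :: 'n and M :: real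
  assumes open_\<Omega>: "open \<Omega>" and x0: "x0 \<in> \<Omega>" and u4: "Ck_on 4 \<Omega> u"
    and symA: "\<And>z. z \<in> \<Omega> \<times> UNIV \<Longrightarrow> transpose (A z) = A z"
    and A2: "\<And>z. z \<in> \<Omega> \<times> UNIV \<Longrightarrow> twice_diff (\<Omega> \<times> UNIV) A z"
    and \<beta>2: "\<And>z. z \<in> \<Omega> \<times> UNIV \<Longrightarrow> twice_diff (\<Omega> \<times> UNIV) \<beta> z"
    and ell: "elliptic \<Omega> A u"
    and equ: "\<And>x. x \<in> \<Omega> \<Longrightarrow> ln (det (MA_matrix A u x)) = \<beta> (x, grad u x)"
    and reg: "\<And>\<xi> \<eta> p. \<xi> \<bullet> \<eta> = 0 \<Longrightarrow> 0 \<le> D (0, \<eta>) (D (0, \<eta>) (mform A \<xi> \<xi>)) (x0, p)"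
    and frame: "orthonormal_frame b"
    and eig: "\<And>i. MA_matrix A u x0 *v b i = lam i *\<^sub>R b i"
    and lam0: "\<And>i. lam i > 0" and lam_le: "\<And>i. lam i \<le> lam m" and lam1: "lam m \<ge> 1"
    and M1: "M \<ge> 1" and pM: "norm (grad u x0) \<le> M"
    and A_bd0: "\<And>\<xi> \<eta>. \<bar>mform A \<xi> \<eta> (x0, grad u x0)\<bar> \<le> M * norm \<xi> * norm \<eta>"
    and A_bd1: "\<And>\<xi> \<eta> \<zeta>. \<bar>D \<zeta> (mform A \<xi> \<eta>) (x0, grad u x0)\<bar> \<le> M * norm \<xi> * norm \<eta> * norm \<zeta>"
    and A_bd2: "\<And>\<xi> \<eta> \<zeta> \<omega>. \<bar>D \<zeta> (D \<omega> (mform A \<xi> \<eta>)) (x0, grad u x0)\<bar>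
        \<le> M * norm \<xi> * norm \<eta> * norm \<zeta> * norm \<omega>"
    and \<beta>_bd1: "\<And>\<zeta>. \<bar>D \<zeta> \<beta> (x0, grad u x0)\<bar> \<le> M * norm \<zeta>"
    and \<beta>_bd2: "\<And>\<zeta> \<omega>. \<bar>D \<zeta> (D \<omega> \<beta>) (x0, grad u x0)\<bar> \<le> M * norm \<zeta> * norm \<omega>"
begin

abbreviation "p \<equiv> grad u"
abbreviation "z0 \<equiv> (x0, grad u x0)"
abbreviation "a \<xi> \<eta> \<equiv> mform A \<xi> \<eta>"
text \<open>
  \<open>q e\<close> is the derivative of the gradient, \<open>D\<^sup>2u(x0) e\<close>, and \<open>T\<close> is the trace of the inverse of
  \<open>D\<^sup>2u - A(x,Du)\<close> at \<open>x0\<close>. The functional \<open>\<Gamma>\<close> is the first-order part of the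
  linearized operator \<open>L\<close>. It is applied to the gradient, so that \<open>L f\<close> depends only on the gradient of
  \<open>f\<close> at \<open>x0\<close> and on its pure second derivatives along the frame.
\<close>
definition "q e = D e p x0"
definition "T = (\<Sum>i\<in>UNIV. 1 / lam i)"
definition "\<Gamma> w = (\<Sum>i\<in>UNIV. D (0, w) (a (b i) (b i)) z0 / lam i) + D (0, w) \<beta> z0"
definition "L f = (\<Sum>i\<in>UNIV. D (b i) (D (b i) f) x0 / lam i) - \<Gamma> (grad f x0)"

lemma lam_ne [simp]: "lam i \<noteq> 0" using lam0[of i] by simp

lemma open_prod: "open (\<Omega> \<times> (UNIV :: (real ^ 'n) set))"
  using open_\<Omega> by (intro open_Times) auto

lemma z0_in: "z0 \<in> \<Omega> \<times> UNIV" using x0 by simp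

lemma a2: "z \<in> \<Omega> \<times> UNIV \<Longrightarrow> twice_diff (\<Omega> \<times> UNIV) (a \<xi> \<eta>) z"
  using twice_diff_mform(1)[OF open_prod _ A2] by blast

lemmas a_diff = twice_diffD(1)[OF a2]
lemmas \<beta>_diff = twice_diffD(1)[OF \<beta>2]

lemma u_Ck: "k \<le> 4 \<Longrightarrow> Ck_on k \<Omega> u" by (rule Ck_on_mono[OF u4])

lemma Du_Ck: "k \<le> 3 \<Longrightarrow> Ck_on k \<Omega> (D e u)"
  using Ck_on_dir_deriv[OF open_\<Omega>, of k u e] u_Ck[of "Suc k"] by simp

lemma DDu_Ck: "k \<le> 2 \<Longrightarrow> Ck_on k \<Omega> (D d (D e u))"
  using Ck_on_dir_deriv[OF open_\<Omega>, of k "D e u" d] Du_Ck[of "Suc k" e] by simp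

lemma p_Ck: "k \<le> 3 \<Longrightarrow> Ck_on k \<Omega> p"
  using Ck_on_grad[OF open_\<Omega>, of k u] u_Ck[of "Suc k"] by simp

lemma u_diff: "x \<in> \<Omega> \<Longrightarrow> u differentiable (at x)"
  and Du_diff: "x \<in> \<Omega> \<Longrightarrow> D e u differentiable (at x)"
  and DDu_diff: "x \<in> \<Omega> \<Longrightarrow> D d (D e u) differentiable (at x)"
  and p_diff: "x \<in> \<Omega> \<Longrightarrow> p differentiable (at x)"
  using u_Ck[of "Suc 0"] Du_Ck[of "Suc 0" e] DDu_Ck[of "Suc 0" d e] p_Ck[of "Suc 0"] by simp_all

lemma Ck2_twice: "Ck_on 2 \<Omega> f \<Longrightarrow> x \<in> \<Omega> \<Longrightarrow> twice_diff \<Omega> f x"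
  by (rule Ck_on_imp_twice_diff[OF open_\<Omega>])

lemma p_twice: "x \<in> \<Omega> \<Longrightarrow> twice_diff \<Omega> p x"
  and Du_twice: "x \<in> \<Omega> \<Longrightarrow> twice_diff \<Omega> (D e u) x"
  and DDu_twice: "x \<in> \<Omega> \<Longrightarrow> twice_diff \<Omega> (D d (D e u)) x"
  using Ck2_twice p_Ck[of 2] Du_Ck[of 2 e] DDu_Ck[of 2 d e] by auto

lemma p_inner: "x \<in> \<Omega> \<Longrightarrow> p x \<bullet> e = D e u x"
  by (rule grad_inner[OF u_diff])

lemma Dp_inner: "x \<in> \<Omega> \<Longrightarrow> D e p x \<bullet> f = D e (D f u) x"
  by (rule dir_deriv_grad_inner[OF open_\<Omega> _ u_diff p_diff])

lemma DDp_inner: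
  assumes "x \<in> \<Omega>"
  shows "D d (D e p) x \<bullet> f = D d (D e (D f u)) x"
proof -
  have "D d (\<lambda>y. D e p y \<bullet> f) x = D d (D e p) x \<bullet> f"
    by (rule dir_deriv_bounded_linear(2)[OF bounded_linear_inner_left twice_diffD(2)[OF p_twice[OF assms]]])
  then show ?thesis
    using dir_deriv_cong[OF open_\<Omega> assms, of "\<lambda>y. D e p y \<bullet> f" "D e (D f u)" d] Dp_inner
    by simp
qed

lemma Du_commute: "x \<in> \<Omega> \<Longrightarrow> D d (D e u) x = D e (D d u) x"
  by (rule dir_deriv_commute[OF open_\<Omega> _ u_Ck]) auto

lemma DDu_commute: "x \<in> \<Omega> \<Longrightarrow>
    D c (D d (D e u)) x = D d (D c (D e u)) x"
  by (rule dir_deriv_commute[OF open_\<Omega> _ Du_Ck]) auto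

lemma DDu_commute': 
  assumes "x \<in> \<Omega>"
  shows "D c (D d (D e u)) x = D c (D e (D d u)) x"
  by (rule dir_deriv_cong[OF open_\<Omega> assms Du_commute])

lemma DDDu_commute: 
  assumes x: "x \<in> \<Omega>"
  shows "D d (D d (D e (D e u))) x =
    D e (D e (D d (D d u))) x"
proof -
  have 1: "D d (D e (D e u)) y = D e (D e (D d u)) y"
    if "y \<in> \<Omega>" for y
    using DDu_commute[OF that, of d e e] DDu_commute'[OF that, of e d e] by simp
  have 2: "D d (D e (D d u)) y = D e (D d (D d u)) y"
    if "y \<in> \<Omega>" for y
    by (rule DDu_commute[OF that])
  have "D d (D d (D e (D e u))) x =
      D d (D e (D e (D d u))) x"
    by (rule dir_deriv_cong[OF open_\<Omega> x 1])
  also have "\<dots> = D e (D d (D e (D d u))) x"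
    by (rule dir_deriv_commute[OF open_\<Omega> x DDu_Ck]) auto
  also have "\<dots> = D e (D e (D d (D d u))) x"
    by (rule dir_deriv_cong[OF open_\<Omega> x 2])
  finally show ?thesis .
qed

lemma grad_Du: "grad (D e u) x0 = q e"
proof -
  have "grad (D e u) x0 \<bullet> f = q e \<bullet> f" for f
    using grad_inner[OF Du_diff[OF x0]] Dp_inner[OF x0] Du_commute[OF x0] by (simp add: q_def)
  then show ?thesis by (metis vector_eq_rdot)
qed

lemma q_eig: "q (b i) = lam i *\<^sub>R b i + A z0 *v b i"
proof -
  have "hess u x0 *v b i = q (b i)"
    unfolding q_def using hess_mult[OF open_\<Omega> x0 u_Ck[of 2]] by simp
  then show ?thesis
    using eig[of i] by (simp add: MA_matrix_def matrix_vector_mult_diff_rdistrib algebra_simps)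
qed

lemma b_norm [simp]: "norm (b i) = 1" by (rule orthonormal_frame_norm[OF frame])

lemma A_norm: "norm (A z0 *v e) \<le> M * norm e"
proof (cases "A z0 *v e = 0")
  case False
  have "(norm (A z0 *v e))\<^sup>2 \<le> M * norm (A z0 *v e) * norm e"
    using A_bd0[of "A z0 *v e" e] by (simp add: mform_def power2_norm_eq_inner)
  then have "norm (A z0 *v e) * norm (A z0 *v e) \<le> norm (A z0 *v e) * (M * norm e)"
    by (simp add: power2_eq_square mult_ac)
  then show ?thesis using False by simp
qed (use M1 in simp)

lemma q_norm: "norm (q (b i)) \<le> lam i + M"
  using norm_triangle_ineq[of "lam i *\<^sub>R b i" "A z0 *v b i"] A_norm[of "b i"] lam0[of i]
  by (simp add: q_eig)

lemma b_q_norm: "norm (b i, q (b i)) \<le> lam i + 2 * M"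
  using norm_Pair_le[of "b i" "q (b i)"] q_norm[of i] M1 by simp

lemma T_nonneg: "T \<ge> 0" unfolding T_def using lam0 by (intro sum_nonneg) (simp add: less_imp_le)

lemma sum_div_bound:
  assumes "\<And>i. \<bar>g i\<bar> \<le> K"
  shows "\<bar>\<Sum>i\<in>UNIV. g i / lam i\<bar> \<le> K * T"
proof -
  have "\<bar>\<Sum>i\<in>UNIV. g i / lam i\<bar> \<le> (\<Sum>i\<in>UNIV. \<bar>g i / lam i\<bar>)" by (rule sum_abs)
  also have "\<dots> \<le> (\<Sum>i\<in>UNIV. K * (1 / lam i))"
    using lam0 assms by (intro sum_mono) (simp add: abs_divide divide_right_mono less_imp_le)
  finally show ?thesis by (simp add: T_def sum_distrib_left)
qed

lemma linear_pair2: "linear (\<lambda>w. f (0, w))" if "linear f" for f :: "(real ^ 'n) \<times> (real ^ 'n) \<Rightarrow> real"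
proof (rule linearI)
  show "f (0, x + y) = f (0, x) + f (0, y)" for x y using linear_add[OF that, of "(0, x)" "(0, y)"] by simp
  show "f (0, r *\<^sub>R x) = r *\<^sub>R f (0, x)" for r x using linear_scale[OF that, of r "(0, x)"] by simp
qed

lemma linear_\<Gamma>: "linear \<Gamma>"
proof -
  have "linear (\<lambda>w. D (0, w) (a (b i) (b i)) z0)" for i
    by (rule linear_pair2[OF linear_dir_deriv[OF a_diff[OF z0_in z0_in]]])
  moreover have "linear (\<lambda>w. D (0, w) \<beta> z0)"
    by (rule linear_pair2[OF linear_dir_deriv[OF \<beta>_diff[OF z0_in z0_in]]])
  ultimately show ?thesis
    unfolding \<Gamma>_def[abs_def] divide_inverse
    by (intro linear_compose_add linear_compose_sum ballI)
      (simp_all add: linear_iff algebra_simps)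
qed

lemma \<Gamma>_bound: "\<bar>\<Gamma> w\<bar> \<le> M * (1 + T) * norm w"
proof -
  have "\<bar>\<Sum>i\<in>UNIV. D (0, w) (a (b i) (b i)) z0 / lam i\<bar> \<le> (M * norm w) * T"
    by (rule sum_div_bound) (use A_bd1[of "(0, w)" "b _" "b _"] in \<open>simp add: norm_Pair\<close>)
  moreover have "\<bar>D (0, w) \<beta> z0\<bar> \<le> M * norm w"
    using \<beta>_bd1[of "(0, w)"] by (simp add: norm_Pair)
  ultimately show ?thesis unfolding \<Gamma>_def by (simp add: algebra_simps)
qed

lemma grad_add: "f differentiable (at x) \<Longrightarrow> g differentiable (at x) \<Longrightarrow>
    grad (\<lambda>y. f y + g y) x = grad f x + grad g x"
  by (simp add: grad_def vec_eq_iff dir_deriv_add)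

lemma grad_diff: "f differentiable (at x) \<Longrightarrow> g differentiable (at x) \<Longrightarrow>
    grad (\<lambda>y. f y - g y) x = grad f x - grad g x"
  by (simp add: grad_def vec_eq_iff dir_deriv_diff)

lemma L_add:
  assumes "twice_diff \<Omega> f x0" "twice_diff \<Omega> g x0"
  shows "L (\<lambda>x. f x + g x) = L f + L g"
  using grad_add[OF twice_diffD(1)[OF assms(1) x0] twice_diffD(1)[OF assms(2) x0]]
  by (simp add: L_def twice_diff_add(2)[OF open_\<Omega> x0 assms] linear_add[OF linear_\<Gamma>]
      add_divide_distrib sum.distrib)

lemma L_diff:
  assumes "twice_diff \<Omega> f x0" "twice_diff \<Omega> g x0"
  shows "L (\<lambda>x. f x - g x) = L f - L g"
  using grad_diff[OF twice_diffD(1)[OF assms(1) x0] twice_diffD(1)[OF assms(2) x0]]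
  by (simp add: L_def twice_diff_diff(2)[OF open_\<Omega> x0 assms] linear_diff[OF linear_\<Gamma>]
      diff_divide_distrib sum_subtractf)

lemma L_cmult:
  assumes "twice_diff \<Omega> f x0"
  shows "L (\<lambda>x. c * f x) = c * L f"
proof -
  have "grad (\<lambda>x. c * f x) x0 = c *\<^sub>R grad f x0"
    by (simp add: grad_def vec_eq_iff dir_deriv_cmult[OF twice_diffD(1)[OF assms x0]])
  then show ?thesis
    using twice_diff_bounded_linear(2)[OF open_\<Omega> x0 bounded_linear_mult_right assms]
    by (simp add: L_def linear_scale[OF linear_\<Gamma>] sum_distrib_left algebra_simps)
qed

lemma L_sum:
  assumes "finite I" "\<And>i. i \<in> I \<Longrightarrow> twice_diff \<Omega> (f i) x0"
  shows "L (\<lambda>x. \<Sum>i\<in>I. f i x) = (\<Sum>i\<in>I. L (f i))"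
  using assms
proof (induction I rule: finite_induct)
  case empty
  have "grad (\<lambda>x. 0) x0 = 0" by (simp add: grad_def vec_eq_iff)
  then show ?case by (simp add: L_def linear_0[OF linear_\<Gamma>])
next
  case (insert j I)
  have "twice_diff \<Omega> (\<lambda>x. \<Sum>i\<in>I. f i x) x0"
    using twice_diff_sum[OF open_\<Omega> x0 insert.hyps(1)] insert.prems by blast
  then have "L (\<lambda>x. f j x + (\<Sum>i\<in>I. f i x)) = L (f j) + L (\<lambda>x. \<Sum>i\<in>I. f i x)"
    by (intro L_add insert.prems) auto
  then show ?case using insert by simp
qed

lemma L_chain:
  assumes f: "twice_diff \<Omega> f x0"
    and \<phi>: "\<And>y. y \<in> \<Omega> \<Longrightarrow> (\<phi> has_real_derivative \<phi>' (f y)) (at (f y))"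
    and \<phi>': "(\<phi>' has_real_derivative c) (at (f x0))"
  shows "L (\<lambda>x. \<phi> (f x)) = \<phi>' (f x0) * L f + c * (\<Sum>i\<in>UNIV. (D (b i) f x0)\<^sup>2 / lam i)"
proof -
  have "grad (\<lambda>x. \<phi> (f x)) x0 = \<phi>' (f x0) *\<^sub>R grad f x0"
    by (simp add: grad_def vec_eq_iff dir_deriv_chain_real(2)[OF twice_diffD(1)[OF f x0] \<phi>[OF x0]])
  then show ?thesis
    by (simp add: L_def twice_diff_chain_real(2)[OF open_\<Omega> x0 f \<phi> \<phi>'] linear_scale[OF linear_\<Gamma>]
        sum_distrib_left sum.distrib add_divide_distrib power2_eq_square algebra_simps)
qed

lemma L_at_maximum:
  assumes f: "twice_diff \<Omega> f x0" and max: "\<And>y. y \<in> \<Omega> \<Longrightarrow> f y \<le> f x0"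
  shows "L f \<le> 0"
proof -
  note snd = second_derivative_at_maximum[OF open_\<Omega> x0 f max]
  have "grad f x0 = 0" by (simp add: grad_def vec_eq_iff snd(1))
  moreover have "(\<Sum>i\<in>UNIV. D (b i) (D (b i) f) x0 / lam i) \<le> 0"
    using snd(2) lam0 by (intro sum_nonpos) (simp add: divide_nonpos_pos)
  ultimately show ?thesis by (simp add: L_def linear_0[OF linear_\<Gamma>])
qed

text \<open>
  The compositions \<open>x \<mapsto> A\<^sub>\<xi>\<^sub>\<eta>(x, Du(x))\<close> and \<open>x \<mapsto> \<beta>(x, Du(x))\<close>.
\<close>

abbreviation "ap \<xi> \<eta> \<equiv> \<lambda>x. a \<xi> \<eta> (x, p x)"
abbreviation "\<beta>p \<equiv> \<lambda>x. \<beta> (x, p x)"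

lemma on_graph: "x \<in> \<Omega> \<Longrightarrow> (x, p x) \<in> \<Omega> \<times> UNIV" by simp

lemma ap_D: "x \<in> \<Omega> \<Longrightarrow> D e (ap \<xi> \<eta>) x = D (e, D e p x) (a \<xi> \<eta>) (x, p x)"
  by (rule dir_deriv_compose_graph[OF open_\<Omega> x0 _ p_twice[OF x0]]) (simp_all add: a2)

lemma ap_twice: "twice_diff \<Omega> (ap \<xi> \<eta>) x0"
  by (rule twice_diff_compose_graph(2)[OF open_\<Omega> x0 _ p_twice[OF x0]]) (simp_all add: a2)

lemma ap_DD: "D d (D e (ap \<xi> \<eta>)) x0 =
    D (d, q d) (D (e, q e) (a \<xi> \<eta>)) z0 + D (0, D d (D e p) x0) (a \<xi> \<eta>) z0"
  unfolding q_def
  by (rule twice_diff_compose_graph(3)[OF open_\<Omega> x0 _ p_twice[OF x0]]) (simp_all add: a2)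

lemma \<beta>p_D: "x \<in> \<Omega> \<Longrightarrow> D e (\<beta>p) x = D (e, D e p x) \<beta> (x, p x)"
  by (rule dir_deriv_compose_graph[OF open_\<Omega> x0 _ p_twice[OF x0]]) (simp_all add: \<beta>2)

lemma \<beta>p_twice: "twice_diff \<Omega> (\<beta>p) x0"
  by (rule twice_diff_compose_graph(2)[OF open_\<Omega> x0 _ p_twice[OF x0]]) (simp_all add: \<beta>2)

lemma \<beta>p_DD: "D d (D e (\<beta>p)) x0 =
    D (d, q d) (D (e, q e) \<beta>) z0 + D (0, D d (D e p) x0) \<beta> z0"
  unfolding q_def
  by (rule twice_diff_compose_graph(3)[OF open_\<Omega> x0 _ p_twice[OF x0]]) (simp_all add: \<beta>2)

text \<open>
  \<open>\<xi> \<bullet> W(x) \<eta>\<close> for \<open>W = D\<^sup>2u - A(x,Du)\<close>, written with directional derivatives.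
\<close>
definition "W \<xi> \<eta> x = D \<xi> (D \<eta> u) x - ap \<xi> \<eta> x"

lemma W_eq: "x \<in> \<Omega> \<Longrightarrow> W \<xi> \<eta> x = \<xi> \<bullet> (MA_matrix A u x *v \<eta>)"
  using hess_inner[OF open_\<Omega> _ u_Ck[of 2]] by (simp add: W_def MA_matrix_form)

lemma W_twice: "twice_diff \<Omega> (W \<xi> \<eta>) x0"
  unfolding W_def[abs_def] by (intro twice_diff_diff open_\<Omega> x0 DDu_twice ap_twice)

lemma W_D: "D e (W \<xi> \<eta>) x0 =
    D e (D \<xi> (D \<eta> u)) x0 - D (e, q e) (a \<xi> \<eta>) z0"
proof -
  have "D e (W \<xi> \<eta>) x0 = D e (D \<xi> (D \<eta> u)) x0 - D e (ap \<xi> \<eta>) x0"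
    unfolding W_def[abs_def] by (rule dir_deriv_diff[OF DDu_diff[OF x0] twice_diffD(1)[OF ap_twice x0]])
  then show ?thesis by (simp add: ap_D[OF x0] q_def)
qed

lemma W_DD: "D e (D e (W \<xi> \<eta>)) x0 =
    D e (D e (D \<xi> (D \<eta> u))) x0 -
    (D (e, q e) (D (e, q e) (a \<xi> \<eta>)) z0 + D (0, D e (D e p) x0) (a \<xi> \<eta>) z0)"
proof -
  have "D e (D e (W \<xi> \<eta>)) x0 =
    D e (D e (D \<xi> (D \<eta> u))) x0 - D e (D e (ap \<xi> \<eta>)) x0"
    unfolding W_def[abs_def] by (rule twice_diff_diff(2)[OF open_\<Omega> x0 DDu_twice[OF x0] ap_twice])
  then show ?thesis by (simp add: ap_DD q_def)
qed

lemma symMA: "x \<in> \<Omega> \<Longrightarrow> transpose (MA_matrix A u x) = MA_matrix A u x"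
  by (rule transpose_MA_matrix[OF open_\<Omega> _ u_Ck[of 2]]) (simp_all add: symA)

lemma ln_det_sheared:
  assumes x: "x \<in> \<Omega>" and c: "1 + c m > 0"
  shows "\<beta>p x \<le> (\<Sum>i\<in>UNIV. (W (b i) (b i) x + 2 * c i * W (b i) (b m) x + (c i)\<^sup>2 * W (b m) (b m) x) / lam i)
     - CARD('n) + (\<Sum>i\<in>UNIV. ln (lam i)) - 2 * ln (1 + c m)"
proof -
  let ?M = "MA_matrix A u x"
  have "pos_definite ?M" using ell x by (simp add: elliptic_def)
  note * = ln_det_le_sheared_frame[where c = c and m = m, OF symMA[OF x] this frame lam0 c]
  have "(b i + c i *\<^sub>R b m) \<bullet> (?M *v (b i + c i *\<^sub>R b m)) =
      W (b i) (b i) x + 2 * c i * W (b i) (b m) x + (c i)\<^sup>2 * W (b m) (b m) x" for i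
    using symmetric_matrix_inner[OF symMA[OF x], of "b m" "b i"]
    by (simp add: W_eq[OF x] matrix_vector_right_distrib matrix_vector_mult_scaleR inner_add
        power2_eq_square algebra_simps)
  then show ?thesis using * equ[OF x] by simp
qed

lemma W_eig: "W (b i) (b j) x0 = (if i = j then lam i else 0)"
  using orthonormal_frame_inner[OF frame, of i j] by (simp add: W_eq[OF x0] eig)

lemma \<beta>p_x0: "\<beta>p x0 = (\<Sum>i\<in>UNIV. ln (lam i))"
proof -
  have "ln (det (MA_matrix A u x0)) = (\<Sum>i\<in>UNIV. ln (lam i))"
    unfolding det_eq_prod_eigenvalues[OF frame eig] using lam0
    by (intro ln_prod) (auto simp: less_imp_neq[THEN not_sym])
  then show ?thesis using equ[OF x0] by simp
qed

text \<open>
  Along the line \<open>x0 + t e\<close> the right-hand side of \<open>ln_det_sheared\<close> with \<open>c = t N\<close> touches \<open>\<beta>(x,Du)\<close> from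
  above at \<open>t = 0\<close>. With \<open>N = 0\<close> the first-order condition is the differentiated equation. The second-order
  condition holds for every \<open>N\<close>; optimizing over \<open>N\<close> later yields the terms quadratic in the third
  derivatives of \<open>u\<close>.
\<close>
lemma second_order_comparison:
  fixes e :: "real ^ 'n" and N :: "'n \<Rightarrow> real"
  shows "(\<Sum>i\<in>UNIV. (D e (W (b i) (b i)) x0 + 2 * N i * W (b i) (b m) x0) / lam i) - 2 * N m = D e \<beta>p x0"
    and "(\<Sum>i\<in>UNIV. (D e (D e (W (b i) (b i))) x0 + 4 * N i * D e (W (b i) (b m)) x0
             + 2 * (N i)\<^sup>2 * lam m) / lam i) + 2 * (N m)\<^sup>2 \<ge> D e (D e \<beta>p) x0"
proof -
  obtain r where r: "r > 0" "ball x0 r \<subseteq> \<Omega>" using open_\<Omega> x0 openE by blast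
  \<comment> \<open>Small enough for the segment to stay in \<open>\<Omega>\<close> and for \<open>1 + t
    N m\<close> to stay positive.\<close>
  define d where "d = min (r / (norm e + 1)) (1 / (\<bar>N m\<bar> + 1))"
  have n1: "norm e + 1 > 0" "\<bar>N m\<bar> + 1 > 0" using norm_ge_zero[of e] by linarith+
  have d0: "d > 0" using r(1) n1 by (simp add: d_def)
  have inS: "x0 + t *\<^sub>R e \<in> \<Omega>" if "\<bar>t\<bar> < d" for t
  proof -
    have "\<bar>t\<bar> * norm e \<le> \<bar>t\<bar> * (norm e + 1)" by (intro mult_left_mono) auto
    also have "\<dots> < (r / (norm e + 1)) * (norm e + 1)" using that n1 by (intro mult_strict_right_mono) (auto simp: d_def)
    also have "\<dots> = r" using n1 by simp
    finally show ?thesis using r(2) by (auto simp: dist_norm)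
  qed
  have pos: "1 + t * N m > 0" if "\<bar>t\<bar> < d" for t
  proof -
    have "\<bar>t * N m\<bar> \<le> \<bar>t\<bar> * (\<bar>N m\<bar> + 1)" by (simp add: abs_mult mult_left_mono)
    also have "\<dots> < (1 / (\<bar>N m\<bar> + 1)) * (\<bar>N m\<bar> + 1)" using that n1 by (intro mult_strict_right_mono) (auto simp: d_def)
    also have "\<dots> = 1" using n1 by simp
    finally show ?thesis by linarith
  qed
  define w where "w i t = W (b i) (b i) (x0 + t *\<^sub>R e)" for i t
  define v where "v i t = W (b i) (b m) (x0 + t *\<^sub>R e)" for i t
  define w1 where "w1 i t = D e (W (b i) (b i)) (x0 + t *\<^sub>R e)" for i t
  define v1 where "v1 i t = D e (W (b i) (b m)) (x0 + t *\<^sub>R e)" for i t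
  define w2 where "w2 i = D e (D e (W (b i) (b i))) x0" for i
  define v2 where "v2 i = D e (D e (W (b i) (b m))) x0" for i
  have wD: "(w i has_real_derivative w1 i t) (at t)" if "\<bar>t\<bar> < d" for i t
    unfolding w_def w1_def by (rule line_has_real_derivative[OF twice_diffD(1)[OF W_twice inS[OF that]]])
  have vD: "(v i has_real_derivative v1 i t) (at t)" if "\<bar>t\<bar> < d" for i t
    unfolding v_def v1_def by (rule line_has_real_derivative[OF twice_diffD(1)[OF W_twice inS[OF that]]])
  have w1D: "(w1 i has_real_derivative w2 i) (at 0)" for i
    unfolding w1_def w2_def
    using line_has_real_derivative[of "D e (W (b i) (b i))" x0 0 e] twice_diffD(2)[OF W_twice] by simp
  have v1D: "(v1 i has_real_derivative v2 i) (at 0)" for i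
    unfolding v1_def v2_def
    using line_has_real_derivative[of "D e (W (b i) (b m))" x0 0 e] twice_diffD(2)[OF W_twice] by simp
  define h where "h t = \<beta>p (x0 + t *\<^sub>R e)" for t
  define h1 where "h1 t = D e \<beta>p (x0 + t *\<^sub>R e)" for t
  define h2 where "h2 = D e (D e \<beta>p) x0"
  have hD: "(h has_real_derivative h1 t) (at t)" if "\<bar>t\<bar> < d" for t
    unfolding h_def h1_def by (rule line_has_real_derivative[OF twice_diffD(1)[OF \<beta>p_twice inS[OF that]]])
  have h1D: "(h1 has_real_derivative h2) (at 0)"
    unfolding h1_def h2_def
    using line_has_real_derivative[of "D e \<beta>p" x0 0 e] twice_diffD(2)[OF \<beta>p_twice] by simp
  define F where "F t = (\<Sum>i\<in>UNIV. (w i t + 2 * (t * N i) * v i t + (t * N i)\<^sup>2 * w m t) / lam i)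
      - 2 * ln (1 + t * N m) - h t" for t
  define G where "G t = (\<Sum>i\<in>UNIV. (w1 i t + (2 * N i * v i t + 2 * (t * N i) * v1 i t)
        + (2 * t * (N i)\<^sup>2 * w m t + (t * N i)\<^sup>2 * w1 m t)) / lam i)
      - 2 * N m / (1 + t * N m) - h1 t" for t
  define G2 where "G2 = (\<Sum>i\<in>UNIV. (w2 i + 4 * N i * v1 i 0 + 2 * (N i)\<^sup>2 * w m 0) / lam i) + 2 * (N m)\<^sup>2 - h2"
  have FD: "(F has_real_derivative G t) (at t)" if "\<bar>t\<bar> < d" for t
    unfolding F_def[abs_def] G_def
  proof (intro DERIV_diff DERIV_sum DERIV_cdivide hD[OF that])
    show "((\<lambda>t. w i t + 2 * (t * N i) * v i t + (t * N i)\<^sup>2 * w m t) has_real_derivative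
        w1 i t + (2 * N i * v i t + 2 * (t * N i) * v1 i t)
        + (2 * t * (N i)\<^sup>2 * w m t + (t * N i)\<^sup>2 * w1 m t)) (at t)" for i
      by (auto intro!: derivative_eq_intros wD[OF that] vD[OF that] simp: power2_eq_square algebra_simps)
    show "((\<lambda>t. 2 * ln (1 + t * N m)) has_real_derivative 2 * N m / (1 + t * N m)) (at t)"
      using pos[OF that] by (auto intro!: derivative_eq_intros)
  qed
  have w00: "((w i) has_real_derivative w1 i 0) (at 0)" "((v i) has_real_derivative v1 i 0) (at 0)" for i
    using wD[of 0] vD[of 0] d0 by auto
  have GD: "(G has_real_derivative G2) (at 0)"
  proof -
    have 1: "((\<lambda>t. w1 i t + (2 * N i * v i t + 2 * (t * N i) * v1 i t)
        + (2 * t * (N i)\<^sup>2 * w m t + (t * N i)\<^sup>2 * w1 m t)) has_real_derivative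
        w2 i + 4 * N i * v1 i 0 + 2 * (N i)\<^sup>2 * w m 0) (at 0)" for i
      by (auto intro!: derivative_eq_intros w00 w1D v1D simp: power2_eq_square algebra_simps)
    have 2: "((\<lambda>t. 2 * N m / (1 + t * N m)) has_real_derivative - (2 * (N m)\<^sup>2)) (at 0)"
      by (auto intro!: derivative_eq_intros simp: power2_eq_square)
    have "(G has_real_derivative (\<Sum>i\<in>UNIV. (w2 i + 4 * N i * v1 i 0 + 2 * (N i)\<^sup>2 * w m 0) / lam i)
        - (- (2 * (N m)\<^sup>2)) - h2) (at 0)"
      unfolding G_def[abs_def] by (intro DERIV_diff DERIV_sum DERIV_cdivide 1 2 h1D)
    then show ?thesis by (simp add: G2_def)
  qed
  have min: "F 0 \<le> F t" if "\<bar>t\<bar> < d" for t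
  proof -
    have "F 0 = real CARD('n) - (\<Sum>i\<in>UNIV. ln (lam i))"
      using lam0 by (simp add: F_def w_def h_def \<beta>p_x0 W_eig less_imp_neq[THEN not_sym])
    moreover have "h t \<le> (\<Sum>i\<in>UNIV. (w i t + 2 * (t * N i) * v i t + (t * N i)\<^sup>2 * w m t) / lam i)
     - CARD('n) + (\<Sum>i\<in>UNIV. ln (lam i)) - 2 * ln (1 + t * N m)"
      using ln_det_sheared[OF inS[OF that], of "\<lambda>i. t * N i"] pos[OF that]
      unfolding h_def w_def v_def by simp
    ultimately show ?thesis by (simp add: F_def)
  qed
  note res = second_derivative_at_minimum[OF d0 FD GD min]
  show "(\<Sum>i\<in>UNIV. (D e (W (b i) (b i)) x0 + 2 * N i * W (b i) (b m) x0) / lam i) - 2 * N m = D e \<beta>p x0"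
    using res(1) by (simp add: G_def w1_def v_def h1_def)
  show "(\<Sum>i\<in>UNIV. (D e (D e (W (b i) (b i))) x0 + 4 * N i * D e (W (b i) (b m)) x0
             + 2 * (N i)\<^sup>2 * lam m) / lam i) + 2 * (N m)\<^sup>2 \<ge> D e (D e \<beta>p) x0"
    using res(2) by (simp add: G2_def w2_def v1_def h2_def w_def W_eig)
qed

end

section \<open>Lower bound for the linearized operator on the logarithm of the largest eigenvalue\<close>

context elliptic_point
begin

lemma dir_deriv_split:
  fixes f :: "(real ^ 'n) \<times> (real ^ 'n) \<Rightarrow> real"
  assumes "f differentiable (at z)"
  shows "D (e, w) f z = D (e, 0) f z + D (0, w) f z"
  using linear_add[OF linear_dir_deriv[OF assms], of "(e, 0)" "(0, w)"] by simp

lemmas a_split = dir_deriv_split[OF a_diff[OF z0_in z0_in]]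
lemmas \<beta>_split = dir_deriv_split[OF \<beta>_diff[OF z0_in z0_in]]

lemma third_commute: "D e (D d (D d u)) x0 = D d (D d (D e u)) x0"
  using DDu_commute[OF x0, of e d d] DDu_commute'[OF x0, of d e d] by simp

text \<open>
  The equation differentiated once: the linearized operator on a first derivative of \<open>u\<close> involves no
  derivatives of \<open>u\<close> beyond the first.
\<close>
lemma L_Du: "L (D e u) = (\<Sum>i\<in>UNIV. D (e, 0) (a (b i) (b i)) z0 / lam i) + D (e, 0) \<beta> z0"
proof -
  have first: "(\<Sum>i\<in>UNIV. D e (W (b i) (b i)) x0 / lam i) = D e \<beta>p x0"
    using second_order_comparison(1)[of e "\<lambda>i. 0"] by simp
  define Z where "Z i = D (b i) (D (b i) (D e u)) x0" for i
  have Z: "D e (D (b i) (D (b i) u)) x0 = Z i" for i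
    unfolding Z_def by (rule third_commute)
  have "(\<Sum>i\<in>UNIV. (Z i - (D (e, 0) (a (b i) (b i)) z0 + D (0, q e) (a (b i) (b i)) z0)) / lam i) =
      D (e, 0) \<beta> z0 + D (0, q e) \<beta> z0"
    using first by (simp add: W_D \<beta>p_D[OF x0] q_def[symmetric] Z a_split[of e "q e"] \<beta>_split[of e "q e"])
  then show ?thesis
    by (simp add: L_def Z_def grad_Du \<Gamma>_def diff_divide_distrib add_divide_distrib sum_subtractf sum.distrib)
qed

lemma L_Du_bound: "\<bar>L (D e u)\<bar> \<le> M * (1 + T) * norm e"
proof -
  have "\<bar>\<Sum>i\<in>UNIV. D (e, 0) (a (b i) (b i)) z0 / lam i\<bar> \<le> (M * norm e) * T"
    by (rule sum_div_bound) (use A_bd1[of "(e, 0)" "b _" "b _"] in \<open>simp add: norm_Pair\<close>)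
  moreover have "\<bar>D (e, 0) \<beta> z0\<bar> \<le> M * norm e"
    using \<beta>_bd1[of "(e, 0)"] by (simp add: norm_Pair)
  ultimately show ?thesis unfolding L_Du by (simp add: algebra_simps)
qed

text \<open>
  The vector representing \<open>\<Gamma>\<close>.
\<close>
definition "\<gamma> = (\<Sum>c\<in>Basis. \<Gamma> c *\<^sub>R c)"

lemma \<Gamma>_inner: "\<Gamma> w = \<gamma> \<bullet> w"
proof -
  have "\<Gamma> w = \<Gamma> (\<Sum>c\<in>Basis. (w \<bullet> c) *\<^sub>R c)" by (simp add: euclidean_representation)
  also have "\<dots> = (\<Sum>c\<in>Basis. (w \<bullet> c) * \<Gamma> c)"
    by (simp add: linear_sum[OF linear_\<Gamma>] linear_scale[OF linear_\<Gamma>])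
  also have "\<dots> = \<gamma> \<bullet> w"
    unfolding \<gamma>_def inner_sum_left by (intro sum.cong refl) (simp add: inner_commute mult.commute)
  finally show ?thesis .
qed

lemma \<gamma>_norm: "norm \<gamma> \<le> M * (1 + T)"
  by (rule norm_le_of_inner_le) (use \<Gamma>_bound in \<open>simp add: \<Gamma>_inner\<close>)

text \<open>
  The operator \<open>L\<close> applied to the components of the gradient of \<open>u\<close>, as a vector.
\<close>
definition "Lp = (\<Sum>i\<in>UNIV. (1 / lam i) *\<^sub>R D (b i) (D (b i) p) x0) - q \<gamma>"

lemma q_commute: "q e \<bullet> f = q f \<bullet> e"
  unfolding q_def Dp_inner[OF x0] by (rule Du_commute[OF x0])

lemma Lp_inner: "Lp \<bullet> f = L (D f u)"
proof -
  have "Lp \<bullet> f = (\<Sum>i\<in>UNIV. (D (b i) (D (b i) p) x0 \<bullet> f) / lam i) - q \<gamma> \<bullet> f"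
    by (simp add: Lp_def inner_diff_left inner_sum_left)
  also have "q \<gamma> \<bullet> f = \<gamma> \<bullet> q f" unfolding q_commute[of \<gamma> f] by (rule inner_commute)
  finally show ?thesis by (simp add: L_def grad_Du \<Gamma>_inner DDp_inner[OF x0])
qed

lemma Lp_norm: "norm Lp \<le> M * (1 + T)"
  by (rule norm_le_of_inner_le) (use L_Du_bound in \<open>simp add: Lp_inner\<close>)

text \<open>
  The Hessian of a function of \<open>(x,p)\<close> along the tangent vector \<open>(e, D\<^sup>2u e)\<close> of the graph of \<open>Du\<close>.
\<close>
abbreviation "Q f e \<equiv> D (e, q e) (D (e, q e) f) z0"

lemma L_ap: "L (ap \<xi> \<eta>) = (\<Sum>i\<in>UNIV. Q (a \<xi> \<eta>) (b i) / lam i)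
    + D (0, Lp) (a \<xi> \<eta>) z0 - D (\<gamma>, 0) (a \<xi> \<eta>) z0"
proof -
  let ?D = "\<lambda>w. D (0, w) (a \<xi> \<eta>) z0"
  have lin: "linear ?D" by (rule linear_pair2[OF linear_dir_deriv[OF a_diff[OF z0_in z0_in]]])
  have "\<Gamma> (grad (ap \<xi> \<eta>) x0) = D \<gamma> (ap \<xi> \<eta>) x0"
    unfolding \<Gamma>_inner using grad_inner[OF twice_diffD(1)[OF ap_twice x0]] by (simp add: inner_commute)
  also have "\<dots> = D (\<gamma>, 0) (a \<xi> \<eta>) z0 + ?D (q \<gamma>)"
    by (simp add: ap_D[OF x0] q_def[symmetric] a_split[of \<gamma> "q \<gamma>"])
  finally have 1: "\<Gamma> (grad (ap \<xi> \<eta>) x0) = D (\<gamma>, 0) (a \<xi> \<eta>) z0 + ?D (q \<gamma>)" .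
  have "?D Lp = (\<Sum>i\<in>UNIV. ?D (D (b i) (D (b i) p) x0) / lam i) - ?D (q \<gamma>)"
    unfolding Lp_def by (simp add: linear_diff[OF lin] linear_sum[OF lin] linear_scale[OF lin])
  then show ?thesis
    by (simp add: L_def 1 ap_DD add_divide_distrib sum.distrib)
qed

lemma n1: "real CARD('n) \<ge> 1" by (simp add: Suc_leI)

lemma quadratic_div_bound:
  assumes "\<bar>g\<bar> \<le> M * (lam i + 2 * M)\<^sup>2"
  shows "\<bar>g / lam i\<bar> \<le> M * lam m + 4 * M\<^sup>2 + 4 * M ^ 3 * (1 / lam i)"
proof -
  have "\<bar>g / lam i\<bar> = \<bar>g\<bar> / lam i" using lam0[of i] by simp
  also have "\<dots> \<le> M * (lam i + 2 * M)\<^sup>2 / lam i"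
    using lam0[of i] assms by (intro divide_right_mono) auto
  also have "\<dots> = M * lam i + 4 * M\<^sup>2 + 4 * M ^ 3 * (1 / lam i)"
    using lam0[of i] by (simp add: field_simps power2_eq_square power3_eq_cube)
  also have "\<dots> \<le> M * lam m + 4 * M\<^sup>2 + 4 * M ^ 3 * (1 / lam i)"
    using lam_le[of i] M1 by (simp add: mult_left_mono)
  finally show ?thesis .
qed

lemma L_ap_bound:
  assumes "norm \<xi> = 1" "norm \<eta> = 1"
  shows "\<bar>L (ap \<xi> \<eta>)\<bar> \<le> real CARD('n) * (M * lam m + 4 * M\<^sup>2) + 4 * M ^ 3 * T + 2 * (M\<^sup>2 * (1 + T))"
proof -
  have Q: "\<bar>Q (a \<xi> \<eta>) (b i)\<bar> \<le> M * (lam i + 2 * M)\<^sup>2" for i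
  proof -
    have "\<bar>Q (a \<xi> \<eta>) (b i)\<bar> \<le> M * (norm (b i, q (b i)))\<^sup>2"
      using A_bd2[of "(b i, q (b i))" "(b i, q (b i))" \<xi> \<eta>] assms by (simp add: power2_eq_square)
    also have "\<dots> \<le> M * (lam i + 2 * M)\<^sup>2"
      using b_q_norm[of i] M1 by (intro mult_left_mono power_mono) auto
    finally show ?thesis .
  qed
  have "\<bar>\<Sum>i\<in>UNIV. Q (a \<xi> \<eta>) (b i) / lam i\<bar> \<le> (\<Sum>i\<in>UNIV. \<bar>Q (a \<xi> \<eta>) (b i) / lam i\<bar>)"
    by (rule sum_abs)
  also have "\<dots> \<le> (\<Sum>i\<in>UNIV. (M * lam m + 4 * M\<^sup>2) + 4 * M ^ 3 * (1 / lam i))"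
    by (intro sum_mono quadratic_div_bound Q)
  also have "\<dots> = real CARD('n) * (M * lam m + 4 * M\<^sup>2) + 4 * M ^ 3 * T"
    unfolding T_def sum.distrib sum_distrib_left by (simp add: distrib_left)
  finally have 1: "\<bar>\<Sum>i\<in>UNIV. Q (a \<xi> \<eta>) (b i) / lam i\<bar> \<le> real CARD('n) * (M * lam m + 4 * M\<^sup>2) + 4 * M ^ 3 * T" .
  have "\<bar>D (0, Lp) (a \<xi> \<eta>) z0\<bar> \<le> M * norm Lp"
    using A_bd1[of "(0, Lp)" \<xi> \<eta>] assms by (simp add: norm_Pair)
  also have "\<dots> \<le> M * (M * (1 + T))" using Lp_norm M1 by (intro mult_left_mono) auto
  finally have 2: "\<bar>D (0, Lp) (a \<xi> \<eta>) z0\<bar> \<le> M\<^sup>2 * (1 + T)" by (simp add: power2_eq_square)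
  have "\<bar>D (\<gamma>, 0) (a \<xi> \<eta>) z0\<bar> \<le> M * norm \<gamma>"
    using A_bd1[of "(\<gamma>, 0)" \<xi> \<eta>] assms by (simp add: norm_Pair)
  also have "\<dots> \<le> M * (M * (1 + T))" using \<gamma>_norm M1 by (intro mult_left_mono) auto
  finally have 3: "\<bar>D (\<gamma>, 0) (a \<xi> \<eta>) z0\<bar> \<le> M\<^sup>2 * (1 + T)" by (simp add: power2_eq_square)
  show ?thesis unfolding L_ap using 1 2 3 by linarith
qed

text \<open>
  The second derivative of \<open>u\<close> in the direction \<open>b m\<close>, and the third-order quantities \<open>D\<^sub>m W\<^sub>i\<^sub>m\<close>.
\<close>
abbreviation "umm \<equiv> D (b m) (D (b m) u)"
definition "dW i = D (b m) (W (b i) (b m)) x0"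

lemma DDp_eq_grad: "D (b m) (D (b m) p) x0 = grad umm x0"
proof -
  have "D (b m) (D (b m) p) x0 \<bullet> f = grad umm x0 \<bullet> f" for f
    unfolding DDp_inner[OF x0] grad_inner[OF DDu_diff[OF x0]] by (rule third_commute[symmetric])
  then show ?thesis by (metis vector_eq_rdot)
qed

text \<open>
  The equation differentiated twice in the direction \<open>b m\<close>, with the part of the third-order terms that is
  needed.
\<close>
lemma L_umm_ge:
  "L umm \<ge> (\<Sum>i\<in>UNIV. Q (a (b i) (b i)) (b m) / lam i) + Q \<beta> (b m)
     + (\<Sum>i\<in>UNIV - {m}. 2 * (dW i)\<^sup>2 / (lam m * lam i)) + (dW m)\<^sup>2 / (lam m)\<^sup>2"
proof -
  \<comment> \<open>The minimizer of the quadratic expression in \<open>N\<close> in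
    \<open>second_order_comparison\<close>.\<close>
  define N where "N i = (if i = m then - dW m / (2 * lam m) else - dW i / lam m)" for i
  define S where "S i = D (b m) (D (b m) (W (b i) (b i))) x0" for i
  have cmp: "(\<Sum>i\<in>UNIV. (S i + 4 * N i * dW i + 2 * (N i)\<^sup>2 * lam m) / lam i) + 2 * (N m)\<^sup>2
      \<ge> D (b m) (D (b m) \<beta>p) x0"
    using second_order_comparison(2)[of "b m" N] by (simp add: dW_def S_def)
  have "(\<Sum>i\<in>UNIV. (S i + 4 * N i * dW i + 2 * (N i)\<^sup>2 * lam m) / lam i) =
      (\<Sum>i\<in>UNIV. S i / lam i) + (\<Sum>i\<in>UNIV. (4 * N i * dW i + 2 * (N i)\<^sup>2 * lam m) / lam i)"
    by (simp add: sum.distrib[symmetric] add_divide_distrib[symmetric] add.assoc)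
  also have "(\<Sum>i\<in>UNIV. (4 * N i * dW i + 2 * (N i)\<^sup>2 * lam m) / lam i) =
      (4 * N m * dW m + 2 * (N m)\<^sup>2 * lam m) / lam m
      + (\<Sum>i\<in>UNIV - {m}. (4 * N i * dW i + 2 * (N i)\<^sup>2 * lam m) / lam i)"
    by (simp add: sum.remove)
  also have "(\<Sum>i\<in>UNIV - {m}. (4 * N i * dW i + 2 * (N i)\<^sup>2 * lam m) / lam i) =
      (\<Sum>i\<in>UNIV - {m}. - (2 * (dW i)\<^sup>2 / (lam m * lam i)))"
    by (intro sum.cong refl) (simp add: N_def field_simps power2_eq_square)
  also have "(4 * N m * dW m + 2 * (N m)\<^sup>2 * lam m) / lam m = - (dW m)\<^sup>2 / (lam m)\<^sup>2 - 2 * (N m)\<^sup>2"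
    by (simp add: N_def field_simps power2_eq_square)
  finally have "(\<Sum>i\<in>UNIV. S i / lam i) \<ge> D (b m) (D (b m) \<beta>p) x0
      + (\<Sum>i\<in>UNIV - {m}. 2 * (dW i)\<^sup>2 / (lam m * lam i)) + (dW m)\<^sup>2 / (lam m)\<^sup>2"
    using cmp by (simp add: sum_negf)
  moreover have "S i = D (b i) (D (b i) umm) x0 -
      (Q (a (b i) (b i)) (b m) + D (0, grad umm x0) (a (b i) (b i)) z0)" for i
    by (simp add: S_def W_DD DDDu_commute[OF x0, of "b m"] DDp_eq_grad)
  moreover have "D (b m) (D (b m) \<beta>p) x0 = Q \<beta> (b m) + D (0, grad umm x0) \<beta> z0"
    by (simp add: \<beta>p_DD DDp_eq_grad)
  ultimately show ?thesis
    by (simp add: L_def \<Gamma>_def diff_divide_distrib add_divide_distrib sum_subtractf sum.distrib)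
qed

lemma bilinear_expand:
  fixes f :: "(real ^ 'n) \<times> (real ^ 'n) \<Rightarrow> real"
  assumes f: "twice_diff (\<Omega> \<times> UNIV) f z" and z: "z \<in> \<Omega> \<times> UNIV"
  shows "D (s *\<^sub>R \<zeta> + \<omega>) (D (s *\<^sub>R \<zeta> + \<omega>) f) z =
    s\<^sup>2 * D \<zeta> (D \<zeta> f) z + s * D \<zeta> (D \<omega> f) z
    + s * D \<omega> (D \<zeta> f) z + D \<omega> (D \<omega> f) z"
proof -
  note l1 = linear_dir_deriv2(1)[OF open_prod z f] and l2 = linear_dir_deriv2(2)[OF open_prod z f]
  show ?thesis
    by (simp add: linear_add[OF l1] linear_add[OF l2] linear_scale[OF l1] linear_scale[OF l2]
        power2_eq_square algebra_simps)
qed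

lemma lam_M_le: "lam m + 2 * M \<le> 3 * M * lam m"
proof -
  have "1 * lam m \<le> M * lam m" using M1 lam1 by (intro mult_right_mono) auto
  moreover have "2 * M * 1 \<le> 2 * M * lam m" using M1 lam1 by (intro mult_left_mono) auto
  ultimately show ?thesis by simp
qed

text \<open>
  Here \<open>D\<^sup>2u b m = lam m b m + A b m\<close>. The term of order \<open>(lam m)\<^sup>2\<close> is \<open>D\<^sub>p\<^sub>p A\<^sub>i\<^sub>i\<close> in the direction \<open>b m\<close>, which
  is nonnegative for \<open>i \<noteq> m\<close> by regularity. For \<open>i = m\<close> it survives, but it will be divided by \<open>lam m\<close>.
\<close>
lemma Q_a_lower: "Q (a (b i) (b i)) (b m) \<ge> (if i = m then - M * (lam m)\<^sup>2 else 0) - 8 * M ^ 3 * lam m"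
proof -
  let ?f = "a (b i) (b i)"
  define \<zeta> where "\<zeta> = (0 :: real ^ 'n, b m)"
  define \<omega> where "\<omega> = (b m, A z0 *v b m)"
  have eq: "(b m, q (b m)) = lam m *\<^sub>R \<zeta> + \<omega>" by (simp add: \<zeta>_def \<omega>_def q_eig)
  have nz: "norm \<zeta> = 1" by (simp add: \<zeta>_def norm_Pair)
  have no: "norm \<omega> \<le> 2 * M"
    using norm_Pair_le[of "b m" "A z0 *v b m"] A_norm[of "b m"] M1 by (simp add: \<omega>_def)
  have bd: "\<bar>D \<sigma> (D \<tau> ?f) z0\<bar> \<le> M * norm \<sigma> * norm \<tau>" for \<sigma> \<tau>
    using A_bd2[of \<sigma> \<tau> "b i" "b i"] by simp
  have c1: "D \<zeta> (D \<omega> ?f) z0 \<ge> - (2 * M\<^sup>2)"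
  proof -
    have "M * norm \<zeta> * norm \<omega> \<le> M * (2 * M)" using nz no M1 by simp
    then show ?thesis using bd[of \<zeta> \<omega>] by (simp add: power2_eq_square)
  qed
  have c2: "D \<omega> (D \<zeta> ?f) z0 \<ge> - (2 * M\<^sup>2)"
  proof -
    have "M * norm \<omega> * norm \<zeta> \<le> M * (2 * M)" using nz no M1 by simp
    then show ?thesis using bd[of \<omega> \<zeta>] by (simp add: power2_eq_square)
  qed
  have c3: "D \<omega> (D \<omega> ?f) z0 \<ge> - (4 * M ^ 3)"
  proof -
    have "M * norm \<omega> * norm \<omega> \<le> M * (2 * M) * (2 * M)" using no M1 by (intro mult_mono) auto
    then show ?thesis using bd[of \<omega> \<omega>] by (simp add: power3_eq_cube)
  qed
  have c0: "D \<zeta> (D \<zeta> ?f) z0 \<ge> (if i = m then - M else 0)"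
  proof (cases "i = m")
    case True
    then show ?thesis using bd[of \<zeta> \<zeta>] nz by simp
  next
    case False
    then show ?thesis using reg[of "b i" "b m" "grad u x0"] orthonormal_frame_inner[OF frame, of i m]
      by (simp add: \<zeta>_def)
  qed
  have l: "lam m \<ge> 0" using lam1 by simp
  have e0: "(lam m)\<^sup>2 * D \<zeta> (D \<zeta> ?f) z0 \<ge> (if i = m then - M * (lam m)\<^sup>2 else 0)"
  proof -
    have "(lam m)\<^sup>2 * (if i = m then - M else 0) \<le> (lam m)\<^sup>2 * D \<zeta> (D \<zeta> ?f) z0"
      by (rule mult_left_mono[OF c0]) simp
    moreover have "(lam m)\<^sup>2 * (if i = m then - M else 0) = (if i = m then - M * (lam m)\<^sup>2 else 0)" by simp
    ultimately show ?thesis by linarith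
  qed
  have e1: "lam m * D \<zeta> (D \<omega> ?f) z0 \<ge> - (2 * M\<^sup>2 * lam m)"
    using mult_left_mono[OF c1 l] by (simp add: algebra_simps)
  have e2: "lam m * D \<omega> (D \<zeta> ?f) z0 \<ge> - (2 * M\<^sup>2 * lam m)"
    using mult_left_mono[OF c2 l] by (simp add: algebra_simps)
  have M23: "M\<^sup>2 \<le> M ^ 3" using M1 by (intro power_increasing) auto
  have e3: "4 * M\<^sup>2 * lam m \<le> 4 * M ^ 3 * lam m" using M23 l by (intro mult_right_mono) auto
  have e4: "4 * M ^ 3 \<le> 4 * M ^ 3 * lam m" using M1 lam1 by simp
  show ?thesis
    unfolding eq bilinear_expand[OF a2[OF z0_in] z0_in] using e0 e1 e2 e3 e4 c3 by linarith
qed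

lemma Q_\<beta>_lower: "Q \<beta> (b m) \<ge> - (9 * M ^ 3 * (lam m)\<^sup>2)"
proof -
  have "norm (b m, q (b m)) \<le> 3 * M * lam m" using b_q_norm[of m] lam_M_le by linarith
  then have "(norm (b m, q (b m)))\<^sup>2 \<le> (3 * M * lam m)\<^sup>2" by (intro power_mono) auto
  then have "M * (norm (b m, q (b m)))\<^sup>2 \<le> M * (3 * M * lam m)\<^sup>2" using M1 by simp
  moreover have "\<bar>Q \<beta> (b m)\<bar> \<le> M * (norm (b m, q (b m)))\<^sup>2"
    using \<beta>_bd2[of "(b m, q (b m))" "(b m, q (b m))"] by (simp add: power2_eq_square mult.assoc)
  ultimately show ?thesis by (simp add: power2_eq_square power3_eq_cube mult_ac)
qed

lemma sum_Q_lower: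
  "(\<Sum>i\<in>UNIV. Q (a (b i) (b i)) (b m) / lam i) \<ge> - (M * lam m) - 8 * M ^ 3 * lam m * T"
proof -
  have "(\<Sum>i\<in>UNIV. Q (a (b i) (b i)) (b m) / lam i) \<ge>
      (\<Sum>i\<in>UNIV. ((if i = m then - M * (lam m)\<^sup>2 else 0) - 8 * M ^ 3 * lam m) / lam i)"
    using lam0 by (intro sum_mono divide_right_mono Q_a_lower) (simp add: less_imp_le)
  also have "(\<Sum>i\<in>UNIV. ((if i = m then - M * (lam m)\<^sup>2 else 0) - 8 * M ^ 3 * lam m) / lam i) =
      (\<Sum>i\<in>UNIV. (if i = m then - M * lam m else 0) - 8 * M ^ 3 * lam m * (1 / lam i))"
    by (intro sum.cong refl) (simp add: diff_divide_distrib power2_eq_square)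
  also have "\<dots> = - (M * lam m) - 8 * M ^ 3 * lam m * T"
    by (simp add: sum_subtractf T_def sum_distrib_left)
  finally show ?thesis .
qed

text \<open>
  The derivatives \<open>D\<^sub>i W\<^sub>m\<^sub>m\<close>. They agree with \<open>D\<^sub>m W\<^sub>i\<^sub>m\<close> up to terms without third derivatives of \<open>u\<close>.
\<close>
definition "E i = D (b i) (W (b m) (b m)) x0"

lemma E_dW: "\<bar>E i - dW i\<bar> \<le> 6 * M\<^sup>2 * lam m" "E m = dW m"
proof -
  have "D (b i) umm x0 = D (b m) (D (b i) (D (b m) u)) x0"
    by (rule DDu_commute[OF x0])
  then have "E i - dW i = D (b m, q (b m)) (a (b i) (b m)) z0 - D (b i, q (b i)) (a (b m) (b m)) z0"
    by (simp add: E_def dW_def W_D)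
  moreover have "\<bar>D (b m, q (b m)) (a (b i) (b m)) z0\<bar> \<le> M * (3 * M * lam m)"
  proof -
    have "\<bar>D (b m, q (b m)) (a (b i) (b m)) z0\<bar> \<le> M * norm (b m, q (b m))"
      using A_bd1[of "(b m, q (b m))" "b i" "b m"] by simp
    also have "\<dots> \<le> M * (3 * M * lam m)"
      using order_trans[OF b_q_norm[of m] lam_M_le] M1 by (intro mult_left_mono) auto
    finally show ?thesis .
  qed
  moreover have "\<bar>D (b i, q (b i)) (a (b m) (b m)) z0\<bar> \<le> M * (3 * M * lam m)"
  proof -
    have "\<bar>D (b i, q (b i)) (a (b m) (b m)) z0\<bar> \<le> M * norm (b i, q (b i))"
      using A_bd1[of "(b i, q (b i))" "b m" "b m"] by simp
    also have "\<dots> \<le> M * (3 * M * lam m)"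
    proof (rule mult_left_mono)
      show "norm (b i, q (b i)) \<le> 3 * M * lam m" using b_q_norm[of i] lam_M_le lam_le[of i] by linarith
    qed (use M1 in simp)
    finally show ?thesis .
  qed
  ultimately show "\<bar>E i - dW i\<bar> \<le> 6 * M\<^sup>2 * lam m" by (simp add: power2_eq_square)
  show "E m = dW m" by (simp add: E_def dW_def)
qed

lemma square_gap: "2 * y\<^sup>2 - x\<^sup>2 \<ge> - 2 * (x - y)\<^sup>2" for x y :: real
proof -
  have "2 * y\<^sup>2 - x\<^sup>2 + 2 * (x - y)\<^sup>2 = (x - 2 * y)\<^sup>2" by (simp add: power2_eq_square algebra_simps)
  then show ?thesis using zero_le_power2[of "x - 2 * y"] by linarith
qed

text \<open>
  The third-order terms of the twice differentiated equation absorb the gradient term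
  \<open>\<Sum>i. (D\<^sub>i W\<^sub>m\<^sub>m)\<^sup>2 / lam i\<close> produced by the logarithm. For \<open>i = m\<close> the two cancel exactly; for \<open>i \<noteq> m\<close> the
  factor \<open>2\<close> leaves room for the commutation error.
\<close>
lemma third_order_terms:
  "((\<Sum>i\<in>UNIV - {m}. 2 * (dW i)\<^sup>2 / (lam m * lam i)) + (dW m)\<^sup>2 / (lam m)\<^sup>2) / lam m
     - (\<Sum>i\<in>UNIV. (E i)\<^sup>2 / lam i) / (lam m)\<^sup>2 \<ge> - (72 * M ^ 4 * T)"
proof -
  have gap: "(2 * (dW i)\<^sup>2 - (E i)\<^sup>2) / ((lam m)\<^sup>2 * lam i) \<ge> - (72 * M ^ 4 * (1 / lam i))" for i
  proof -
    have "(E i - dW i)\<^sup>2 \<le> (6 * M\<^sup>2 * lam m)\<^sup>2"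
      using power_mono[OF E_dW(1)[of i], of 2] by simp
    then have "2 * (dW i)\<^sup>2 - (E i)\<^sup>2 \<ge> - (72 * M ^ 4 * (lam m)\<^sup>2)"
      using square_gap[where x = "E i" and y = "dW i"] by (simp add: power_mult_distrib)
    then have "(2 * (dW i)\<^sup>2 - (E i)\<^sup>2) / ((lam m)\<^sup>2 * lam i) \<ge> - (72 * M ^ 4 * (lam m)\<^sup>2) / ((lam m)\<^sup>2 * lam i)"
      using lam0[of i] by (intro divide_right_mono) auto
    then show ?thesis by simp
  qed
  have "(\<Sum>i\<in>UNIV. (E i)\<^sup>2 / lam i) = (dW m)\<^sup>2 / lam m + (\<Sum>i\<in>UNIV - {m}. (E i)\<^sup>2 / lam i)"
    by (simp add: sum.remove[of UNIV m] E_dW(2))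
  then have "((\<Sum>i\<in>UNIV - {m}. 2 * (dW i)\<^sup>2 / (lam m * lam i)) + (dW m)\<^sup>2 / (lam m)\<^sup>2) / lam m
     - (\<Sum>i\<in>UNIV. (E i)\<^sup>2 / lam i) / (lam m)\<^sup>2 =
     (\<Sum>i\<in>UNIV - {m}. 2 * (dW i)\<^sup>2 / (lam m * lam i)) / lam m - (\<Sum>i\<in>UNIV - {m}. (E i)\<^sup>2 / lam i) / (lam m)\<^sup>2"
    by (simp add: add_divide_distrib power2_eq_square)
  also have "\<dots> = (\<Sum>i\<in>UNIV - {m}. (2 * (dW i)\<^sup>2 - (E i)\<^sup>2) / ((lam m)\<^sup>2 * lam i))"
    unfolding sum_divide_distrib sum_subtractf[symmetric]
    by (intro sum.cong refl) (simp add: diff_divide_distrib power2_eq_square mult_ac)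
  also have "\<dots> \<ge> (\<Sum>i\<in>UNIV - {m}. - (72 * M ^ 4 * (1 / lam i)))"
    by (intro sum_mono gap)
  also have "(\<Sum>i\<in>UNIV - {m}. - (72 * M ^ 4 * (1 / lam i))) \<ge> (\<Sum>i\<in>UNIV. - (72 * M ^ 4 * (1 / lam i)))"
  proof -
    have "(\<Sum>i\<in>UNIV. - (72 * M ^ 4 * (1 / lam i))) =
        - (72 * M ^ 4 * (1 / lam m)) + (\<Sum>i\<in>UNIV - {m}. - (72 * M ^ 4 * (1 / lam i)))"
      by (rule sum.remove) auto
    moreover have "72 * M ^ 4 * (1 / lam m) \<ge> 0" using lam0[of m] M1 by simp
    ultimately show ?thesis by linarith
  qed
  also have "(\<Sum>i\<in>UNIV. - (72 * M ^ 4 * (1 / lam i))) = - (72 * M ^ 4 * T)"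
    unfolding T_def sum_distrib_left by (simp add: sum_negf)
  finally show ?thesis by linarith
qed

lemma W_pos: "x \<in> \<Omega> \<Longrightarrow> W (b m) (b m) x > 0"
proof -
  assume x: "x \<in> \<Omega>"
  have "b m \<noteq> 0" using b_norm[of m] by (metis norm_zero zero_neq_one)
  then show ?thesis using ell x by (simp add: W_eq[OF x] elliptic_def pos_definite_def)
qed

lemma ln_W_twice: "twice_diff \<Omega> (\<lambda>x. ln (W (b m) (b m) x)) x0"
proof (rule twice_diff_chain_real(1)[OF open_\<Omega> x0 W_twice])
  show "(ln has_real_derivative inverse (W (b m) (b m) y)) (at (W (b m) (b m) y))" if "y \<in> \<Omega>" for y
    using W_pos[OF that] by (rule DERIV_ln)
  show "(inverse has_real_derivative - (inverse (W (b m) (b m) x0) ^ 2)) (at (W (b m) (b m) x0))"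
    using DERIV_inverse[of "W (b m) (b m) x0" UNIV] W_pos[OF x0] by (simp add: numeral_2_eq_2)
qed

lemma L_ln_W_ge: "L (\<lambda>x. ln (W (b m) (b m) x)) \<ge> - (100 * M ^ 4 * real CARD('n) * (1 + T + lam m))"
proof -
  have "L (\<lambda>x. ln (W (b m) (b m) x)) = inverse (W (b m) (b m) x0) * L (W (b m) (b m))
      + (- (inverse (W (b m) (b m) x0) ^ 2)) * (\<Sum>i\<in>UNIV. (D (b i) (W (b m) (b m)) x0)\<^sup>2 / lam i)"
  proof (rule L_chain[OF W_twice])
    show "(ln has_real_derivative inverse (W (b m) (b m) y)) (at (W (b m) (b m) y))" if "y \<in> \<Omega>" for y
      using W_pos[OF that] by (rule DERIV_ln)
    show "(inverse has_real_derivative - (inverse (W (b m) (b m) x0) ^ 2)) (at (W (b m) (b m) x0))"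
      using DERIV_inverse[of "W (b m) (b m) x0" UNIV] W_pos[OF x0] by (simp add: numeral_2_eq_2)
  qed
  then have eq: "L (\<lambda>x. ln (W (b m) (b m) x)) = L (W (b m) (b m)) / lam m - (\<Sum>i\<in>UNIV. (E i)\<^sup>2 / lam i) / (lam m)\<^sup>2"
    by (simp add: W_eig E_def divide_inverse power_inverse mult.commute)
  have LW: "L (W (b m) (b m)) = L umm - L (ap (b m) (b m))"
    unfolding W_def[abs_def] by (rule L_diff[OF DDu_twice[OF x0] ap_twice])
  define R where "R = real CARD('n) * (M * lam m + 4 * M\<^sup>2) + 4 * M ^ 3 * T + 2 * (M\<^sup>2 * (1 + T))"
  define TH where "TH = (\<Sum>i\<in>UNIV - {m}. 2 * (dW i)\<^sup>2 / (lam m * lam i)) + (dW m)\<^sup>2 / (lam m)\<^sup>2"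
  have lm: "lam m > 0" by (rule lam0)
  have "L (W (b m) (b m)) \<ge> (- (M * lam m) - 8 * M ^ 3 * lam m * T - 9 * M ^ 3 * (lam m)\<^sup>2 - R) + TH"
    unfolding LW R_def TH_def
    using L_umm_ge sum_Q_lower Q_\<beta>_lower L_ap_bound[OF b_norm b_norm, of m m] by linarith
  then have "L (W (b m) (b m)) / lam m \<ge>
      ((- (M * lam m) - 8 * M ^ 3 * lam m * T - 9 * M ^ 3 * (lam m)\<^sup>2 - R) + TH) / lam m"
    using lm by (intro divide_right_mono) auto
  also have "((- (M * lam m) - 8 * M ^ 3 * lam m * T - 9 * M ^ 3 * (lam m)\<^sup>2 - R) + TH) / lam m =
      - M - 8 * M ^ 3 * T - 9 * M ^ 3 * lam m - R / lam m + TH / lam m"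
    by (simp add: field_simps power2_eq_square)
  finally have 1: "L (W (b m) (b m)) / lam m \<ge> - M - 8 * M ^ 3 * T - 9 * M ^ 3 * lam m - R / lam m + TH / lam m" .
  have R: "R / lam m \<le> real CARD('n) * M + real CARD('n) * (4 * M\<^sup>2) + 4 * M ^ 3 * T + 2 * (M\<^sup>2 * (1 + T))"
  proof -
    have "R / lam m = real CARD('n) * M + (real CARD('n) * (4 * M\<^sup>2) + 4 * M ^ 3 * T + 2 * (M\<^sup>2 * (1 + T))) / lam m"
      by (simp add: R_def field_simps)
    also have "(real CARD('n) * (4 * M\<^sup>2) + 4 * M ^ 3 * T + 2 * (M\<^sup>2 * (1 + T))) / lam m \<le>
        (real CARD('n) * (4 * M\<^sup>2) + 4 * M ^ 3 * T + 2 * (M\<^sup>2 * (1 + T))) / 1"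
      using lam1 M1 T_nonneg by (intro divide_left_mono) auto
    finally show ?thesis by simp
  qed
  have 2: "TH / lam m - (\<Sum>i\<in>UNIV. (E i)\<^sup>2 / lam i) / (lam m)\<^sup>2 \<ge> - (72 * M ^ 4 * T)"
    using third_order_terms by (simp add: TH_def)
  have low: "L (\<lambda>x. ln (W (b m) (b m) x)) \<ge>
      - (M + 8 * M ^ 3 * T + 9 * M ^ 3 * lam m + (real CARD('n) * M + real CARD('n) * (4 * M\<^sup>2) + 4 * M ^ 3 * T + 2 * (M\<^sup>2 * (1 + T))) + 72 * M ^ 4 * T)"
    unfolding eq using 1 2 R by linarith
  define P where "P = M ^ 4 * real CARD('n)"
  have Mp: "M \<le> M ^ 4" "M\<^sup>2 \<le> M ^ 4" "M ^ 3 \<le> M ^ 4" "M ^ 4 \<ge> 0"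
    using M1 power_increasing[of 1 4 M] power_increasing[of 2 4 M] power_increasing[of 3 4 M] by auto
  have MP: "M ^ 4 \<le> P" using mult_left_mono[OF n1 Mp(4)] by (simp add: P_def)
  have k: "M \<le> P" "M\<^sup>2 \<le> P" "M ^ 3 \<le> P" "real CARD('n) * M \<le> P" "real CARD('n) * M\<^sup>2 \<le> P"
    using Mp MP n1 mult_left_mono[OF Mp(1), of "real CARD('n)"] mult_left_mono[OF Mp(2), of "real CARD('n)"] by (auto simp: P_def mult.commute)
  have kT: "M ^ 3 * T \<le> P * T" "M\<^sup>2 * T \<le> P * T" "M ^ 4 * T \<le> P * T"
    using k MP T_nonneg by (auto intro: mult_right_mono)
  have kl: "M ^ 3 * lam m \<le> P * lam m" using k lm by (auto intro: mult_right_mono)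
  have P0: "P \<ge> 0" using Mp MP by linarith
  have "P * T \<ge> 0" "P * lam m \<ge> 0" using P0 T_nonneg lm by simp_all
  with P0 have "M + 8 * M ^ 3 * T + 9 * M ^ 3 * lam m + (real CARD('n) * M + real CARD('n) * (4 * M\<^sup>2) + 4 * M ^ 3 * T + 2 * (M\<^sup>2 * (1 + T))) + 72 * M ^ 4 * T
      \<le> 100 * (P + P * T + P * lam m)"
    using k kT kl by (simp add: algebra_simps)
  also have "\<dots> = 100 * M ^ 4 * real CARD('n) * (1 + T + lam m)" by (simp add: P_def algebra_simps)
  finally show ?thesis using low by linarith
qed

end

section \<open>The barrier and the interior estimate\<close>

lemma second_order_lower_bound:
  fixes f f1 f2 :: "real \<Rightarrow> real"
  assumes f: "\<And>t. 0 \<le> t \<Longrightarrow> t \<le> 1 \<Longrightarrow> (f has_real_derivative f1 t) (at t)"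
    and f1: "\<And>t. 0 \<le> t \<Longrightarrow> t \<le> 1 \<Longrightarrow> (f1 has_real_derivative f2 t) (at t)"
    and f2: "\<And>t. 0 \<le> t \<Longrightarrow> t \<le> 1 \<Longrightarrow> f2 t \<ge> - c"
  shows "f 1 - f 0 - f1 0 \<ge> - c / 2"
proof -
  define F where "F k = (if k = 0 then f else if k = Suc 0 then f1 else f2)" for k
  have "\<exists>t>0. t < 1 \<and> f 1 = (\<Sum>k<2. F k 0 / fact k * 1 ^ k) + F 2 t / fact 2 * 1 ^ 2"
  proof (rule Maclaurin)
    show "\<forall>k t. k < 2 \<and> 0 \<le> t \<and> t \<le> 1 \<longrightarrow> DERIV (F k) t :> F (Suc k) t"
      using f f1 by (auto simp: F_def less_2_cases_iff)
  qed (auto simp: F_def)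
  then obtain t where t: "t > 0" "t < 1" "f 1 = (\<Sum>k<2. F k 0 / fact k * 1 ^ k) + F 2 t / fact 2 * 1 ^ 2"
    by blast
  then have "f 1 = f 0 + f1 0 + f2 t / 2" by (simp add: F_def numeral_2_eq_2)
  then show ?thesis using f2[of t] t by simp
qed

context elliptic_point
begin

text \<open>
  The function \<open>|Du|\<^sup>2/2\<close>, expressed in the frame.
\<close>
definition "psq x = (\<Sum>k\<in>UNIV. (1 / 2) * (D (b k) u x)\<^sup>2)"

lemma psq_eq:
  assumes "x \<in> \<Omega>"
  shows "psq x = (norm (p x))\<^sup>2 / 2"
proof -
  have bp: "b k \<bullet> p x = D (b k) u x" for k
    using p_inner[OF assms, of "b k"] by (simp only: inner_commute)
  have "(norm (p x))\<^sup>2 = (\<Sum>k\<in>UNIV. (D (b k) u x)\<^sup>2)"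
    unfolding power2_norm_eq_inner by (subst orthonormal_frame_Parseval[OF frame]) (simp add: bp power2_eq_square)
  then show ?thesis by (simp add: psq_def sum_divide_distrib)
qed

lemma half_square_deriv: "((\<lambda>s. (1 / 2) * s\<^sup>2) has_real_derivative s) (at s)" for s :: real
  by (auto intro!: derivative_eq_intros)

lemma half_square_twice: "twice_diff \<Omega> (\<lambda>x. (1 / 2) * (D e u x)\<^sup>2) x0"
  by (rule twice_diff_chain_real(1)[OF open_\<Omega> x0 Du_twice[OF x0] half_square_deriv DERIV_ident])

lemma psq_twice: "twice_diff \<Omega> psq x0"
  unfolding psq_def[abs_def]
  by (rule twice_diff_sum[OF open_\<Omega> x0 finite half_square_twice, THEN conjunct1])

lemma L_psq_ge: "L psq \<ge> lam m - 3 * M\<^sup>2 * real CARD('n) * (1 + T)"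
proof -
  have 1: "L (\<lambda>x. (1 / 2) * (D (b k) u x)\<^sup>2) = D (b k) u x0 * L (D (b k) u)
      + 1 * (\<Sum>i\<in>UNIV. (D (b i) (D (b k) u) x0)\<^sup>2 / lam i)" for k
    by (rule L_chain[OF Du_twice[OF x0] half_square_deriv DERIV_ident])
  have "L psq = (\<Sum>k\<in>UNIV. L (\<lambda>x. (1 / 2) * (D (b k) u x)\<^sup>2))"
    unfolding psq_def[abs_def]
    by (rule L_sum[OF finite half_square_twice])
  also have "\<dots> = (\<Sum>k\<in>UNIV. D (b k) u x0 * L (D (b k) u))
      + (\<Sum>k\<in>UNIV. \<Sum>i\<in>UNIV. (D (b i) (D (b k) u) x0)\<^sup>2 / lam i)"
    unfolding 1 by (simp add: sum.distrib)
  also have "(\<Sum>k\<in>UNIV. \<Sum>i\<in>UNIV. (D (b i) (D (b k) u) x0)\<^sup>2 / lam i) =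
      (\<Sum>i\<in>UNIV. (norm (q (b i)))\<^sup>2 / lam i)"
  proof (subst sum.swap, rule sum.cong[OF refl])
    fix i
    have "(norm (q (b i)))\<^sup>2 = (\<Sum>k\<in>UNIV. (D (b i) (D (b k) u) x0)\<^sup>2)"
    proof -
      have bq: "b k \<bullet> q (b i) = D (b i) (D (b k) u) x0" for k
        using Dp_inner[OF x0, of "b i" "b k"] by (simp only: q_def inner_commute)
      show ?thesis
        unfolding power2_norm_eq_inner by (subst orthonormal_frame_Parseval[OF frame]) (simp add: bq power2_eq_square)
    qed
    then show "(\<Sum>k\<in>UNIV. (D (b i) (D (b k) u) x0)\<^sup>2 / lam i) = (norm (q (b i)))\<^sup>2 / lam i"
      by (simp add: sum_divide_distrib)
  qed
  finally have eq: "L psq = (\<Sum>k\<in>UNIV. D (b k) u x0 * L (D (b k) u))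
      + (\<Sum>i\<in>UNIV. (norm (q (b i)))\<^sup>2 / lam i)" .
  have "(\<Sum>k\<in>UNIV. D (b k) u x0 * L (D (b k) u)) \<ge> (\<Sum>k\<in>(UNIV :: 'n set). - (M\<^sup>2 * (1 + T)))"
  proof (rule sum_mono)
    fix k
    have "\<bar>D (b k) u x0\<bar> \<le> M"
      using Cauchy_Schwarz_ineq2[of "p x0" "b k"] pM by (simp add: p_inner[OF x0])
    then have "\<bar>D (b k) u x0 * L (D (b k) u)\<bar> \<le> M * (M * (1 + T))"
      using L_Du_bound[of "b k"] M1 unfolding abs_mult by (intro mult_mono) auto
    then show "- (M\<^sup>2 * (1 + T)) \<le> D (b k) u x0 * L (D (b k) u)"
      by (simp add: power2_eq_square)
  qed
  then have 2: "(\<Sum>k\<in>UNIV. D (b k) u x0 * L (D (b k) u)) \<ge> - (real CARD('n) * (M\<^sup>2 * (1 + T)))"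
    by simp
  have sq: "(norm (q (b i)))\<^sup>2 / lam i \<ge> lam i - 2 * M" for i
  proof -
    have "(norm (q (b i)))\<^sup>2 = (lam i)\<^sup>2 + 2 * lam i * (b i \<bullet> (A z0 *v b i)) + (norm (A z0 *v b i))\<^sup>2"
      using orthonormal_frame_inner[OF frame, of i i]
      unfolding power2_norm_eq_inner q_eig
      by (simp add: inner_add inner_commute power2_eq_square algebra_simps)
    moreover have "b i \<bullet> (A z0 *v b i) \<ge> - M" using A_bd0[of "b i" "b i"] by (simp add: mform_def)
    then have "2 * lam i * (b i \<bullet> (A z0 *v b i)) \<ge> 2 * lam i * (- M)"
      using lam0[of i] by (intro mult_left_mono) auto
    moreover have k: "(lam i - 2 * M) * lam i = (lam i)\<^sup>2 + 2 * lam i * (- M)"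
      by (simp add: power2_eq_square algebra_simps)
    ultimately have "(norm (q (b i)))\<^sup>2 \<ge> (lam i - 2 * M) * lam i"
      using zero_le_power2[of "norm (A z0 *v b i)"] k by linarith
    then show ?thesis using lam0[of i] by (simp add: pos_le_divide_eq)
  qed
  have "lam m \<le> (\<Sum>i\<in>UNIV. lam i)"
    using lam0 by (intro member_le_sum) (auto simp: less_imp_le)
  moreover have "(\<Sum>i\<in>UNIV. (norm (q (b i)))\<^sup>2 / lam i) \<ge> (\<Sum>i\<in>UNIV. lam i - 2 * M)"
    by (intro sum_mono sq)
  ultimately have 3: "(\<Sum>i\<in>UNIV. (norm (q (b i)))\<^sup>2 / lam i) \<ge> lam m - real CARD('n) * (2 * M)"
    by (simp add: sum_subtractf)
  have "M \<le> M\<^sup>2" using M1 power_increasing[of 1 2 M] by simp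
  then have "real CARD('n) * (2 * M) \<le> real CARD('n) * (2 * M\<^sup>2)" using n1 by (intro mult_left_mono) auto
  also have "\<dots> \<le> real CARD('n) * (2 * M\<^sup>2) * (1 + T)" using T_nonneg n1 by (simp add: mult_left_mono algebra_simps)
  finally have "real CARD('n) * (2 * M) \<le> 2 * M\<^sup>2 * real CARD('n) * (1 + T)" by (simp add: mult_ac)
  then show ?thesis unfolding eq using 2 3 by (simp add: algebra_simps)
qed

text \<open>
  Regularity gives a sign to the Hessian of \<open>A\<^sub>i\<^sub>i\<close> only in directions orthogonal to \<open>b i\<close>; in a general direction
  \<open>r\<close> the loss is proportional to the component of \<open>r\<close> along \<open>b i\<close>.
\<close>
lemma regular_lower:
  assumes bd: "\<And>\<zeta> \<omega>. \<bar>D \<zeta> (D \<omega> (a (b i) (b i))) (x0, p')\<bar> \<le> M * norm \<zeta> * norm \<omega>"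
  shows "D (0, r) (D (0, r) (a (b i) (b i))) (x0, p') \<ge> - (3 * M * \<bar>b i \<bullet> r\<bar> * norm r)"
proof -
  let ?f = "a (b i) (b i)"
  define s where "s = b i \<bullet> r"
  define r' where "r' = r - s *\<^sub>R b i"
  have eq: "(0, r) = s *\<^sub>R (0, b i) + (0 :: real ^ 'n, r')" by (simp add: r'_def)
  have orth: "b i \<bullet> r' = 0"
    using orthonormal_frame_inner[OF frame, of i i] by (simp add: r'_def s_def inner_diff_right)
  have "r \<bullet> r = s\<^sup>2 + r' \<bullet> r'"
    using orth orthonormal_frame_inner[OF frame, of i i]
    by (simp add: r'_def inner_diff inner_commute power2_eq_square s_def algebra_simps)
  then have "(norm r')\<^sup>2 \<le> (norm r)\<^sup>2" by (simp add: power2_norm_eq_inner)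
  then have nr: "norm r' \<le> norm r" by (rule power2_le_imp_le) simp
  have sr: "\<bar>s\<bar> \<le> norm r" unfolding s_def using Cauchy_Schwarz_ineq2[of "b i" r] by simp
  have z: "(x0, p') \<in> \<Omega> \<times> UNIV" using x0 by simp
  have Mnr: "M * norm r' \<le> M * norm r" using nr M1 by (intro mult_left_mono) auto
  have m1: "\<bar>D (0, b i) (D (0, r') ?f) (x0, p')\<bar> \<le> M * norm r"
    using bd[of "(0, b i)" "(0, r')"] Mnr by (simp add: norm_Pair)
  have m2: "\<bar>D (0, r') (D (0, b i) ?f) (x0, p')\<bar> \<le> M * norm r"
    using bd[of "(0, r')" "(0, b i)"] Mnr by (simp add: norm_Pair)
  have c0: "D (0, r') (D (0, r') ?f) (x0, p') \<ge> 0" by (rule reg[OF orth])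
  have "\<bar>s * D (0, b i) (D (0, r') ?f) (x0, p')\<bar> \<le> \<bar>s\<bar> * (M * norm r)"
    unfolding abs_mult
    by (rule mult_left_mono) (use m1 in simp_all)
  moreover have "\<bar>s * D (0, r') (D (0, b i) ?f) (x0, p')\<bar> \<le> \<bar>s\<bar> * (M * norm r)"
    unfolding abs_mult
    by (rule mult_left_mono) (use m2 in simp_all)
  moreover have "\<bar>s\<^sup>2 * D (0, b i) (D (0, b i) ?f) (x0, p')\<bar> \<le> \<bar>s\<bar> * (M * norm r)"
  proof -
    have "\<bar>s\<^sup>2 * D (0, b i) (D (0, b i) ?f) (x0, p')\<bar> \<le> \<bar>s\<bar> * \<bar>s\<bar> * M"
      unfolding abs_mult power2_eq_square
      by (rule mult_left_mono) (use bd[of "(0, b i)" "(0, b i)"] in \<open>simp_all add: norm_Pair\<close>)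
    also have "\<dots> \<le> \<bar>s\<bar> * norm r * M" using sr M1 by (intro mult_right_mono mult_left_mono) auto
    finally show ?thesis by (simp add: mult_ac)
  qed
  moreover have m3: "3 * M * \<bar>s\<bar> * norm r = 3 * (\<bar>s\<bar> * (M * norm r))" by simp
  ultimately show ?thesis
    unfolding eq bilinear_expand[OF a2[OF z] z] using c0 unfolding s_def[symmetric] m3 by linarith
qed

text \<open>
  For \<open>g = v - u\<close> and \<open>K = 9 M\<^sup>4 / (2 \<delta>)\<close> the left-hand side is \<open>L exp (K g)\<close> divided by \<open>K exp (K g)\<close>. In
  \<open>\<Sum>i. D\<^sub>i\<^sub>i g / lam i\<close> the eigenvalues themselves contribute the constant \<open>- n\<close>, and the uniform positivity
  of \<open>D\<^sup>2v - A(x,Dv)\<close> contributes \<open>\<delta> T\<close>.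
\<close>

lemma L_barrier:
  assumes v2: "Ck_on 2 \<Omega> v" and v\<rho>: "norm (grad v x0) \<le> \<rho>" and p\<rho>: "norm (grad u x0) \<le> \<rho>" and \<rho>M: "\<rho> \<le> M"
    and Wv: "\<And>i. \<delta> \<le> b i \<bullet> (MA_matrix A v x0 *v b i)" and \<delta>: "\<delta> > 0"
    and bd: "\<And>i p' \<zeta> \<omega>. norm p' \<le> \<rho> \<Longrightarrow>
        \<bar>D \<zeta> (D \<omega> (a (b i) (b i))) (x0, p')\<bar> \<le> M * norm \<zeta> * norm \<omega>"
  defines "g \<equiv> \<lambda>x. v x - u x"
  shows "L g + 9 * M ^ 4 / (2 * \<delta>) * (\<Sum>i\<in>UNIV. (D (b i) g x0)\<^sup>2 / lam i) \<ge> \<delta> / 2 * T - 3 * M\<^sup>2 * real CARD('n)"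
proof -
  define r where "r = grad v x0 - p x0"
  have nr: "norm r \<le> 2 * M" using norm_triangle_ineq4[of "grad v x0" "p x0"] v\<rho> p\<rho> \<rho>M by (simp add: r_def)
  have tv: "twice_diff \<Omega> v x0" by (rule Ck2_twice[OF v2 x0])
  have tu: "twice_diff \<Omega> u x0" by (rule Ck2_twice[OF u_Ck x0]) simp
  have grad_g: "grad g x0 = r"
    unfolding g_def r_def by (rule grad_diff[OF twice_diffD(1)[OF tv x0] u_diff[OF x0]])
  have s: "D (b i) g x0 = b i \<bullet> r" for i
  proof -
    have "g differentiable (at x0)"
      unfolding g_def by (intro differentiable_diff twice_diffD(1)[OF tv x0] u_diff[OF x0])
    then show ?thesis using grad_inner[of g x0 "b i"] grad_g by (simp add: inner_commute)
  qed
  define t where "t i = a (b i) (b i) (x0, grad v x0) - a (b i) (b i) z0 - D (0, r) (a (b i) (b i)) z0" for i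
  have t: "t i \<ge> - (3 * M\<^sup>2 * \<bar>b i \<bullet> r\<bar>)" for i
  proof -
    let ?f = "a (b i) (b i)"
    define P where "P \<tau> = z0 + \<tau> *\<^sub>R (0, r)" for \<tau> :: real
    have P: "P \<tau> = (x0, p x0 + \<tau> *\<^sub>R r)" for \<tau> by (simp add: P_def)
    have Pin: "P \<tau> \<in> \<Omega> \<times> UNIV" for \<tau> using x0 by (simp add: P)
    have conv: "norm (p x0 + \<tau> *\<^sub>R r) \<le> \<rho>" if "0 \<le> \<tau>" "\<tau> \<le> 1" for \<tau>
    proof -
      have "p x0 + \<tau> *\<^sub>R r = (1 - \<tau>) *\<^sub>R p x0 + \<tau> *\<^sub>R grad v x0" by (simp add: r_def algebra_simps)
      moreover have "norm ((1 - \<tau>) *\<^sub>R p x0 + \<tau> *\<^sub>R grad v x0) \<le> (1 - \<tau>) * norm (p x0) + \<tau> * norm (grad v x0)"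
        using norm_triangle_ineq[of "(1 - \<tau>) *\<^sub>R p x0" "\<tau> *\<^sub>R grad v x0"] that by simp
      moreover have "\<dots> \<le> (1 - \<tau>) * \<rho> + \<tau> * \<rho>" using that p\<rho> v\<rho> by (intro add_mono mult_left_mono) auto
      moreover have "(1 - \<tau>) * \<rho> + \<tau> * \<rho> = \<rho>" by (simp add: algebra_simps)
      ultimately show ?thesis by simp
    qed
    have "?f (P 1) - ?f (P 0) - D (0, r) ?f (P 0) \<ge> - (3 * M * \<bar>b i \<bullet> r\<bar> * norm r) / 2"
    proof (rule second_order_lower_bound)
      fix \<tau> :: real assume \<tau>: "0 \<le> \<tau>" "\<tau> \<le> 1"
      show "((\<lambda>\<tau>. ?f (P \<tau>)) has_real_derivative D (0, r) ?f (P \<tau>)) (at \<tau>)"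
        unfolding P_def
        by (rule line_has_real_derivative) (rule a_diff[OF Pin[unfolded P_def] Pin[unfolded P_def]])
      show "((\<lambda>\<tau>. D (0, r) ?f (P \<tau>)) has_real_derivative D (0, r) (D (0, r) ?f) (P \<tau>)) (at \<tau>)"
        unfolding P_def
        by (rule line_has_real_derivative) (rule twice_diffD(2)[OF a2[OF Pin[unfolded P_def]]])
      show "D (0, r) (D (0, r) ?f) (P \<tau>) \<ge> - (3 * M * \<bar>b i \<bullet> r\<bar> * norm r)"
        unfolding P by (rule regular_lower[OF bd[OF conv[OF \<tau>]]])
    qed
    then have 1: "t i \<ge> - (3 * M * \<bar>b i \<bullet> r\<bar> * norm r) / 2" by (simp add: P t_def r_def)
    have "3 * M * \<bar>b i \<bullet> r\<bar> * norm r \<le> 3 * M * \<bar>b i \<bullet> r\<bar> * (2 * M)"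
      using nr M1 by (intro mult_left_mono) auto
    then show ?thesis using 1 by (simp add: power2_eq_square algebra_simps)
  qed
  have DDg: "D (b i) (D (b i) g) x0 =
      b i \<bullet> (MA_matrix A v x0 *v b i) - lam i + (a (b i) (b i) (x0, grad v x0) - a (b i) (b i) z0)" for i
  proof -
    have "D (b i) (D (b i) g) x0 = D (b i) (D (b i) v) x0 - D (b i) (D (b i) u) x0"
      unfolding g_def by (rule twice_diff_diff(2)[OF open_\<Omega> x0 tv tu])
    moreover have "D (b i) (D (b i) v) x0 = b i \<bullet> (MA_matrix A v x0 *v b i) + a (b i) (b i) (x0, grad v x0)"
      using hess_inner[OF open_\<Omega> x0 v2, of "b i" "b i"] by (simp add: MA_matrix_form)
    moreover have "D (b i) (D (b i) u) x0 = lam i + a (b i) (b i) z0"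
      using W_eig[of i i] by (simp add: W_def)
    ultimately show ?thesis by simp
  qed
  define w where "w i = b i \<bullet> (MA_matrix A v x0 *v b i)" for i
  have "L g = (\<Sum>i\<in>UNIV. (w i - lam i + t i) / lam i) - D (0, r) \<beta> z0"
    unfolding L_def grad_g \<Gamma>_def DDg t_def w_def
    by (simp add: sum_subtractf[symmetric] sum.distrib[symmetric] diff_divide_distrib add_divide_distrib algebra_simps)
  moreover have "D (0, r) \<beta> z0 \<le> 2 * M\<^sup>2"
  proof -
    have "M * norm r \<le> M * (2 * M)" using nr M1 by (intro mult_left_mono) auto
    then show ?thesis using \<beta>_bd1[of "(0, r)"] by (simp add: norm_Pair power2_eq_square)
  qed
  ultimately have "L g + 9 * M ^ 4 / (2 * \<delta>) * (\<Sum>i\<in>UNIV. (D (b i) g x0)\<^sup>2 / lam i) \<ge>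
      (\<Sum>i\<in>UNIV. (w i - lam i + t i) / lam i)
      + (\<Sum>i\<in>UNIV. 9 * M ^ 4 / (2 * \<delta>) * (b i \<bullet> r)\<^sup>2 / lam i) - 2 * M\<^sup>2"
    by (simp add: s sum_distrib_left)
  also have "(\<Sum>i\<in>UNIV. (w i - lam i + t i) / lam i)
      + (\<Sum>i\<in>UNIV. 9 * M ^ 4 / (2 * \<delta>) * (b i \<bullet> r)\<^sup>2 / lam i) =
      (\<Sum>i\<in>UNIV. (w i - lam i + t i + 9 * M ^ 4 / (2 * \<delta>) * (b i \<bullet> r)\<^sup>2) / lam i)"
    by (simp only: sum.distrib[symmetric] add_divide_distrib[symmetric])
  finally have 1: "L g + 9 * M ^ 4 / (2 * \<delta>) * (\<Sum>i\<in>UNIV. (D (b i) g x0)\<^sup>2 / lam i) \<ge>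
      (\<Sum>i\<in>UNIV. (w i - lam i + t i + 9 * M ^ 4 / (2 * \<delta>) * (b i \<bullet> r)\<^sup>2) / lam i) - 2 * M\<^sup>2" .
  have "(w i - lam i + t i + 9 * M ^ 4 / (2 * \<delta>) * (b i \<bullet> r)\<^sup>2) / lam i \<ge>
      \<delta> / 2 * (1 / lam i) - 1" for i
  proof -
    define y where "y = \<bar>b i \<bullet> r\<bar>"
    \<comment> \<open>Completing the square; this fixes the value of \<open>K\<close>.\<close>
    have "9 * M ^ 4 / (2 * \<delta>) * y\<^sup>2 - 3 * M\<^sup>2 * y + \<delta> / 2 = (3 * M\<^sup>2 * y - \<delta>)\<^sup>2 / (2 * \<delta>)"
      using \<delta> by (simp add: power2_eq_square power4_eq_xxxx field_simps)
    also have "\<dots> \<ge> 0" using \<delta> by simp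
    finally have "9 * M ^ 4 / (2 * \<delta>) * (b i \<bullet> r)\<^sup>2 \<ge> 3 * M\<^sup>2 * \<bar>b i \<bullet> r\<bar> - \<delta> / 2"
      by (simp add: y_def)
    then have "w i - lam i + t i + 9 * M ^ 4 / (2 * \<delta>) * (b i \<bullet> r)\<^sup>2 \<ge> \<delta> / 2 - lam i"
      using t[of i] Wv[of i] unfolding w_def by linarith
    then have "(w i - lam i + t i + 9 * M ^ 4 / (2 * \<delta>) * (b i \<bullet> r)\<^sup>2) / lam i \<ge> (\<delta> / 2 - lam i) / lam i"
      using lam0[of i] by (intro divide_right_mono) auto
    then show ?thesis by (simp add: diff_divide_distrib)
  qed
  then have "(\<Sum>i\<in>UNIV. (w i - lam i + t i + 9 * M ^ 4 / (2 * \<delta>) * (b i \<bullet> r)\<^sup>2) / lam i) \<ge>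
      (\<Sum>i\<in>UNIV. \<delta> / 2 * (1 / lam i) - 1)"
    by (intro sum_mono)
  also have "(\<Sum>i\<in>UNIV. \<delta> / 2 * (1 / lam i) - 1) = \<delta> / 2 * T - real CARD('n)"
    unfolding sum_subtractf T_def sum_distrib_left by simp
  finally have 2: "(\<Sum>i\<in>UNIV. (w i - lam i + t i + 9 * M ^ 4 / (2 * \<delta>) * (b i \<bullet> r)\<^sup>2) / lam i)
      \<ge> \<delta> / 2 * T - real CARD('n)" .
  have "M\<^sup>2 \<ge> 1" using M1 by (simp add: one_le_power)
  then have "1 * real CARD('n) \<le> M\<^sup>2 * real CARD('n)" by (rule mult_right_mono) simp
  moreover have "2 * M\<^sup>2 * 1 \<le> 2 * M\<^sup>2 * real CARD('n)" using n1 by (intro mult_left_mono) auto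
  ultimately have "real CARD('n) + 2 * M\<^sup>2 \<le> 3 * M\<^sup>2 * real CARD('n)" by linarith
  then show ?thesis using 1 2 by linarith
qed

text \<open>
  The conclusion at an interior maximum. The constants are chosen in the order \<open>K\<close>, \<open>\<tau>\<close>, \<open>\<kappa>\<close>: \<open>K\<close> makes the
  barrier work, \<open>\<tau>\<close> makes \<open>|Du|\<^sup>2\<close> dominate the terms in \<open>lam m\<close>, and \<open>\<kappa>\<close> makes the barrier dominate the terms
  in \<open>T\<close>, the bound \<open>|v - u| \<le> 2 M\<close> being used in the exponential.
\<close>
theorem largest_eigenvalue_bound:
  assumes v2: "Ck_on 2 \<Omega> v" and v\<rho>: "norm (grad v x0) \<le> \<rho>" and p\<rho>: "norm (grad u x0) \<le> \<rho>" and \<rho>M: "\<rho> \<le> M"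
    and uv: "\<bar>u x0\<bar> \<le> M" "\<bar>v x0\<bar> \<le> M"
    and Wv: "\<And>i. \<delta> \<le> b i \<bullet> (MA_matrix A v x0 *v b i)" and \<delta>: "\<delta> > 0"
    and bd: "\<And>i p' \<zeta> \<omega>. norm p' \<le> \<rho> \<Longrightarrow>
        \<bar>D \<zeta> (D \<omega> (a (b i) (b i))) (x0, p')\<bar> \<le> M * norm \<zeta> * norm \<omega>"
    and K: "K = 9 * M ^ 4 / (2 * \<delta>)" and \<tau>: "\<tau> = 100 * M ^ 4 * real CARD('n) + 1"
    and C: "C = 100 * M ^ 4 * real CARD('n) + \<tau> * (3 * M\<^sup>2 * real CARD('n))" and \<kappa>: "\<kappa> = 2 * C / (\<delta> * (K * exp (- (2 * K * M))))"
    and max: "\<And>y. y \<in> \<Omega> \<Longrightarrow>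
        ln (b m \<bullet> (MA_matrix A u y *v b m)) + (\<tau> * ((norm (grad u y))\<^sup>2 / 2) + \<kappa> * exp (K * (v y - u y)))
        \<le> ln (b m \<bullet> (MA_matrix A u x0 *v b m)) + (\<tau> * ((norm (grad u x0))\<^sup>2 / 2) + \<kappa> * exp (K * (v x0 - u x0)))"
  shows "lam m \<le> C + \<kappa> * (K * exp (2 * K * M)) * (3 * M\<^sup>2 * real CARD('n))"
proof -
  have K0: "K > 0" using \<delta> M1 by (simp add: K)
  have M2n: "M\<^sup>2 * real CARD('n) \<ge> 0" "M ^ 4 * real CARD('n) \<ge> 0" by auto
  have C0: "C \<ge> 0" unfolding C \<tau> by (intro add_nonneg_nonneg mult_nonneg_nonneg) auto
  have \<kappa>0: "\<kappa> \<ge> 0" using C0 K0 \<delta> by (simp add: \<kappa>)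
  define g where "g x = v x - u x" for x
  define H where "H x = ln (W (b m) (b m) x) + (\<tau> * psq x + \<kappa> * exp (K * g x))" for x
  have tg: "twice_diff \<Omega> g x0"
    unfolding g_def[abs_def]
    by (rule twice_diff_diff(1)[OF open_\<Omega> x0 Ck2_twice[OF v2 x0] Ck2_twice[OF u_Ck x0]]) simp
  have e1: "((\<lambda>s. exp (K * s)) has_real_derivative K * exp (K * s)) (at s)" for s
    by (auto intro!: derivative_eq_intros)
  have e2: "((\<lambda>s. K * exp (K * s)) has_real_derivative K * (K * exp (K * s))) (at s)" for s
    by (auto intro!: derivative_eq_intros)
  have te: "twice_diff \<Omega> (\<lambda>x. exp (K * g x)) x0"
    by (rule twice_diff_chain_real(1)[OF open_\<Omega> x0 tg e1 e2])
  have tke: "twice_diff \<Omega> (\<lambda>x. \<kappa> * exp (K * g x)) x0"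
    by (rule twice_diff_bounded_linear(1)[OF open_\<Omega> x0 bounded_linear_mult_right te])
  have tp: "twice_diff \<Omega> (\<lambda>x. \<tau> * psq x) x0"
    by (rule twice_diff_bounded_linear(1)[OF open_\<Omega> x0 bounded_linear_mult_right psq_twice])
  have t2: "twice_diff \<Omega> (\<lambda>x. \<tau> * psq x + \<kappa> * exp (K * g x)) x0"
    by (rule twice_diff_add(1)[OF open_\<Omega> x0 tp tke])
  have tH: "twice_diff \<Omega> H x0"
    unfolding H_def[abs_def] by (rule twice_diff_add(1)[OF open_\<Omega> x0 ln_W_twice t2])
  have "H y \<le> H x0" if "y \<in> \<Omega>" for y
    using max[OF that] unfolding H_def g_def W_eq[OF that] W_eq[OF x0] psq_eq[OF that] psq_eq[OF x0] .
  then have "L H \<le> 0" by (rule L_at_maximum[OF tH])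
  moreover have "L H = L (\<lambda>x. ln (W (b m) (b m) x)) + (\<tau> * L psq + \<kappa> * L (\<lambda>x. exp (K * g x)))"
    unfolding H_def[abs_def]
    by (simp only: L_add[OF ln_W_twice t2] L_add[OF tp tke] L_cmult[OF psq_twice] L_cmult[OF te])
  ultimately have le: "L (\<lambda>x. ln (W (b m) (b m) x)) + (\<tau> * L psq + \<kappa> * L (\<lambda>x. exp (K * g x))) \<le> 0" by simp
  define E where "E = K * exp (K * g x0)"
  have gb: "\<bar>g x0\<bar> \<le> 2 * M" using uv by (simp add: g_def)
  have "K * g x0 \<le> K * (2 * M)" "K * (- (2 * M)) \<le> K * g x0"
    using gb K0 by (intro mult_left_mono; simp)+
  then have E: "K * exp (- (2 * K * M)) \<le> E" "E \<le> K * exp (2 * K * M)"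
    using K0 by (auto simp: E_def mult_ac)
  have E0: "E > 0" using K0 by (simp add: E_def)
  have "L (\<lambda>x. exp (K * g x)) = K * exp (K * g x0) * L g
      + K * (K * exp (K * g x0)) * (\<Sum>i\<in>UNIV. (D (b i) g x0)\<^sup>2 / lam i)"
    by (rule L_chain[OF tg e1 e2])
  then have "L (\<lambda>x. exp (K * g x)) = E * (L g + K * (\<Sum>i\<in>UNIV. (D (b i) g x0)\<^sup>2 / lam i))"
    by (simp add: E_def algebra_simps)
  also have "\<dots> \<ge> E * (\<delta> / 2 * T - 3 * M\<^sup>2 * real CARD('n))"
    using L_barrier[OF v2 v\<rho> p\<rho> \<rho>M Wv \<delta> bd] E0 unfolding K g_def[abs_def] by (intro mult_left_mono) auto
  finally have "\<kappa> * L (\<lambda>x. exp (K * g x)) \<ge> \<kappa> * (E * (\<delta> / 2 * T - 3 * M\<^sup>2 * real CARD('n)))"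
    using \<kappa>0 by (intro mult_left_mono)
  also have "\<kappa> * (E * (\<delta> / 2 * T - 3 * M\<^sup>2 * real CARD('n))) = \<kappa> * E * (\<delta> / 2) * T - \<kappa> * E * (3 * M\<^sup>2 * real CARD('n))"
    by (simp add: algebra_simps)
  also have "\<dots> \<ge> C * T - \<kappa> * (K * exp (2 * K * M)) * (3 * M\<^sup>2 * real CARD('n))"
  proof -
    have "C = \<kappa> * (K * exp (- (2 * K * M))) * (\<delta> / 2)" using K0 \<delta> by (simp add: \<kappa>)
    also have "\<dots> \<le> \<kappa> * E * (\<delta> / 2)" using E \<kappa>0 \<delta> by (intro mult_right_mono mult_left_mono) auto
    finally have "C * T \<le> \<kappa> * E * (\<delta> / 2) * T" using T_nonneg by (intro mult_right_mono)
    moreover have "\<kappa> * E * (3 * M\<^sup>2 * real CARD('n)) \<le> \<kappa> * (K * exp (2 * K * M)) * (3 * M\<^sup>2 * real CARD('n))"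
      using E \<kappa>0 by (intro mult_right_mono mult_left_mono) auto
    ultimately show ?thesis by linarith
  qed
  finally have 3: "\<kappa> * L (\<lambda>x. exp (K * g x)) \<ge> C * T - \<kappa> * (K * exp (2 * K * M)) * (3 * M\<^sup>2 * real CARD('n))" .
  have \<tau>0: "\<tau> \<ge> 0" using M2n by (simp add: \<tau>)
  have 2: "\<tau> * L psq \<ge> \<tau> * (lam m - 3 * M\<^sup>2 * real CARD('n) * (1 + T))"
    using L_psq_ge \<tau>0 by (rule mult_left_mono)
  have "- (100 * M ^ 4 * real CARD('n) * (1 + T + lam m)) + \<tau> * (lam m - 3 * M\<^sup>2 * real CARD('n) * (1 + T)) + C * T = lam m - C"
    by (simp add: C \<tau> algebra_simps)
  then show ?thesis using le 2 3 L_ln_W_ge by linarith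
qed

end

section \<open>The maximum over the closed domain\<close>

lemma norm_matrix_vector_le:
  fixes N :: "real ^ 'n ^ 'n"
  shows "norm (N *v x) \<le> real CARD('n) * norm N * norm x"
proof -
  have "norm (N *v x) \<le> (\<Sum>i\<in>UNIV. \<bar>(N *v x) $ i\<bar>)" by (rule norm_le_l1_cart)
  also have "\<dots> \<le> (\<Sum>i\<in>(UNIV :: 'n set). norm N * norm x)"
  proof (rule sum_mono)
    fix i
    have "\<bar>(N *v x) $ i\<bar> \<le> norm (N $ i) * norm x"
      using Cauchy_Schwarz_ineq2[of "N $ i" x] by (simp add: matrix_vector_mult_def inner_vec_def)
    also have "\<dots> \<le> norm N * norm x" by (intro mult_right_mono Finite_Cartesian_Product.norm_nth_le) auto
    finally show "\<bar>(N *v x) $ i\<bar> \<le> norm N * norm x" .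
  qed
  finally show ?thesis by simp
qed

lemma abs_matrix_form_le:
  fixes N :: "real ^ 'n ^ 'n"
  shows "\<bar>\<xi> \<bullet> (N *v \<eta>)\<bar> \<le> real CARD('n) * norm N * norm \<xi> * norm \<eta>"
proof -
  have "\<bar>\<xi> \<bullet> (N *v \<eta>)\<bar> \<le> norm \<xi> * norm (N *v \<eta>)" by (rule Cauchy_Schwarz_ineq2)
  also have "\<dots> \<le> norm \<xi> * (real CARD('n) * norm N * norm \<eta>)"
    by (intro mult_left_mono norm_matrix_vector_le) auto
  finally show ?thesis by (simp add: mult_ac)
qed

lemma norm_pos_definite_le:
  fixes N :: "real ^ 'n ^ 'n"
  assumes sym: "transpose N = N" and pos: "pos_definite N"
    and le: "\<And>x. norm x = 1 \<Longrightarrow> x \<bullet> (N *v x) \<le> \<Lambda>"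
  shows "norm N \<le> (real CARD('n))\<^sup>2 * \<Lambda>"
proof -
  have entry: "N $ i $ j = axis i 1 \<bullet> (N *v axis j 1)" for i j
    by (simp add: inner_axis' matrix_vector_mul_component inner_axis)
  have nonneg: "0 \<le> x \<bullet> (N *v x)" for x
    using pos by (cases "x = 0") (auto simp: pos_definite_def less_imp_le)
  have diag: "N $ i $ i \<le> \<Lambda>" for i using le[of "axis i 1"] by (simp add: entry)
  have "\<bar>N $ i $ j\<bar> \<le> \<Lambda>" for i j
  proof -
    have s: "N $ j $ i = N $ i $ j" using sym by (metis transpose_def vec_lambda_beta)
    have "0 \<le> N $ i $ i + 2 * N $ i $ j + N $ j $ j"
      using nonneg[of "axis i 1 + axis j 1"] s
      by (simp add: matrix_vector_right_distrib inner_add entry[symmetric])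
    moreover have "0 \<le> N $ i $ i - 2 * N $ i $ j + N $ j $ j"
      using nonneg[of "axis i 1 - axis j 1"] s
      by (simp add: matrix_vector_mult_diff_distrib inner_diff entry[symmetric])
    ultimately show ?thesis using diag[of i] diag[of j] by linarith
  qed
  then have row: "norm (N $ i) \<le> real CARD('n) * \<Lambda>" for i
    using order_trans[OF norm_le_l1_cart[of "N $ i"] sum_mono[of UNIV "\<lambda>j. \<bar>N $ i $ j\<bar>" "\<lambda>j. \<Lambda>"]] by simp
  have "norm N \<le> (\<Sum>i\<in>UNIV. norm (N $ i))"
    unfolding norm_vec_def by (rule L2_set_le_sum) auto
  also have "\<dots> \<le> (\<Sum>i\<in>(UNIV :: 'n set). real CARD('n) * \<Lambda>)" by (rule sum_mono[OF row])
  finally show ?thesis by (simp add: power2_eq_square)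
qed

lemma twice_diff_ln:
  fixes f :: "'a::euclidean_space \<Rightarrow> real"
  assumes S: "open S" "z \<in> S" and f: "twice_diff S f z" and pos: "\<And>y. y \<in> S \<Longrightarrow> f y > 0"
  shows "twice_diff S (\<lambda>y. ln (f y)) z"
    and "D d (\<lambda>y. ln (f y)) z = D d f z / f z"
    and "D d (D e (\<lambda>y. ln (f y))) z =
      D d (D e f) z / f z - D d f z * D e f z / (f z)\<^sup>2"
proof -
  have 1: "(ln has_real_derivative inverse (f y)) (at (f y))" if "y \<in> S" for y
    using pos[OF that] by (rule DERIV_ln)
  have 2: "(inverse has_real_derivative - (inverse (f z) ^ 2)) (at (f z))"
    using DERIV_inverse[of "f z" UNIV] pos[OF S(2)] by (simp add: numeral_2_eq_2)
  show "twice_diff S (\<lambda>y. ln (f y)) z" by (rule twice_diff_chain_real(1)[OF S f 1 2])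
  show "D d (\<lambda>y. ln (f y)) z = D d f z / f z"
    using dir_deriv_chain_real(2)[OF twice_diffD(1)[OF f S(2)] 1[OF S(2)], of d] by (simp add: divide_inverse mult.commute)
  show "D d (D e (\<lambda>y. ln (f y))) z =
      D d (D e f) z / f z - D d f z * D e f z / (f z)\<^sup>2"
    using twice_diff_chain_real(2)[OF S f 1 2, of d e] by (simp add: divide_inverse power_inverse algebra_simps)
qed

text \<open>
  The coordinate form of regularity, for arbitrary directions.
\<close>
lemma regular_on_mform:
  fixes \<Omega> :: "(real ^ 'n) set"
  assumes \<Omega>: "open \<Omega>" and A: "\<And>z. z \<in> \<Omega> \<times> UNIV \<Longrightarrow> twice_diff (\<Omega> \<times> UNIV) A z"
    and reg: "regular_on \<Omega> A" and x: "x \<in> \<Omega>" and orth: "\<xi> \<bullet> \<eta> = 0"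
  shows "0 \<le> D (0, \<eta>) (D (0, \<eta>) (mform A \<xi> \<xi>)) (x, p)"
proof -
  have oD: "open (\<Omega> \<times> (UNIV :: (real ^ 'n) set))" using \<Omega> by (intro open_Times) auto
  have z: "(x, p) \<in> \<Omega> \<times> UNIV" using x by simp
  let ?H = "\<lambda>\<zeta> \<omega>. D \<zeta> (D \<omega> A) (x, p)"
  have l1: "linear (?H \<zeta>)" for \<zeta> by (rule linear_dir_deriv2(1)[OF oD z A[OF z]])
  have l2: "linear (\<lambda>\<zeta>. ?H \<zeta> \<omega>)" for \<omega> by (rule linear_dir_deriv2(2)[OF oD z A[OF z]])
  have \<eta>: "(0, \<eta>) = (\<Sum>k\<in>UNIV. (\<eta> $ k) *\<^sub>R (0 :: real ^ 'n, axis k 1))"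
  proof -
    have "(\<Sum>k\<in>UNIV. (\<eta> $ k) *\<^sub>R (0 :: real ^ 'n, axis k (1::real))) = (0, \<Sum>k\<in>UNIV. (\<eta> $ k) *\<^sub>R axis k 1)"
      by (simp add: sum_prod)
    then show ?thesis by (simp only: inner_axis_sum)
  qed
  have comp: "dp k (dp l (\<lambda>z. A z $ i $ j)) (x, p) = ?H (0, axis k 1) (0, axis l 1) $ i $ j" for i j k l
  proof -
    have bl: "bounded_linear (\<lambda>N :: real ^ 'n ^ 'n. N $ i $ j)"
      by (rule bounded_linear_compose[OF bounded_linear_vec_nth bounded_linear_vec_nth])
    show ?thesis
      unfolding dp_def[abs_def] by (rule twice_diff_bounded_linear(2)[OF oD z bl A[OF z]])
  qed
  have "D (0, \<eta>) (D (0, \<eta>) (mform A \<xi> \<xi>)) (x, p) = \<xi> \<bullet> (?H (0, \<eta>) (0, \<eta>) *v \<xi>)"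
    by (rule twice_diff_mform(3)[OF oD z A[OF z]])
  also have "?H (0, \<eta>) (0, \<eta>) = (\<Sum>l\<in>UNIV. \<Sum>k\<in>UNIV. (\<eta> $ l * \<eta> $ k) *\<^sub>R ?H (0, axis k 1) (0, axis l 1))"
    unfolding \<eta> by (simp only: linear_sum[OF l1] linear_sum[OF l2] linear_scale[OF l1] linear_scale[OF l2]
        scaleR_sum_right scaleR_scaleR)
  also have "\<xi> \<bullet> ((\<Sum>l\<in>UNIV. \<Sum>k\<in>UNIV. (\<eta> $ l * \<eta> $ k) *\<^sub>R ?H (0, axis k 1) (0, axis l 1)) *v \<xi>) =
      (\<Sum>l\<in>UNIV. \<Sum>k\<in>UNIV. (\<eta> $ l * \<eta> $ k) * (\<xi> \<bullet> (?H (0, axis k 1) (0, axis l 1) *v \<xi>)))"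
    by (simp add: linear_sum[OF bounded_linear.linear[OF bounded_linear_matrix_form]]
        linear_scale[OF bounded_linear.linear[OF bounded_linear_matrix_form]])
  also have "\<dots> = (\<Sum>l\<in>UNIV. \<Sum>k\<in>UNIV. \<Sum>i\<in>UNIV. \<Sum>j\<in>UNIV.
      dp k (dp l (\<lambda>z. A z $ i $ j)) (x, p) * \<xi> $ i * \<xi> $ j * \<eta> $ k * \<eta> $ l)"
    unfolding comp
    by (intro sum.cong refl)
      (simp add: inner_vec_def matrix_vector_mult_def sum_distrib_left mult_ac)
  also have "\<dots> = (\<Sum>i\<in>UNIV. \<Sum>j\<in>UNIV. \<Sum>k\<in>UNIV. \<Sum>l\<in>UNIV.
      dp k (dp l (\<lambda>z. A z $ i $ j)) (x, p) * \<xi> $ i * \<xi> $ j * \<eta> $ k * \<eta> $ l)" (is "?L = ?R")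
  proof -
    let ?t = "\<lambda>i j k l. dp k (dp l (\<lambda>z. A z $ i $ j)) (x, p) * \<xi> $ i * \<xi> $ j * \<eta> $ k * \<eta> $ l"
    have "?L = (\<Sum>k\<in>UNIV. \<Sum>l\<in>UNIV. \<Sum>i\<in>UNIV. \<Sum>j\<in>UNIV. ?t i j k l)" by (rule sum.swap)
    also have "\<dots> = (\<Sum>k\<in>UNIV. \<Sum>i\<in>UNIV. \<Sum>l\<in>UNIV. \<Sum>j\<in>UNIV. ?t i j k l)"
      by (rule sum.cong[OF refl]) (rule sum.swap)
    also have "\<dots> = (\<Sum>k\<in>UNIV. \<Sum>i\<in>UNIV. \<Sum>j\<in>UNIV. \<Sum>l\<in>UNIV. ?t i j k l)"
      by (rule sum.cong[OF refl], rule sum.cong[OF refl]) (rule sum.swap)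
    also have "\<dots> = (\<Sum>i\<in>UNIV. \<Sum>k\<in>UNIV. \<Sum>j\<in>UNIV. \<Sum>l\<in>UNIV. ?t i j k l)" by (rule sum.swap)
    also have "\<dots> = ?R" by (rule sum.cong[OF refl]) (rule sum.swap)
    finally show ?thesis .
  qed
  also have "\<dots> \<ge> 0" using reg x orth by (simp add: regular_on_def orthogonal_def)
  finally show ?thesis .
qed

text \<open>
  The gradient and the Hessian extend continuously to the closure.
\<close>
lemma Ck_closure_2_extension:
  fixes u :: "real ^ 'n \<Rightarrow> real"
  assumes S: "open S" and u: "Ck_closure 2 S u"
  obtains G H where "continuous_on (closure S) G" "continuous_on (closure S) H"
    "\<And>x. x \<in> S \<Longrightarrow> G x = grad u x" "\<And>x. x \<in> S \<Longrightarrow> H x = hess u x"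
proof -
  have u2: "Ck_closure (Suc (Suc 0)) S u" using u by (simp add: numeral_2_eq_2)
  have ax: "axis i 1 \<in> (Basis :: (real ^ 'n) set)" for i by (simp add: axis_in_Basis_iff)
  have "\<forall>i. \<exists>g. (\<forall>x\<in>S. g x = D (axis i 1) u x) \<and> Ck_closure (Suc 0) S g"
    using u2 ax unfolding Ck_closure.simps(2)[of "Suc 0"] by blast
  then obtain g where g: "\<And>i x. x \<in> S \<Longrightarrow> g i x = D (axis i 1) u x" "\<And>i. Ck_closure (Suc 0) S (g i)"
    by metis
  have "\<exists>h. (\<forall>x\<in>S. h x = D (axis i 1) (g j) x) \<and> continuous_on (closure S) h" for i j
    using g(2)[of j] ax[of i] unfolding Ck_closure.simps by blast
  then obtain h where h: "\<And>i j x. x \<in> S \<Longrightarrow> h i j x = D (axis i 1) (g j) x"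
      "\<And>i j. continuous_on (closure S) (h i j)"
    by metis
  show ?thesis
  proof (rule that[of "\<lambda>x. \<chi> i. g i x" "\<lambda>x. \<chi> i j. h i j x"])
    have "continuous_on (closure S) (g i)" for i using g(2)[of i] by simp
    then show "continuous_on (closure S) (\<lambda>x. \<chi> i. g i x)" by (intro continuous_on_vec_lambda)
    show "continuous_on (closure S) (\<lambda>x. \<chi> i j. h i j x)" by (intro continuous_on_vec_lambda h(2))
    show "(\<chi> i. g i x) = grad u x" if "x \<in> S" for x using g(1)[OF that] by (simp add: grad_def)
    show "(\<chi> i j. h i j x) = hess u x" if "x \<in> S" for x
    proof -
      have "h i j x = D (axis i 1) (D (axis j 1) u) x" for i j
        unfolding h(1)[OF that] by (rule dir_deriv_cong[OF S that g(1)])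
      then show ?thesis by (simp add: hess_def)
    qed
  qed
qed

lemma closure_ext_eq:
  fixes f :: "'a::euclidean_space \<Rightarrow> 'b::euclidean_space"
  assumes S: "open S" and H: "continuous_on (closure S) H" "\<And>x. x \<in> S \<Longrightarrow> H x = f x" and x: "x \<in> frontier S"
  shows "closure_ext S f x = H x"
proof -
  have xS: "x \<notin> S" and xc: "x \<in> closure S" using x S by (auto simp: frontier_def interior_open)
  have nontriv: "\<not> trivial_limit (at x within S)"
    using xS xc by (simp add: trivial_limit_within closure_def)
  have "(H \<longlongrightarrow> H x) (at x within S)"
    using H(1) xc unfolding continuous_on_def by (meson closure_subset tendsto_within_subset)
  moreover have "\<forall>\<^sub>F y in at x within S. H y = f y"
    using H(2) by (simp add: eventually_at_filter)
  ultimately have "(f \<longlongrightarrow> H x) (at x within S)" by (rule Lim_transform_eventually)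
  then show ?thesis using xS nontriv by (simp add: closure_ext_def tendsto_Lim)
qed

text \<open>
  The data on which the final constant depends. The bounds for \<open>A\<close> and \<open>\<beta>\<close> hold for \<open>|p| \<le> \<rho>\<close>, where \<open>\<rho>\<close>
  bounds the gradients of \<open>v\<close> and of the solutions considered. The radius \<open>\<rho>\<close> is separate from \<open>M\<close> because
  \<open>M\<close> depends on the bounds on the ball of radius \<open>\<rho>\<close>.
\<close>
locale elliptic_problem =
  fixes \<Omega> :: "(real ^ 'n) set" and A :: "(real ^ 'n) \<times> (real ^ 'n) \<Rightarrow> real ^ 'n ^ 'n"
    and \<beta> :: "(real ^ 'n) \<times> (real ^ 'n) \<Rightarrow> real" and v :: "real ^ 'n \<Rightarrow> real" and \<rho> M \<delta> :: real
  assumes open_\<Omega>: "open \<Omega>" and bounded_\<Omega>: "bounded \<Omega>" and ne_\<Omega>: "\<Omega> \<noteq> {}"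
    and contA: "continuous_on (closure \<Omega> \<times> UNIV) A"
    and symA: "\<And>z. z \<in> \<Omega> \<times> UNIV \<Longrightarrow> transpose (A z) = A z"
    and A2: "\<And>z. z \<in> \<Omega> \<times> UNIV \<Longrightarrow> twice_diff (\<Omega> \<times> UNIV) A z"
    and \<beta>2: "\<And>z. z \<in> \<Omega> \<times> UNIV \<Longrightarrow> twice_diff (\<Omega> \<times> UNIV) \<beta> z"
    and reg: "regular_on \<Omega> A"
    and v2: "Ck_on 2 \<Omega> v" and contv: "continuous_on (closure \<Omega>) v"
    and v_bd: "\<And>x. x \<in> \<Omega> \<Longrightarrow> \<bar>v x\<bar> \<le> M" "\<And>x. x \<in> \<Omega> \<Longrightarrow> norm (grad v x) \<le> \<rho>"
    and M1: "M \<ge> 1" and \<rho>M: "\<rho> \<le> M" and \<delta>: "\<delta> > 0"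
    and v_ell: "\<And>x e. x \<in> \<Omega> \<Longrightarrow> norm e = 1 \<Longrightarrow> \<delta> \<le> e \<bullet> (MA_matrix A v x *v e)"
    and A_bd0: "\<And>x p \<xi> \<eta>. x \<in> closure \<Omega> \<Longrightarrow> norm p \<le> \<rho> \<Longrightarrow> \<bar>mform A \<xi> \<eta> (x, p)\<bar> \<le> M * norm \<xi> * norm \<eta>"
    and A_norm: "\<And>x p. x \<in> \<Omega> \<Longrightarrow> norm p \<le> \<rho> \<Longrightarrow> norm (A (x, p)) \<le> M"
    and A_bd1: "\<And>x p \<xi> \<eta> \<zeta>. x \<in> \<Omega> \<Longrightarrow> norm p \<le> \<rho> \<Longrightarrow>
        \<bar>D \<zeta> (mform A \<xi> \<eta>) (x, p)\<bar> \<le> M * norm \<xi> * norm \<eta> * norm \<zeta>"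
    and A_bd2: "\<And>x p \<xi> \<eta> \<zeta> \<omega>. x \<in> \<Omega> \<Longrightarrow> norm p \<le> \<rho> \<Longrightarrow>
        \<bar>D \<zeta> (D \<omega> (mform A \<xi> \<eta>)) (x, p)\<bar> \<le> M * norm \<xi> * norm \<eta> * norm \<zeta> * norm \<omega>"
    and \<beta>_bd1: "\<And>x p \<zeta>. x \<in> \<Omega> \<Longrightarrow> norm p \<le> \<rho> \<Longrightarrow> \<bar>D \<zeta> \<beta> (x, p)\<bar> \<le> M * norm \<zeta>"
    and \<beta>_bd2: "\<And>x p \<zeta> \<omega>. x \<in> \<Omega> \<Longrightarrow> norm p \<le> \<rho> \<Longrightarrow>
        \<bar>D \<zeta> (D \<omega> \<beta>) (x, p)\<bar> \<le> M * norm \<zeta> * norm \<omega>"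
begin

text \<open>
  The constants \<open>K\<close>, \<open>\<tau>\<close>, \<open>C\<close>, \<open>\<kappa>\<close> are those of \<open>largest_eigenvalue_bound\<close>. \<open>\<Lambda>\<close> bounds the largest eigenvalue at an interior maximum, and \<open>\<Phi>max\<close> bounds the exponent
  \<open>\<tau> |Du|\<^sup>2/2 + \<kappa> exp (K (v - u))\<close> of the weight.
\<close>
definition "K = 9 * M ^ 4 / (2 * \<delta>)"
definition "\<tau> = 100 * M ^ 4 * real CARD('n) + 1"
definition "C = 100 * M ^ 4 * real CARD('n) + \<tau> * (3 * M\<^sup>2 * real CARD('n))"
definition "\<kappa> = 2 * C / (\<delta> * (K * exp (- (2 * K * M))))"
definition "\<Lambda> = C + \<kappa> * (K * exp (2 * K * M)) * (3 * M\<^sup>2 * real CARD('n))"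
definition "\<Phi>max = \<tau> * (M\<^sup>2 / 2) + \<kappa> * exp (2 * K * M)"

lemma const_pos: "K > 0" "\<tau> > 0" "C > 0" "\<kappa> > 0" "\<Lambda> > 0" "\<Phi>max > 0"
proof -
  have M0: "M > 0" using M1 by simp
  show K: "K > 0" using M0 \<delta> by (simp add: K_def)
  show t: "\<tau> > 0" unfolding \<tau>_def using M0 by (intro add_nonneg_pos) auto
  show C: "C > 0" unfolding C_def using M0 t by (intro add_pos_nonneg) auto
  show k: "\<kappa> > 0" unfolding \<kappa>_def using C K \<delta> by simp
  show "\<Lambda> > 0" unfolding \<Lambda>_def using C K k M0 by (intro add_pos_nonneg) auto
  show "\<Phi>max > 0" unfolding \<Phi>max_def using t k M0 by (intro add_pos_pos) auto
qed

text \<open>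
  An interior maximum over points and unit vectors. The vector is replaced by an eigenvector of the largest
  eigenvalue, which is then kept fixed, so that \<open>largest_eigenvalue_bound\<close> applies.
\<close>
lemma weighted_maximum_bound:
  assumes u4: "Ck_on 4 \<Omega> u" and ell: "elliptic \<Omega> A u"
    and equ: "\<And>x. x \<in> \<Omega> \<Longrightarrow> ln (det (MA_matrix A u x)) = \<beta> (x, grad u x)"
    and u_bd: "\<And>x. x \<in> \<Omega> \<Longrightarrow> \<bar>u x\<bar> \<le> M" "\<And>x. x \<in> \<Omega> \<Longrightarrow> norm (grad u x) \<le> \<rho>"
    and x0: "x0 \<in> \<Omega>" and e0: "norm e0 = 1"
    and max: "\<And>x e. x \<in> \<Omega> \<Longrightarrow> norm e = 1 \<Longrightarrow>
      (e \<bullet> (MA_matrix A u x *v e)) * exp (\<tau> * ((norm (grad u x))\<^sup>2 / 2) + \<kappa> * exp (K * (v x - u x))) \<le>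
      (e0 \<bullet> (MA_matrix A u x0 *v e0)) * exp (\<tau> * ((norm (grad u x0))\<^sup>2 / 2) + \<kappa> * exp (K * (v x0 - u x0)))"
  shows "e0 \<bullet> (MA_matrix A u x0 *v e0) \<le> 1 + \<Lambda>"
proof -
  define W where "W = MA_matrix A u"
  define \<Phi> where "\<Phi> x = \<tau> * ((norm (grad u x))\<^sup>2 / 2) + \<kappa> * exp (K * (v x - u x))" for x
  have u2: "Ck_on 2 \<Omega> u" using Ck_on_mono[OF u4, of 2] by simp
  have symW: "transpose (W x) = W x" if "x \<in> \<Omega>" for x
    unfolding W_def by (rule transpose_MA_matrix[OF open_\<Omega> that u2 symA]) (use that in simp)
  have posW: "pos_definite (W x)" if "x \<in> \<Omega>" for x using ell that by (simp add: elliptic_def W_def)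
  obtain b lam where b: "orthonormal_frame b" and lam: "\<And>i. W x0 *v b i = lam i *\<^sub>R b i" "\<And>i. lam i > 0"
    using pos_definite_eigenframe[OF symW[OF x0] posW[OF x0]] by blast
  have "finite (range lam)" "range lam \<noteq> {}" by auto
  then have "Max (range lam) \<in> range lam" by (rule Max_in)
  then obtain m where m: "lam m = Max (range lam)" by (metis rangeE)
  have lam_le: "lam i \<le> lam m" for i unfolding m by (rule Max_ge) auto
  have bm: "norm (b m) = 1" by (rule orthonormal_frame_norm[OF b])
  have Wbm: "b m \<bullet> (W x0 *v b m) = lam m"
    using orthonormal_frame_inner[OF b, of m m] by (simp add: lam)
  have e0_le: "e0 \<bullet> (W x0 *v e0) \<le> lam m"
  proof -
    have "b i \<bullet> (W x0 *v e0) = lam i * (b i \<bullet> e0)" for i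
      using symmetric_matrix_inner[OF symW[OF x0], of "b i" e0] by (simp add: lam(1) inner_commute)
    then have "e0 \<bullet> (W x0 *v e0) = (\<Sum>i\<in>UNIV. lam i * (b i \<bullet> e0)\<^sup>2)"
      by (subst orthonormal_frame_Parseval[OF b]) (simp add: power2_eq_square algebra_simps)
    also have "\<dots> \<le> (\<Sum>i\<in>UNIV. lam m * (b i \<bullet> e0)\<^sup>2)"
      by (intro sum_mono mult_right_mono lam_le) auto
    also have "\<dots> = lam m * (e0 \<bullet> e0)"
      by (subst orthonormal_frame_Parseval[OF b]) (simp add: power2_eq_square sum_distrib_left)
    finally show ?thesis using e0 by (simp add: norm_eq_1)
  qed
  show ?thesis
  proof (cases "lam m \<ge> 1")
    case False
    then show ?thesis using e0_le const_pos by (simp add: W_def)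
  next
    case True
    interpret ep: elliptic_point \<Omega> A \<beta> u x0 b lam m M
    proof unfold_locales
      show "0 \<le> D (0, \<eta>) (D (0, \<eta>) (mform A \<xi> \<xi>)) (x0, p)" if "\<xi> \<bullet> \<eta> = 0" for \<xi> \<eta> p
        by (rule regular_on_mform[OF open_\<Omega> A2 reg x0 that])
      show "norm (grad u x0) \<le> M" using u_bd(2)[OF x0] \<rho>M by linarith
    qed (use open_\<Omega> x0 u4 symA A2 \<beta>2 ell equ b lam lam_le True M1 u_bd A_bd1 A_bd2 \<beta>_bd1 \<beta>_bd2
          A_bd0[OF subsetD[OF closure_subset x0]] in \<open>auto simp: W_def\<close>)
    have "lam m \<le> \<Lambda>"
      unfolding \<Lambda>_def
    proof (rule ep.largest_eigenvalue_bound[OF v2 v_bd(2)[OF x0] u_bd(2)[OF x0] \<rho>M u_bd(1)[OF x0] v_bd(1)[OF x0] _ \<delta> _ K_def \<tau>_def C_def \<kappa>_def])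
      show "\<delta> \<le> b i \<bullet> (MA_matrix A v x0 *v b i)" for i
        by (rule v_ell[OF x0 orthonormal_frame_norm[OF b]])
      show "\<bar>D \<zeta> (D \<omega> (mform A (b i) (b i))) (x0, p')\<bar> \<le> M * norm \<zeta> * norm \<omega>"
        if "norm p' \<le> \<rho>" for i p' \<zeta> \<omega>
        using A_bd2[OF x0 that, of \<zeta> \<omega> "b i" "b i"] orthonormal_frame_norm[OF b] by simp
      fix y assume y: "y \<in> \<Omega>"
      have Wy: "b m \<bullet> (W y *v b m) > 0"
      proof -
        have "b m \<noteq> 0" by (metis bm norm_zero zero_neq_one)
        then show ?thesis using posW[OF y] by (simp add: pos_definite_def)
      qed
      have "(b m \<bullet> (W y *v b m)) * exp (\<Phi> y) \<le> (e0 \<bullet> (W x0 *v e0)) * exp (\<Phi> x0)"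
        using max[OF y bm] by (simp add: W_def \<Phi>_def)
      also have "\<dots> \<le> (b m \<bullet> (W x0 *v b m)) * exp (\<Phi> x0)" using e0_le by (simp add: Wbm)
      finally have "ln ((b m \<bullet> (W y *v b m)) * exp (\<Phi> y)) \<le> ln ((b m \<bullet> (W x0 *v b m)) * exp (\<Phi> x0))"
        using Wy by (subst ln_le_cancel_iff) (auto simp: Wbm lam(2))
      then have "ln (b m \<bullet> (W y *v b m)) + \<Phi> y \<le> ln (b m \<bullet> (W x0 *v b m)) + \<Phi> x0"
        using Wy lam(2)[of m] Wbm by (simp add: ln_mult)
      then show "ln (b m \<bullet> (MA_matrix A u y *v b m)) + (\<tau> * ((norm (grad u y))\<^sup>2 / 2) + \<kappa> * exp (K * (v y - u y)))
        \<le> ln (b m \<bullet> (MA_matrix A u x0 *v b m)) + (\<tau> * ((norm (grad u x0))\<^sup>2 / 2) + \<kappa> * exp (K * (v x0 - u x0)))"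
        by (simp add: W_def \<Phi>_def)
    qed
    then show ?thesis using e0_le by (simp add: W_def)
  qed
qed

text \<open>
  The constant of the estimate: \<open>exp \<Phi>max\<close> compares the weights at two points, and the other factors
  convert between the quadratic form of \<open>D\<^sup>2u - A(x,Du)\<close> and the norm of \<open>D\<^sup>2u\<close>.
\<close>
definition "Cfinal = (real CARD('n))\<^sup>2 * (exp \<Phi>max * (1 + \<Lambda> + M + real CARD('n))) + M"

lemma hessian_bound:
  assumes u4: "Ck_on 4 \<Omega> u" and uc: "Ck_closure 2 \<Omega> u" and ell: "elliptic \<Omega> A u"
    and equ: "\<And>x. x \<in> \<Omega> \<Longrightarrow> ln (det (MA_matrix A u x)) = \<beta> (x, grad u x)"
    and u_bd: "\<And>x. x \<in> \<Omega> \<Longrightarrow> \<bar>u x\<bar> \<le> M" "\<And>x. x \<in> \<Omega> \<Longrightarrow> norm (grad u x) \<le> \<rho>"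
    and S: "\<And>x. x \<in> frontier \<Omega> \<Longrightarrow> norm (closure_ext \<Omega> (hess u) x) \<le> S" "S \<ge> 0"
    and x: "x \<in> \<Omega>"
  shows "norm (hess u x) \<le> Cfinal * (1 + S)"
proof -
  obtain G H where GH: "continuous_on (closure \<Omega>) G" "continuous_on (closure \<Omega>) H"
    "\<And>x. x \<in> \<Omega> \<Longrightarrow> G x = grad u x" "\<And>x. x \<in> \<Omega> \<Longrightarrow> H x = hess u x"
    using Ck_closure_2_extension[OF open_\<Omega> uc] by blast
  have contu: "continuous_on (closure \<Omega>) u" using uc by (simp add: numeral_2_eq_2)
  have cG: "norm (G x) \<le> \<rho>" if "x \<in> closure \<Omega>" for x
    by (rule continuous_le_on_closure[of \<Omega> "\<lambda>x. norm (G x)"]) (use GH u_bd(2) that in \<open>auto intro: continuous_on_norm\<close>)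
  have cu: "\<bar>u x\<bar> \<le> M" if "x \<in> closure \<Omega>" for x
    by (rule continuous_le_on_closure[of \<Omega> "\<lambda>x. \<bar>u x\<bar>"]) (use contu u_bd(1) that in \<open>auto intro: continuous_on_rabs\<close>)
  have cv: "\<bar>v x\<bar> \<le> M" if "x \<in> closure \<Omega>" for x
    by (rule continuous_le_on_closure[of \<Omega> "\<lambda>x. \<bar>v x\<bar>"]) (use contv v_bd(1) that in \<open>auto intro: continuous_on_rabs\<close>)
  define \<Phi> where "\<Phi> x = \<tau> * ((norm (G x))\<^sup>2 / 2) + \<kappa> * exp (K * (v x - u x))" for x
  have \<Phi>0: "0 \<le> \<Phi> x" for x using const_pos by (simp add: \<Phi>_def)
  have \<Phi>le: "\<Phi> x \<le> \<Phi>max" if "x \<in> closure \<Omega>" for x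
  proof -
    have "(norm (G x))\<^sup>2 \<le> M\<^sup>2" using cG[OF that] \<rho>M by (intro power_mono) auto
    moreover have "K * (v x - u x) \<le> 2 * K * M"
    proof -
      have "v x - u x \<le> 2 * M" using cu[OF that] cv[OF that] by linarith
      then have "K * (v x - u x) \<le> K * (2 * M)" using const_pos by (intro mult_left_mono) auto
      then show ?thesis by simp
    qed
    ultimately show ?thesis
      unfolding \<Phi>_def \<Phi>max_def using const_pos
      by (intro add_mono mult_left_mono divide_right_mono) auto
  qed
  define N where "N x = H x - A (x, G x)" for x
  have N: "N x = MA_matrix A u x" if "x \<in> \<Omega>" for x using GH(3,4)[OF that] by (simp add: N_def MA_matrix_def)
  have contN: "continuous_on (closure \<Omega>) N"
    unfolding N_def
    by (intro continuous_on_diff GH(2) continuous_on_compose2[OF contA] continuous_on_Pair continuous_on_id GH(1)) auto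
  \<comment> \<open>The exponential of \<open>H\<close>; unlike \<open>H\<close> it is continuous up to
    the boundary without a positive lower bound for \<open>W\<close> there.\<close>
  define \<Psi> where "\<Psi> z = (snd z \<bullet> (N (fst z) *v snd z)) * exp (\<Phi> (fst z))" for z
  let ?D = "closure \<Omega> \<times> sphere (0 :: real ^ 'n) 1"
  have "compact ?D" using bounded_\<Omega> by (intro compact_Times) (auto simp: compact_closure)
  moreover have "?D \<noteq> {}"
  proof -
    have "axis undefined 1 \<in> sphere (0 :: real ^ 'n) 1" by simp
    then show ?thesis using ne_\<Omega> closure_subset by blast
  qed
  moreover have "continuous_on ?D \<Psi>"
  proof -
    have f: "continuous_on ?D (\<lambda>z. h (fst z))" if "continuous_on (closure \<Omega>) h" for h :: "real ^ 'n \<Rightarrow> 'c::topological_space"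
      by (rule continuous_on_compose2[OF that continuous_on_fst[OF continuous_on_id]]) auto
    have mv: "(\<lambda>z. snd z \<bullet> (N (fst z) *v snd z)) =
        (\<lambda>z. \<Sum>i\<in>UNIV. snd z $ i * (\<Sum>j\<in>UNIV. N (fst z) $ i $ j * snd z $ j))"
      by (simp add: inner_vec_def matrix_vector_mult_def)
    have "continuous_on ?D (\<lambda>z. snd z \<bullet> (N (fst z) *v snd z))"
      unfolding mv by (intro continuous_intros f[OF contN])
    moreover have "continuous_on (closure \<Omega>) \<Phi>"
      unfolding \<Phi>_def by (intro continuous_intros GH(1) contu contv) auto
    ultimately show ?thesis
      unfolding \<Psi>_def by (intro continuous_on_mult continuous_on_exp f)
  qed
  ultimately obtain z0 where z0: "z0 \<in> ?D" and max: "\<And>z. z \<in> ?D \<Longrightarrow> \<Psi> z \<le> \<Psi> z0"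
    using continuous_attains_sup[of ?D \<Psi>] by blast
  obtain x0 e0 where z0_eq: "z0 = (x0, e0)" by force
  have x0c: "x0 \<in> closure \<Omega>" and e0: "norm e0 = 1" using z0 by (auto simp: z0_eq)
  define B where "B = (1 + \<Lambda> + M + real CARD('n)) * (1 + S)"
  have pieces: "1 + \<Lambda> \<le> B" "real CARD('n) * S + M \<le> B"
    using const_pos M1 S(2) by (auto simp: B_def algebra_simps)
  have bound0: "e0 \<bullet> (N x0 *v e0) \<le> B"
  proof (cases "x0 \<in> \<Omega>")
    case True
    have "e0 \<bullet> (MA_matrix A u x0 *v e0) \<le> 1 + \<Lambda>"
    proof (rule weighted_maximum_bound[OF u4 ell equ u_bd True e0])
      fix x and e :: "real ^ 'n" assume "x \<in> \<Omega>" "norm e = 1"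
      then show "(e \<bullet> (MA_matrix A u x *v e)) * exp (\<tau> * ((norm (grad u x))\<^sup>2 / 2) + \<kappa> * exp (K * (v x - u x))) \<le>
        (e0 \<bullet> (MA_matrix A u x0 *v e0)) * exp (\<tau> * ((norm (grad u x0))\<^sup>2 / 2) + \<kappa> * exp (K * (v x0 - u x0)))"
        using max[of "(x, e)"] True subsetD[OF closure_subset[of \<Omega>], of x]
        by (simp add: z0_eq \<Psi>_def \<Phi>_def N GH(3))
    qed
    then show ?thesis using pieces(1) N[OF True] by simp
  next
    case False
    then have fr: "x0 \<in> frontier \<Omega>" using x0c open_\<Omega> by (simp add: frontier_def interior_open)
    have "norm (H x0) \<le> S"
      using S(1)[OF fr] closure_ext_eq[OF open_\<Omega> GH(2) GH(4) fr] by simp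
    then have "real CARD('n) * norm (H x0) \<le> real CARD('n) * S" by (intro mult_left_mono) auto
    moreover have "e0 \<bullet> (H x0 *v e0) \<le> real CARD('n) * norm (H x0)"
      using abs_matrix_form_le[of e0 "H x0" e0] e0 by simp
    moreover have "\<bar>e0 \<bullet> (A (x0, G x0) *v e0)\<bar> \<le> M"
      using A_bd0[OF x0c cG[OF x0c], of e0 e0] e0 by (simp add: mform_def)
    ultimately have "e0 \<bullet> (N x0 *v e0) \<le> real CARD('n) * S + M"
      unfolding N_def matrix_vector_mult_diff_rdistrib inner_diff_right by linarith
    then show ?thesis using pieces(2) by simp
  qed
  have B0: "B \<ge> 0" using pieces(1) const_pos by linarith
  have \<Psi>0: "\<Psi> z0 \<le> exp \<Phi>max * B"
  proof -
    have "\<Psi> z0 \<le> B * exp (\<Phi> x0)" unfolding \<Psi>_def z0_eq using bound0 by simp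
    also have "\<dots> \<le> B * exp \<Phi>max" using \<Phi>le[OF x0c] B0 by (intro mult_left_mono) auto
    finally show ?thesis by (simp add: mult.commute)
  qed
  have posx: "pos_definite (MA_matrix A u x)" using ell x by (simp add: elliptic_def)
  have u2: "Ck_on 2 \<Omega> u" using Ck_on_mono[OF u4, of 2] by simp
  have symx: "transpose (MA_matrix A u x) = MA_matrix A u x"
    by (rule transpose_MA_matrix[OF open_\<Omega> x u2 symA]) (use x in simp)
  have "norm (MA_matrix A u x) \<le> (real CARD('n))\<^sup>2 * (exp \<Phi>max * B)"
  proof (rule norm_pos_definite_le[OF symx posx])
    fix e :: "real ^ 'n" assume e: "norm e = 1"
    have "e \<noteq> 0" using e by auto
    then have pe: "e \<bullet> (MA_matrix A u x *v e) > 0" using posx by (simp add: pos_definite_def)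
    have "e \<bullet> (MA_matrix A u x *v e) * 1 \<le> e \<bullet> (MA_matrix A u x *v e) * exp (\<Phi> x)"
      using pe \<Phi>0[of x] by (intro mult_left_mono) auto
    also have "\<dots> = \<Psi> (x, e)" by (simp add: \<Psi>_def N[OF x])
    also have "\<dots> \<le> \<Psi> z0" using max[of "(x, e)"] e x closure_subset[of \<Omega>] by auto
    finally show "e \<bullet> (MA_matrix A u x *v e) \<le> exp \<Phi>max * B" using \<Psi>0 by simp
  qed
  moreover have "norm (hess u x) \<le> norm (MA_matrix A u x) + norm (A (x, grad u x))"
    using norm_triangle_ineq[of "MA_matrix A u x" "A (x, grad u x)"] by (simp add: MA_matrix_def)
  moreover have "norm (A (x, grad u x)) \<le> M * (1 + S)"
    using A_norm[OF x u_bd(2)[OF x]] M1 S(2) by (simp add: algebra_simps) (smt (verit) mult_nonneg_nonneg)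
  ultimately show ?thesis by (simp add: Cfinal_def B_def algebra_simps)
qed

end

section \<open>The global second derivative estimate\<close>

lemma norm_grad_le:
  assumes "u differentiable (at x)" "\<And>e. norm (D e u x) \<le> K * norm e"
  shows "norm (grad u x) \<le> K"
  by (rule norm_le_of_inner_le) (use assms(2) in \<open>simp add: grad_inner[OF assms(1)]\<close>)

lemma twice_diff_ln_bounds:
  fixes f :: "'a::euclidean_space \<Rightarrow> real"
  assumes S: "open S" "z \<in> S" and f: "twice_diff S f z" and pos: "\<And>y. y \<in> S \<Longrightarrow> f y > 0"
    and c: "c > 0" "c \<le> f z"
    and d1: "\<And>\<zeta>. \<bar>D \<zeta> f z\<bar> \<le> K * norm \<zeta>"
    and d2: "\<And>\<zeta> \<omega>. \<bar>D \<zeta> (D \<omega> f) z\<bar> \<le> K * norm \<zeta> * norm \<omega>"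
  shows "\<bar>D \<zeta> (\<lambda>y. ln (f y)) z\<bar> \<le> K / c * norm \<zeta>"
    and "\<bar>D \<zeta> (D \<omega> (\<lambda>y. ln (f y))) z\<bar> \<le> (K / c + K\<^sup>2 / c\<^sup>2) * norm \<zeta> * norm \<omega>"
proof -
  have fz: "f z > 0" using c by simp
  have K1: "K * norm \<zeta> \<ge> 0" for \<zeta> :: 'a by (rule order_trans[OF abs_ge_zero d1])
  have K2: "K * norm \<zeta> * norm \<omega> \<ge> 0" for \<zeta> \<omega> :: 'a by (rule order_trans[OF abs_ge_zero d2])
  have "\<bar>D \<zeta> (\<lambda>y. ln (f y)) z\<bar> = \<bar>D \<zeta> f z\<bar> / f z"
    using fz by (simp add: twice_diff_ln(2)[OF S f pos])
  also have "\<dots> \<le> (K * norm \<zeta>) / c"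
    using d1 c K1 by (intro frac_le) auto
  finally show "\<bar>D \<zeta> (\<lambda>y. ln (f y)) z\<bar> \<le> K / c * norm \<zeta>" by simp
  have "\<bar>D \<zeta> (D \<omega> (\<lambda>y. ln (f y))) z\<bar> \<le>
      \<bar>D \<zeta> (D \<omega> f) z / f z\<bar> + \<bar>D \<zeta> f z * D \<omega> f z / (f z)\<^sup>2\<bar>"
    using abs_triangle_ineq4[of "D \<zeta> (D \<omega> f) z / f z" "D \<zeta> f z * D \<omega> f z / (f z)\<^sup>2"]
    by (simp only: twice_diff_ln(3)[OF S f pos])
  also have "\<dots> = \<bar>D \<zeta> (D \<omega> f) z\<bar> / f z + (\<bar>D \<zeta> f z\<bar> * \<bar>D \<omega> f z\<bar>) / (f z)\<^sup>2"
    using fz by (simp add: abs_mult)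
  also have "\<dots> \<le> (K * norm \<zeta> * norm \<omega>) / c + ((K * norm \<zeta>) * (K * norm \<omega>)) / c\<^sup>2"
  proof (rule add_mono)
    show "\<bar>D \<zeta> (D \<omega> f) z\<bar> / f z \<le> (K * norm \<zeta> * norm \<omega>) / c"
      using d2 c K2 by (intro frac_le) auto
    show "(\<bar>D \<zeta> f z\<bar> * \<bar>D \<omega> f z\<bar>) / (f z)\<^sup>2 \<le> ((K * norm \<zeta>) * (K * norm \<omega>)) / c\<^sup>2"
    proof (rule frac_le)
      show "0 \<le> (K * norm \<zeta>) * (K * norm \<omega>)" by (rule mult_nonneg_nonneg[OF K1 K1])
      show "\<bar>D \<zeta> f z\<bar> * \<bar>D \<omega> f z\<bar> \<le> (K * norm \<zeta>) * (K * norm \<omega>)"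
        using d1 K1 by (intro mult_mono) auto
    qed (use c in \<open>auto intro: power_mono\<close>)
  qed
  also have "\<dots> = (K / c + K\<^sup>2 / c\<^sup>2) * norm \<zeta> * norm \<omega>"
    by (simp add: power2_eq_square algebra_simps)
  finally show "\<bar>D \<zeta> (D \<omega> (\<lambda>y. ln (f y))) z\<bar> \<le> (K / c + K\<^sup>2 / c\<^sup>2) * norm \<zeta> * norm \<omega>" .
qed

lemma INF_ereal_pos:
  assumes "(INF z \<in> S. ereal (f z)) > 0"
  obtains c where "c > 0" "\<And>z. z \<in> S \<Longrightarrow> c \<le> f z"
proof -
  obtain c where c: "0 < ereal c" "ereal c < (INF z \<in> S. ereal (f z))"
    using ereal_dense2[OF assms] by blast
  have "c \<le> f z" if "z \<in> S" for z
  proof -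
    have "ereal c < ereal (f z)" using c(2) INF_lower[OF that, of "\<lambda>z. ereal (f z)"] by (rule less_le_trans)
    then show ?thesis by simp
  qed
  then show ?thesis using that c(1) by simp
qed

text \<open>
  A subsolution is uniformly elliptic: the determinant is bounded below and the second derivatives are
  bounded above.
\<close>
lemma uniformly_elliptic_of_det_bound:
  fixes \<Omega> :: "(real ^ 'n) set"
  assumes \<Omega>: "open \<Omega>" and cb: "compact (closure \<Omega>)"
    and A: "continuous_on (closure \<Omega> \<times> UNIV) A" and symA: "\<And>z. z \<in> \<Omega> \<times> UNIV \<Longrightarrow> transpose (A z) = A z"
    and v: "Ck_closure 2 \<Omega> v" and ell: "elliptic \<Omega> A v"
    and c: "c > 0" "\<And>x. x \<in> \<Omega> \<Longrightarrow> c \<le> det (MA_matrix A v x)"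
    and vgrad: "\<And>x. x \<in> \<Omega> \<Longrightarrow> norm (grad v x) \<le> K"
    and vhess: "\<And>x \<zeta> \<omega>. x \<in> \<Omega> \<Longrightarrow> norm (D \<zeta> (D \<omega> v) x) \<le> K * norm \<zeta> * norm \<omega>"
  obtains \<delta> where "\<delta> > 0" "\<And>x e. x \<in> \<Omega> \<Longrightarrow> norm e = 1 \<Longrightarrow> \<delta> \<le> e \<bullet> (MA_matrix A v x *v e)"
proof -
  have v2: "Ck_on 2 \<Omega> v" by (rule Ck_closure_imp_Ck_on[OF \<Omega> v])
  have "compact (A ` (closure \<Omega> \<times> cball 0 K))"
    by (intro compact_continuous_image continuous_on_subset[OF A] compact_Times cb compact_cball) auto
  then obtain N where "\<forall>y\<in>A ` (closure \<Omega> \<times> cball 0 K). norm y \<le> N"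
    using compact_imp_bounded[THEN bounded_iff[THEN iffD1]] by blast
  then have N: "norm (A z) \<le> N" if "z \<in> closure \<Omega> \<times> cball 0 K" for z using imageI[OF that, of A] by blast
  define L where "L = 1 + \<bar>K\<bar> + real CARD('n) * \<bar>N\<bar>"
  have L1: "L \<ge> 1" by (simp add: L_def)
  have lower: "c / L ^ CARD('n) \<le> e \<bullet> (MA_matrix A v x *v e)" if x: "x \<in> \<Omega>" and e: "norm e = 1" for x e
  proof -
    have sym: "transpose (MA_matrix A v x) = MA_matrix A v x"
      by (rule transpose_MA_matrix[OF \<Omega> x v2 symA]) (use x in simp)
    have pos: "pos_definite (MA_matrix A v x)" using ell x by (simp add: elliptic_def)
    have up: "y \<bullet> (MA_matrix A v x *v y) \<le> L" if y: "norm y = 1" for y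
    proof -
      have "\<bar>y \<bullet> (hess v x *v y)\<bar> \<le> K" using vhess[OF x, of y y] y hess_inner[OF \<Omega> x v2, of y y] by simp
      moreover have "\<bar>y \<bullet> (A (x, grad v x) *v y)\<bar> \<le> real CARD('n) * norm (A (x, grad v x))"
        using abs_matrix_form_le[of y "A (x, grad v x)" y] y by simp
      moreover have "real CARD('n) * norm (A (x, grad v x)) \<le> real CARD('n) * \<bar>N\<bar>"
      proof (rule mult_left_mono)
        have "(x, grad v x) \<in> closure \<Omega> \<times> cball 0 K" using vgrad[OF x] x closure_subset by auto
        from N[OF this] show "norm (A (x, grad v x)) \<le> \<bar>N\<bar>" by linarith
      qed simp
      ultimately show ?thesis unfolding MA_matrix_form mform_def L_def by linarith
    qed
    show ?thesis
      using pos_definite_lower_bound[OF sym pos c(1) c(2)[OF x] L1 up, of e] e by (simp add: norm_eq_1)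
  qed
  show ?thesis
    by (rule that[of "c / L ^ CARD('n)"]) (use c(1) L1 lower in auto)
qed

theorem theorem1p1:
  fixes \<Omega> :: "(real ^ 'n) set"
    and A :: "(real ^ 'n) \<times> (real ^ 'n) \<Rightarrow> real ^ 'n ^ 'n"
    and B :: "(real ^ 'n) \<times> (real ^ 'n) \<Rightarrow> real"
    and v :: "real ^ 'n \<Rightarrow> real"
  assumes "smooth_bounded_domain \<Omega>"
    and "Ck_closure 2 (\<Omega> \<times> UNIV) A"
    and "\<forall>z \<in> closure \<Omega> \<times> UNIV. transpose (A z) = A z"
    and "regular_on \<Omega> A"
    and "Ck_closure 2 (\<Omega> \<times> UNIV) B"
    and "(INF z \<in> closure \<Omega> \<times> UNIV. ereal (B z)) > 0"
    and "Ck_closure 2 \<Omega> v"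
    and "subsolution \<Omega> A B v"
  shows "\<exists>C :: real \<Rightarrow> real. \<forall>\<phi> u.
           smooth_on_subset (frontier \<Omega>) \<phi> \<and>
           Ck_on 4 \<Omega> u \<and> Ck_closure 2 \<Omega> u \<and>
           elliptic \<Omega> A u \<and> dirichlet_solution \<Omega> A B \<phi> u \<longrightarrow>
           (SUP x\<in>\<Omega>. norm (hess u x))
             \<le> C (SUP x\<in>\<Omega>. \<bar>u x\<bar> + norm (grad u x)) *
               (1 + (SUP x\<in>frontier \<Omega>. norm (closure_ext \<Omega> (hess u) x)))"
proof -
  have open_\<Omega>: "open \<Omega>" and ne: "\<Omega> \<noteq> {}" and bdd: "bounded \<Omega>"
    using assms(1) by (auto simp: smooth_bounded_domain_def)
  have cb: "compact (closure \<Omega>)" using bdd by (simp add: compact_closure)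
  let ?D = "\<Omega> \<times> (UNIV :: (real ^ 'n) set)"
  have oD: "open ?D" using open_\<Omega> by (intro open_Times) auto
  have clD: "closure ?D = closure \<Omega> \<times> UNIV" by (simp add: closure_Times)
  have inD: "z \<in> closure \<Omega> \<times> UNIV" if "z \<in> ?D" for z using that closure_subset by auto
  obtain c0 where c0: "c0 > 0" "\<And>z. z \<in> closure \<Omega> \<times> UNIV \<Longrightarrow> c0 \<le> B z"
    using INF_ereal_pos[OF assms(6)] by blast
  have Bpos: "B z > 0" if "z \<in> ?D" for z using c0(1) c0(2)[OF inD[OF that]] by linarith
  have A2: "twice_diff ?D A z" if "z \<in> ?D" for z
    by (rule Ck_on_imp_twice_diff[OF oD that Ck_closure_imp_Ck_on[OF oD assms(2)]])
  have B2: "twice_diff ?D B z" if "z \<in> ?D" for z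
    by (rule Ck_on_imp_twice_diff[OF oD that Ck_closure_imp_Ck_on[OF oD assms(5)]])
  have \<beta>2: "twice_diff ?D (\<lambda>z. ln (B z)) z" if "z \<in> ?D" for z
    by (rule twice_diff_ln(1)[OF oD that B2[OF that] Bpos])
  have contA: "continuous_on (closure \<Omega> \<times> UNIV) A"
    using assms(2) clD by (simp add: numeral_2_eq_2)
  have symA: "transpose (A z) = A z" if "z \<in> ?D" for z using assms(3) inD[OF that] by blast
  have v2: "Ck_on 2 \<Omega> v" by (rule Ck_closure_imp_Ck_on[OF open_\<Omega> assms(7)])
  have v_diff: "v differentiable (at x)" if "x \<in> \<Omega>" for x
    using v2 that by (simp add: numeral_2_eq_2)
  have contv: "continuous_on (closure \<Omega>) v" using assms(7) by (simp add: numeral_2_eq_2)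
  obtain K where K: "K \<ge> 0" "\<And>x. x \<in> \<Omega> \<Longrightarrow> x \<in> closure \<Omega> \<Longrightarrow> norm (v x) \<le> K"
    "\<And>x \<zeta>. x \<in> \<Omega> \<Longrightarrow> x \<in> closure \<Omega> \<Longrightarrow> norm (D \<zeta> v x) \<le> K * norm \<zeta>"
    "\<And>x \<zeta> \<omega>. x \<in> \<Omega> \<Longrightarrow> x \<in> closure \<Omega> \<Longrightarrow> norm (D \<zeta> (D \<omega> v) x) \<le> K * norm \<zeta> * norm \<omega>"
    by (rule Ck_closure_2_bounds[OF open_\<Omega> assms(7) cb subset_refl]) (rule that; assumption)
  have cl: "x \<in> closure \<Omega>" if "x \<in> \<Omega>" for x using that closure_subset by blast
  have vK: "\<bar>v x\<bar> \<le> K" "norm (grad v x) \<le> K" if "x \<in> \<Omega>" for x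
    using K(2)[OF that cl[OF that]] norm_grad_le[OF v_diff[OF that] K(3)[OF that cl[OF that]]] by simp_all
  have ell_v: "elliptic \<Omega> A v" and det_v: "\<And>x. x \<in> \<Omega> \<Longrightarrow> B (x, grad v x) \<le> det (MA_matrix A v x)"
    using assms(8) by (auto simp: subsolution_def)
  have "c0 \<le> det (MA_matrix A v x)" if "x \<in> \<Omega>" for x
    using det_v[OF that] c0(2)[OF inD[of "(x, grad v x)"]] that by simp
  then obtain \<delta> where \<delta>: "\<delta> > 0" "\<And>x e. x \<in> \<Omega> \<Longrightarrow> norm e = 1 \<Longrightarrow> \<delta> \<le> e \<bullet> (MA_matrix A v x *v e)"
    using uniformly_elliptic_of_det_bound[OF open_\<Omega> cb contA symA assms(7) ell_v c0(1) _ vK(2) K(4)[OF _ cl]]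
    by blast
  have fr_ne: "frontier \<Omega> \<noteq> {}"
    using ne bdd by (metis frontier_eq_empty not_bounded_UNIV)
  have "\<forall>R. \<exists>C. \<forall>\<phi> u. Ck_on 4 \<Omega> u \<and> Ck_closure 2 \<Omega> u \<and> elliptic \<Omega> A u \<and> dirichlet_solution \<Omega> A B \<phi> u \<and>
      (SUP x\<in>\<Omega>. \<bar>u x\<bar> + norm (grad u x)) = R \<longrightarrow>
      (SUP x\<in>\<Omega>. norm (hess u x)) \<le> C * (1 + (SUP x\<in>frontier \<Omega>. norm (closure_ext \<Omega> (hess u) x)))"
  proof
    fix R :: real
    define \<rho> where "\<rho> = \<bar>R\<bar> + K"
    let ?K = "closure \<Omega> \<times> cball (0 :: real ^ 'n) \<rho>"
    have cK: "compact ?K" "?K \<subseteq> closure ?D" using cb clD by (auto intro: compact_Times)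
    obtain MA where MA: "MA \<ge> 0" "\<And>z. z \<in> ?D \<Longrightarrow> z \<in> ?K \<Longrightarrow> norm (A z) \<le> MA"
      "\<And>z \<zeta>. z \<in> ?D \<Longrightarrow> z \<in> ?K \<Longrightarrow> norm (D \<zeta> A z) \<le> MA * norm \<zeta>"
      "\<And>z \<zeta> \<omega>. z \<in> ?D \<Longrightarrow> z \<in> ?K \<Longrightarrow> norm (D \<zeta> (D \<omega> A) z) \<le> MA * norm \<zeta> * norm \<omega>"
      by (rule Ck_closure_2_bounds[OF oD assms(2) cK]) (rule that; assumption)
    obtain MB where MB: "MB \<ge> 0" "\<And>z. z \<in> ?D \<Longrightarrow> z \<in> ?K \<Longrightarrow> norm (B z) \<le> MB"
      "\<And>z \<zeta>. z \<in> ?D \<Longrightarrow> z \<in> ?K \<Longrightarrow> norm (D \<zeta> B z) \<le> MB * norm \<zeta>"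
      "\<And>z \<zeta> \<omega>. z \<in> ?D \<Longrightarrow> z \<in> ?K \<Longrightarrow> norm (D \<zeta> (D \<omega> B) z) \<le> MB * norm \<zeta> * norm \<omega>"
      by (rule Ck_closure_2_bounds[OF oD assms(5) cK]) (rule that; assumption)
    have "compact (A ` ?K)"
      by (intro compact_continuous_image continuous_on_subset[OF contA] cK) auto
    then obtain N where "\<forall>y\<in>A ` ?K. norm y \<le> N"
      using compact_imp_bounded[THEN bounded_iff[THEN iffD1]] by blast
    then have N: "norm (A z) \<le> N" if "z \<in> ?K" for z using imageI[OF that, of A] by blast
    let ?n = "real CARD('n)"
    have n1: "?n \<ge> 1" by (simp add: Suc_leI)
    define M where "M = 1 + \<rho> + ?n * (MA + \<bar>N\<bar>) + (MB / c0 + MB\<^sup>2 / c0\<^sup>2)"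
    have \<rho>0: "\<rho> \<ge> 0" "K \<le> \<rho>" "\<bar>R\<bar> \<le> \<rho>" using K(1) by (auto simp: \<rho>_def)
    have parts: "?n * (MA + \<bar>N\<bar>) \<ge> 0" "MB / c0 \<ge> 0" "MB\<^sup>2 / c0\<^sup>2 \<ge> 0"
      using MA(1) MB(1) c0(1) by auto
    have "MA \<le> ?n * MA" "\<bar>N\<bar> \<le> ?n * \<bar>N\<bar>"
      using mult_right_mono[OF n1 MA(1)] mult_right_mono[OF n1 abs_ge_zero[of N]] by simp_all
    then have Mle: "1 \<le> M" "\<rho> \<le> M" "?n * MA \<le> M" "?n * \<bar>N\<bar> \<le> M" "MA \<le> M" "MB / c0 \<le> M" "MB / c0 + MB\<^sup>2 / c0\<^sup>2 \<le> M"
      using \<rho>0 parts MA(1) abs_ge_zero[of N] unfolding M_def distrib_left by linarith+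
    have z: "(x, p) \<in> ?D" "(x, p) \<in> ?K" if "x \<in> \<Omega>" "norm p \<le> \<rho>" for x p
      using that cl by auto
    have form: "\<bar>\<xi> \<bullet> (P *v \<eta>)\<bar> \<le> M * norm \<xi> * norm \<eta> * t" if P: "norm P \<le> MA * t" and t: "t \<ge> 0"
      for P :: "real ^ 'n ^ 'n" and \<xi> \<eta> t
    proof -
      have "\<bar>\<xi> \<bullet> (P *v \<eta>)\<bar> \<le> ?n * norm P * norm \<xi> * norm \<eta>" by (rule abs_matrix_form_le)
      also have "\<dots> \<le> ?n * (MA * t) * norm \<xi> * norm \<eta>" using P by (intro mult_right_mono mult_left_mono) auto
      also have "\<dots> = ?n * MA * (norm \<xi> * norm \<eta> * t)" by simp
      also have "\<dots> \<le> M * (norm \<xi> * norm \<eta> * t)" using Mle(3) t by (intro mult_right_mono) auto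
      finally show ?thesis by simp
    qed
    \<comment> \<open>The constant depends on \<open>u\<close> only through \<open>R\<close>, which
      determines \<open>\<rho>\<close> and then \<open>M\<close>.\<close>
    interpret elliptic_problem \<Omega> A "\<lambda>z. ln (B z)" v \<rho> M \<delta>
    proof unfold_locales
      show "\<bar>v x\<bar> \<le> M" "norm (grad v x) \<le> \<rho>" if "x \<in> \<Omega>" for x
        using vK[OF that] \<rho>0 Mle(2) by linarith+
      show "\<bar>mform A \<xi> \<eta> (x, p)\<bar> \<le> M * norm \<xi> * norm \<eta>" if "x \<in> closure \<Omega>" "norm p \<le> \<rho>" for x p \<xi> \<eta>
      proof -
        have "norm (A (x, p)) \<le> \<bar>N\<bar>" using N[of "(x, p)"] that by auto
        have "\<bar>mform A \<xi> \<eta> (x, p)\<bar> \<le> ?n * norm (A (x, p)) * norm \<xi> * norm \<eta>"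
          unfolding mform_def by (rule abs_matrix_form_le)
        also have "\<dots> \<le> ?n * \<bar>N\<bar> * norm \<xi> * norm \<eta>"
          using \<open>norm (A (x, p)) \<le> \<bar>N\<bar>\<close> by (intro mult_right_mono mult_left_mono) auto
        also have "\<dots> \<le> M * norm \<xi> * norm \<eta>" using Mle(4) by (intro mult_right_mono) auto
        finally show ?thesis .
      qed
      fix x p :: "real ^ 'n" assume xp: "x \<in> \<Omega>" "norm p \<le> \<rho>"
      note zD = z(1)[OF xp] and zK = z(2)[OF xp]
      show "norm (A (x, p)) \<le> M" using MA(2)[OF zD zK] Mle(5) by linarith
      show "\<bar>D \<zeta> (mform A \<xi> \<eta>) (x, p)\<bar> \<le> M * norm \<xi> * norm \<eta> * norm \<zeta>" for \<xi> \<eta> \<zeta>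
        unfolding twice_diff_mform(2)[OF oD zD A2[OF zD]] by (rule form[OF MA(3)[OF zD zK]]) simp
      show "\<bar>D \<zeta> (D \<omega> (mform A \<xi> \<eta>)) (x, p)\<bar> \<le> M * norm \<xi> * norm \<eta> * norm \<zeta> * norm \<omega>" for \<xi> \<eta> \<zeta> \<omega>
        unfolding twice_diff_mform(3)[OF oD zD A2[OF zD]]
        using form[of "D \<zeta> (D \<omega> A) (x, p)" "norm \<zeta> * norm \<omega>" \<xi> \<eta>] MA(4)[OF zD zK, of \<zeta> \<omega>]
        by (simp add: mult.assoc)
      have c0z: "c0 \<le> B (x, p)" by (rule c0(2)[OF inD[OF zD]])
      have b1: "\<bar>D \<zeta> B (x, p)\<bar> \<le> MB * norm \<zeta>" for \<zeta> using MB(3)[OF zD zK, of \<zeta>] by simp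
      have b2: "\<bar>D \<zeta> (D \<omega> B) (x, p)\<bar> \<le> MB * norm \<zeta> * norm \<omega>" for \<zeta> \<omega>
        using MB(4)[OF zD zK, of \<zeta> \<omega>] by simp
      note lnb = twice_diff_ln_bounds[OF oD zD B2[OF zD] Bpos c0(1) c0z b1 b2]
      show "\<bar>D \<zeta> (\<lambda>z. ln (B z)) (x, p)\<bar> \<le> M * norm \<zeta>" for \<zeta>
        by (rule order_trans[OF lnb(1) mult_right_mono[OF Mle(6)]]) simp_all
      show "\<bar>D \<zeta> (D \<omega> (\<lambda>z. ln (B z))) (x, p)\<bar> \<le> M * norm \<zeta> * norm \<omega>" for \<zeta> \<omega>
        by (rule order_trans[OF lnb(2) mult_right_mono[OF mult_right_mono[OF Mle(7)]]]) simp_all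
    qed (fact open_\<Omega> bdd ne contA symA A2 \<beta>2 assms(4) v2 contv Mle(1) Mle(2) \<delta>)+
    show "\<exists>C. \<forall>\<phi> u. Ck_on 4 \<Omega> u \<and> Ck_closure 2 \<Omega> u \<and> elliptic \<Omega> A u \<and> dirichlet_solution \<Omega> A B \<phi> u \<and>
      (SUP x\<in>\<Omega>. \<bar>u x\<bar> + norm (grad u x)) = R \<longrightarrow>
      (SUP x\<in>\<Omega>. norm (hess u x)) \<le> C * (1 + (SUP x\<in>frontier \<Omega>. norm (closure_ext \<Omega> (hess u) x)))"
    proof (rule exI[of _ Cfinal], intro allI impI, elim conjE)
      fix \<phi> u
      assume u4: "Ck_on 4 \<Omega> u" and uc: "Ck_closure 2 \<Omega> u" and ell: "elliptic \<Omega> A u"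
        and sol: "dirichlet_solution \<Omega> A B \<phi> u" and R: "(SUP x\<in>\<Omega>. \<bar>u x\<bar> + norm (grad u x)) = R"
      obtain G H where GH: "continuous_on (closure \<Omega>) G" "continuous_on (closure \<Omega>) H"
        "\<And>x. x \<in> \<Omega> \<Longrightarrow> G x = grad u x" "\<And>x. x \<in> \<Omega> \<Longrightarrow> H x = hess u x"
        using Ck_closure_2_extension[OF open_\<Omega> uc] by blast
      have contu: "continuous_on (closure \<Omega>) u" using uc by (simp add: numeral_2_eq_2)
      have "compact ((\<lambda>x. \<bar>u x\<bar> + norm (G x)) ` closure \<Omega>)"
        by (intro compact_continuous_image cb continuous_intros contu GH(1))
      then have "bdd_above ((\<lambda>x. \<bar>u x\<bar> + norm (G x)) ` \<Omega>)"
        by (meson bdd_above_mono bounded_imp_bdd_above closure_subset compact_imp_bounded image_mono)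
      then have bdu: "bdd_above ((\<lambda>x. \<bar>u x\<bar> + norm (grad u x)) ` \<Omega>)"
        using GH(3) by (simp cong: image_cong)
      have uR: "\<bar>u x\<bar> + norm (grad u x) \<le> R" if "x \<in> \<Omega>" for x
        unfolding R[symmetric] by (rule cSUP_upper[OF that bdu])
      have u_bd: "\<bar>u x\<bar> \<le> M" "norm (grad u x) \<le> \<rho>" if "x \<in> \<Omega>" for x
        using uR[OF that] \<rho>0 Mle(2) norm_ge_zero[of "grad u x"] abs_ge_zero[of "u x"] by linarith+
      have equ: "ln (det (MA_matrix A u x)) = ln (B (x, grad u x))" if "x \<in> \<Omega>" for x
        using sol that by (simp add: dirichlet_solution_def)
      define S where "S = (SUP x\<in>frontier \<Omega>. norm (closure_ext \<Omega> (hess u) x))"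
      have ext: "closure_ext \<Omega> (hess u) x = H x" if "x \<in> frontier \<Omega>" for x
        by (rule closure_ext_eq[OF open_\<Omega> GH(2) GH(4) that])
      have "compact ((\<lambda>x. norm (H x)) ` frontier \<Omega>)"
        by (intro compact_continuous_image compact_frontier_bounded bdd continuous_on_norm
            continuous_on_subset[OF GH(2)]) (auto simp: frontier_def)
      then have "bdd_above ((\<lambda>x. norm (H x)) ` frontier \<Omega>)"
        by (intro bounded_imp_bdd_above compact_imp_bounded)
      then have bdS: "bdd_above ((\<lambda>x. norm (closure_ext \<Omega> (hess u) x)) ` frontier \<Omega>)"
        using ext by (simp cong: image_cong)
      have S: "norm (closure_ext \<Omega> (hess u) x) \<le> S" if "x \<in> frontier \<Omega>" for x
        unfolding S_def by (rule cSUP_upper[OF that bdS])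
      have "S \<ge> 0"
      proof -
        obtain y where "y \<in> frontier \<Omega>" using fr_ne by blast
        from S[OF this] show ?thesis by (rule order_trans[OF norm_ge_zero])
      qed
      have "norm (hess u x) \<le> Cfinal * (1 + S)" if "x \<in> \<Omega>" for x
        by (rule hessian_bound[OF u4 uc ell equ u_bd S \<open>S \<ge> 0\<close> that])
      then show "(SUP x\<in>\<Omega>. norm (hess u x)) \<le> Cfinal * (1 + (SUP x\<in>frontier \<Omega>. norm (closure_ext \<Omega> (hess u) x)))"
        unfolding S_def[symmetric] by (intro cSUP_least ne)
    qed
  qed
  from choice[OF this] obtain C where C: "\<forall>R. \<forall>\<phi> u. Ck_on 4 \<Omega> u \<and> Ck_closure 2 \<Omega> u \<and>
      elliptic \<Omega> A u \<and> dirichlet_solution \<Omega> A B \<phi> u \<and>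
      (SUP x\<in>\<Omega>. \<bar>u x\<bar> + norm (grad u x)) = R \<longrightarrow>
      (SUP x\<in>\<Omega>. norm (hess u x)) \<le> C R * (1 + (SUP x\<in>frontier \<Omega>. norm (closure_ext \<Omega> (hess u) x)))"
    by blast
  show ?thesis
  proof (intro exI[of _ C] allI impI, elim conjE)
    fix \<phi> u
    assume "Ck_on 4 \<Omega> u" "Ck_closure 2 \<Omega> u" "elliptic \<Omega> A u" "dirichlet_solution \<Omega> A B \<phi> u"
    then show "(SUP x\<in>\<Omega>. norm (hess u x))
             \<le> C (SUP x\<in>\<Omega>. \<bar>u x\<bar> + norm (grad u x)) *
               (1 + (SUP x\<in>frontier \<Omega>. norm (closure_ext \<Omega> (hess u) x)))"
      by (intro C[rule_format] conjI refl)
  qed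
qed

end
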